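(* Suppose that $0=(0,0,0)$ is a parabolic point of the plane field $\Delta$ at which the two asymptotic directions coincide, with coordinates chosen so that $\xi$ has the expansion at $0$ described in the context. Denote by $\Gamma_1$ and $\Gamma_2$ the asymptotic lines in $\mathbb{H}\cup\mathbb{P}$ (the union of the hyperbolic region and the parabolic set) that pass through $0$. Let $\mathcal{A}$ be the asymptotic direction at $0$ and let $\theta$ be the angle between $\nabla\mathcal{K}(0)$ and $\mathcal{A}$. If $\theta\neq\frac{\pi}{2}$, then the image of the asymptotic lines $\Gamma_1$ and $\Gamma_2$ is locally parameterized by $\gamma:(-\varepsilon,\varepsilon)\to\mathbb{R}^3$, $$\gamma(t)=\left(-\left(\frac{3^{2/3}\,\mathcal{I}}{2^{1/3}(a_{11})^{2/3}}\right)t^2+O(t^3),\ \ t^3+O(t^4),\ \ \left(\frac{3^{2/3}\,\mathcal{I}\,\mathcal{R}}{2^{4/3}\,5\,(a_{11})^{2/3}}\right)t^5+O(t^6)\right),$$ where $\mathcal{I}=|\nabla\mathcal{K}(0)|\,|\mathcal{A}|\cos\theta$ and $\mathcal{R}=\langle \mathrm{curl}(\xi)(0),\xi(0)\rangle$. The curve $\gamma$ is locally of the type of the curve $(t^2,t^3,t^5)$ and has a cuspidal singularity of the type $(t^2,t^3,0)$ at $0$. Furthermore, the asymptotic lines in a neighbourhood of $0$ have the following pictured configuration: there are two foliations of asymptotic lines near the parabolic surface, whose points are cuspidal parabolic points, and if a leaf of one foliation and a leaf of the other start at the same point $P$ of the parabolic surface, then near $P$ the image of these two leaves can be parameterized by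 a curve with a cuspidal point at $P$ of the type $(t^2,t^3,t^5)$.
   Context: Let $\xi=(a,b,c):\mathbb{R}^3\to\mathbb{R}^3$ be a vector field of class $C^k$, $k\ge 3$, and let $\Delta$ be the plane field orthogonal to $\xi$ (defined where $\xi\neq0$). An asymptotic direction at a point is a nonzero vector $dr=(dx,dy,dz)$ (up to scale) with $\langle\xi,dr\rangle=0$ and $\langle d\xi(dr),dr\rangle=0$; an asymptotic line is an integral curve of these equations. Where $c\neq0$, these equations become $dz=-\frac ac dx-\frac bc dy$ and $e\,dx^2+2f\,dx\,dy+g\,dy^2=0$ with $$e=a_x-\frac{(a_z+c_x)a}{c}+\frac{a^2c_z}{c^2},\qquad g=b_y-\frac{(b_z+c_y)b}{c}+\frac{b^2c_z}{c^2},$$ $$f=\frac{a_y+b_x}{2}-\frac{(a_z+c_x)b}{2c}-\frac{(b_z+c_y)a}{2c}+\frac{ab\,c_z}{c^2}.$$ Set $\mathcal{K}=eg-f^2$. A point is parabolic if $\mathcal{K}=0$ and hyperbolic if $\mathcal{K}<0$; $\mathbb{P}$ and $\mathbb{H}$ denote the sets of parabolic and hyperbolic points. Standing assumption: $\mathbb{P}$ is a regular surface and $d\mathcal{K}\neq0$ on it. Normal form: $\xi$ is taken to be a unit vector field (this does not change the asymptotic lines) and coordinates are chosen so that $\xi(0)=(0,0,1)$ and $(1,0,0)$ is an asymptotic direction at $0$. Then near $0$ $$a=a_2y+a_3z+a_{11}x^2+a_{12}xy+a_{13}xz+a_{22}y^2+a_{23}yz+a_{33}z^2+\dots,$$ $$b=b_1x+b_2y+b_3z+b_{11}x^2+b_{12}xy+b_{13}xz+b_{22}y^2+b_{23}yz+b_{33}z^2+\dots,$$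 and $c=1+$ terms of order at least $2$. If $0$ is parabolic with coinciding asymptotic directions, then $a_2=-b_1$, $b_2\ne0$, and the asymptotic direction at $0$ is taken as $\mathcal{A}=(1,0,0)$; if moreover $\theta\ne\frac\pi2$, then $a_{11}\neq0$. $\mathrm{curl}(\xi)=(c_y-b_z,\,a_z-c_x,\,b_x-a_y)$. That $\gamma$ is of the type of $(t^2,t^3,t^5)$ refers to the fact that rescaling the coordinates brings it to the form $(t^2+O(t^3),t^3+O(t^4),t^5+O(t^6))$; a cuspidal singularity of the type $(t^2,t^3,0)$ means that the germ becomes $(t^2,t^3,0)$ after changes of the parameter and of the ambient coordinates.
   Formalization: In both coefficients I is replaced by I^{1/3}/2 (printed values fail for the normalized field (x²/2,−y,1)); type (t²,t³,t⁵) is claimed only where ⟨curl ξ,ξ⟩≠0 at the point, since otherwise the third coordinate is O(t⁶); the coordinate changes for (t²,t³,0) are of class C¹. *)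

theory Defs
  imports "HOL-Analysis.Analysis" "HOL-Library.Landau_Symbols"
begin

section \<open>Differential calculus\<close>

text \<open>Class \<open>C\<^sup>k\<close> on a set, meant for open sets: all iterated directional derivatives
  of order at most \<open>k\<close> exist and are continuous, those of order below \<open>k\<close> being
  Frechet differentiable.\<close>

fun Ck_on :: "nat \<Rightarrow> ('a::real_normed_vector \<Rightarrow> 'b::real_normed_vector) \<Rightarrow> 'a set \<Rightarrow> bool" where
  "Ck_on 0 f S \<longleftrightarrow> continuous_on S f"
| "Ck_on (Suc k) f S \<longleftrightarrow>
     (\<forall>p\<in>S. f differentiable (at p)) \<and> (\<forall>v. Ck_on k (\<lambda>p. frechet_derivative f (at p) v) S)"

definition pd :: "3 \<Rightarrow> (real^3 \<Rightarrow> real) \<Rightarrow> real^3 \<Rightarrow> real" where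
  "pd i f p = frechet_derivative f (at p) (axis i 1)"

definition grad :: "(real^3 \<Rightarrow> real) \<Rightarrow> real^3 \<Rightarrow> real^3" where
  "grad f p = (\<chi> i. pd i f p)"

definition curl :: "(real^3 \<Rightarrow> real^3) \<Rightarrow> real^3 \<Rightarrow> real^3" where
  "curl \<xi> p = vector
     [pd 2 (\<lambda>q. \<xi> q $ 3) p - pd 3 (\<lambda>q. \<xi> q $ 2) p,
      pd 3 (\<lambda>q. \<xi> q $ 1) p - pd 1 (\<lambda>q. \<xi> q $ 3) p,
      pd 1 (\<lambda>q. \<xi> q $ 2) p - pd 2 (\<lambda>q. \<xi> q $ 1) p]"

definition vec_angle :: "real^3 \<Rightarrow> real^3 \<Rightarrow> real" where
  "vec_angle u v = arccos (u \<bullet> v / (norm u * norm v))"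


section \<open>Asymptotic directions, parabolic and hyperbolic points\<close>

definition asym_dir :: "(real^3 \<Rightarrow> real^3) \<Rightarrow> real^3 \<Rightarrow> real^3 \<Rightarrow> bool" where
  "asym_dir \<xi> p v \<longleftrightarrow> v \<noteq> 0 \<and> \<xi> p \<bullet> v = 0 \<and> frechet_derivative \<xi> (at p) v \<bullet> v = 0"

text \<open>The coefficients of the binary equation \<open>e dx\<^sup>2 + 2 f dx dy + g dy\<^sup>2 = 0\<close>,
  meaningful where the third component of \<open>\<xi>\<close> does not vanish.\<close>

definition e_coeff :: "(real^3 \<Rightarrow> real^3) \<Rightarrow> real^3 \<Rightarrow> real" where
  "e_coeff \<xi> p = (let a = (\<lambda>q. \<xi> q $ 1); c = (\<lambda>q. \<xi> q $ 3) in
     pd 1 a p - (pd 3 a p + pd 1 c p) * a p / c p + (a p)\<^sup>2 * pd 3 c p / (c p)\<^sup>2)"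

definition g_coeff :: "(real^3 \<Rightarrow> real^3) \<Rightarrow> real^3 \<Rightarrow> real" where
  "g_coeff \<xi> p = (let b = (\<lambda>q. \<xi> q $ 2); c = (\<lambda>q. \<xi> q $ 3) in
     pd 2 b p - (pd 3 b p + pd 2 c p) * b p / c p + (b p)\<^sup>2 * pd 3 c p / (c p)\<^sup>2)"

definition f_coeff :: "(real^3 \<Rightarrow> real^3) \<Rightarrow> real^3 \<Rightarrow> real" where
  "f_coeff \<xi> p = (let a = (\<lambda>q. \<xi> q $ 1); b = (\<lambda>q. \<xi> q $ 2); c = (\<lambda>q. \<xi> q $ 3) in
     (pd 2 a p + pd 1 b p) / 2 - (pd 3 a p + pd 1 c p) * b p / (2 * c p)
       - (pd 3 b p + pd 2 c p) * a p / (2 * c p) + a p * b p * pd 3 c p / (c p)\<^sup>2)"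

definition KK :: "(real^3 \<Rightarrow> real^3) \<Rightarrow> real^3 \<Rightarrow> real" where
  "KK \<xi> p = e_coeff \<xi> p * g_coeff \<xi> p - (f_coeff \<xi> p)\<^sup>2"

definition parabolic_set :: "(real^3 \<Rightarrow> real^3) \<Rightarrow> (real^3) set \<Rightarrow> (real^3) set" where
  "parabolic_set \<xi> W = {p \<in> W. \<xi> p $ 3 \<noteq> 0 \<and> KK \<xi> p = 0}"

definition hyperbolic_set :: "(real^3 \<Rightarrow> real^3) \<Rightarrow> (real^3) set \<Rightarrow> (real^3) set" where
  "hyperbolic_set \<xi> W = {p \<in> W. \<xi> p $ 3 \<noteq> 0 \<and> KK \<xi> p < 0}"

text \<open>A parabolic point where the two asymptotic directions coincide and span a line
  whose angle with \<open>\<nabla>\<K>\<close> is not \<open>\<pi>/2\<close>.\<close>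

definition cuspidal_parabolic :: "(real^3 \<Rightarrow> real^3) \<Rightarrow> (real^3) set \<Rightarrow> real^3 \<Rightarrow> bool" where
  "cuspidal_parabolic \<xi> W p \<longleftrightarrow> p \<in> parabolic_set \<xi> W \<and>
     (\<exists>A. A \<noteq> 0 \<and> {v. asym_dir \<xi> p v} = {r *\<^sub>R A | r. r \<noteq> 0} \<and>
          vec_angle (grad (KK \<xi>) p) A \<noteq> pi / 2)"


section \<open>Asymptotic lines\<close>

text \<open>\<open>\<Gamma>\<close> is a simple regular asymptotic arc of class \<open>C\<^sup>1\<close> (up to its end points),
  contained in \<open>\<H> \<union> \<P>\<close> and starting at \<open>P\<close>.\<close>

definition asym_arc_from ::
  "(real^3 \<Rightarrow> real^3) \<Rightarrow> (real^3) set \<Rightarrow> real^3 \<Rightarrow> (real^3) set \<Rightarrow> bool" where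
  "asym_arc_from \<xi> W P \<Gamma> \<longleftrightarrow>
     (\<exists>(\<delta>::real) \<sigma> \<sigma>'. \<delta> > 0 \<and> \<sigma> 0 = P \<and> \<Gamma> = \<sigma> ` {0..\<delta>} \<and> inj_on \<sigma> {0..\<delta>} \<and>
        (\<forall>t\<in>{0..\<delta>}. (\<sigma> has_vector_derivative \<sigma>' t) (at t within {0..\<delta>})) \<and>
        continuous_on {0..\<delta>} \<sigma>' \<and>
        (\<forall>t\<in>{0..\<delta>}. \<sigma> t \<in> hyperbolic_set \<xi> W \<union> parabolic_set \<xi> W \<and> asym_dir \<xi> (\<sigma> t) (\<sigma>' t)))"

definition same_germ :: "'a::topological_space \<Rightarrow> 'a set \<Rightarrow> 'a set \<Rightarrow> bool" where
  "same_germ P A B \<longleftrightarrow> (\<exists>V. open V \<and> P \<in> V \<and> A \<inter> V = B \<inter> V)"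

text \<open>The curve \<open>\<gamma>\<close> on \<open>(-\<epsilon>, \<epsilon>)\<close> passes through \<open>P\<close> at time \<open>0\<close>; apart from that point it is
  a regular curve in \<open>\<H>\<close> tangent to asymptotic directions.\<close>

definition asym_param ::
  "(real^3 \<Rightarrow> real^3) \<Rightarrow> (real^3) set \<Rightarrow> real^3 \<Rightarrow> real \<Rightarrow> (real \<Rightarrow> real^3) \<Rightarrow> bool" where
  "asym_param \<xi> W P \<epsilon> \<gamma> \<longleftrightarrow>
     \<gamma> C1_differentiable_on {-\<epsilon><..<\<epsilon>} \<and> inj_on \<gamma> {-\<epsilon><..<\<epsilon>} \<and> \<gamma> 0 = P \<and>
     (\<forall>t\<in>{-\<epsilon><..<\<epsilon>}. t \<noteq> 0 \<longrightarrow>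
        \<gamma> t \<in> hyperbolic_set \<xi> W \<and> asym_dir \<xi> (\<gamma> t) (vector_derivative \<gamma> (at t)))"


section \<open>Types of curve germs\<close>

text \<open>A rescaling of the coordinates brings \<open>\<gamma>\<close> to the form
  \<open>(t\<^sup>2 + O(t\<^sup>3), t\<^sup>3 + O(t\<^sup>4), t\<^sup>5 + O(t\<^sup>6))\<close>.\<close>

definition type_235 :: "(real \<Rightarrow> real^3) \<Rightarrow> bool" where
  "type_235 \<gamma> \<longleftrightarrow>
     (\<exists>l\<^sub>1 l\<^sub>2 l\<^sub>3. l\<^sub>1 \<noteq> 0 \<and> l\<^sub>2 \<noteq> 0 \<and> l\<^sub>3 \<noteq> 0 \<and>
        (\<lambda>t. l\<^sub>1 * \<gamma> t $ 1 - t^2) \<in> O[at 0](\<lambda>t. t^3) \<and>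
        (\<lambda>t. l\<^sub>2 * \<gamma> t $ 2 - t^3) \<in> O[at 0](\<lambda>t. t^4) \<and>
        (\<lambda>t. l\<^sub>3 * \<gamma> t $ 3 - t^5) \<in> O[at 0](\<lambda>t. t^6))"

text \<open>The same at an arbitrary point \<open>P\<close>: the coordinates are first centred at \<open>P\<close> and rotated
  so that the plane field at \<open>P\<close> is horizontal and the asymptotic direction is the first axis.\<close>

definition type_235_at :: "(real^3 \<Rightarrow> real^3) \<Rightarrow> real^3 \<Rightarrow> (real \<Rightarrow> real^3) \<Rightarrow> bool" where
  "type_235_at \<xi> P \<gamma> \<longleftrightarrow>
     (\<exists>Q. orthogonal_transformation Q \<and> Q (\<xi> P) = axis 3 1 \<and>
        (\<forall>v. asym_dir \<xi> P v \<longrightarrow> (\<exists>r. Q v = r *\<^sub>R axis 1 1)) \<and>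
        type_235 (\<lambda>t. Q (\<gamma> t - P)))"

text \<open>After a change \<open>h\<close> of the parameter and a change \<open>\<Phi>\<close> of the ambient coordinates the germ
  of \<open>\<gamma>\<close> at \<open>0\<close> is the germ of \<open>(t\<^sup>2, t\<^sup>3, 0)\<close>. Both changes are local diffeomorphisms of
  class \<open>C\<^sup>1\<close>.\<close>

definition cusp_230 :: "real^3 \<Rightarrow> (real \<Rightarrow> real^3) \<Rightarrow> bool" where
  "cusp_230 P \<gamma> \<longleftrightarrow>
     (\<exists>V V' (\<Phi> :: real^3 \<Rightarrow> real^3) \<Psi> h (\<eta>::real). open V \<and> P \<in> V \<and> open V' \<and> homeomorphism V V' \<Phi> \<Psi> \<and>
        Ck_on 1 \<Phi> V \<and> Ck_on 1 \<Psi> V' \<and> \<Phi> P = 0 \<and>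
        \<eta> > 0 \<and> h C1_differentiable_on {-\<eta><..<\<eta>} \<and> h 0 = 0 \<and>
        (\<forall>s\<in>{-\<eta><..<\<eta>}. vector_derivative h (at s) \<noteq> 0) \<and>
        (\<forall>s\<in>{-\<eta><..<\<eta>}. \<gamma> (h s) \<in> V \<and> \<Phi> (\<gamma> (h s)) = vector [s^2, s^3, 0]))"


text \<open>For the curve of asymptotic lines at the origin, with \<open>A = (1,0,0)\<close> and
  \<open>\<I> = |\<nabla>\<K>(0)| |A| cos \<theta> = 2 a\<^sub>1\<^sub>1 b\<^sub>2\<close>: inserting \<open>x = - \<alpha> t\<^sup>2\<close>, \<open>y = t\<^sup>3\<close> in the leading part
  \<open>2 a\<^sub>1\<^sub>1 x dx\<^sup>2 + b\<^sub>2 dy\<^sup>2 = 0\<close> of the binary equation gives \<open>8 a\<^sub>1\<^sub>1 \<alpha>\<^sup>3 = 9 b\<^sub>2\<close>, that is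
  \<open>\<alpha> = 3 powr (2/3) * root 3 \<I> / (2 powr (4/3) * (root 3 a\<^sub>1\<^sub>1)^2)\<close>; since \<open>\<R> = - 2 a\<^sub>2\<close>, the equation
  \<open>dz = - a\<^sub>2 (y dx - x dy) + \<dots>\<close> then gives \<open>z = \<alpha> \<R> t\<^sup>5 / 10 + \<dots>\<close>. The cube root of \<open>\<I>\<close>
  cannot be replaced by \<open>\<I>\<close>. If \<open>\<R> = 0\<close> the third coordinate is \<open>O(t\<^sup>6)\<close>, and then no
  rescaling gives \<open>type_235\<close>.\<close>


section \<open>Foliations by asymptotic lines\<close>

text \<open>A one-dimensional foliation of the open set \<open>M\<close>: a partition into connected leaves such
  that \<open>M\<close> is covered by flow boxes, in which the components of each leaf are plaques.\<close>

definition foliation :: "(real^3) set \<Rightarrow> (real^3) set set \<Rightarrow> bool" where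
  "foliation M \<F> \<longleftrightarrow> partition_on M \<F> \<and> (\<forall>L\<in>\<F>. connected L) \<and>
     (\<forall>p\<in>M. \<exists>V (h :: real^3 \<Rightarrow> (real^2) \<times> real) k. open V \<and> p \<in> V \<and> V \<subseteq> M \<and>
        homeomorphism V (ball 0 1 \<times> {-1<..<1}) h k \<and>
        (\<forall>L\<in>\<F>. \<forall>C\<in>components (L \<inter> V). \<exists>d. h ` C = {d} \<times> {-1<..<1}))"

text \<open>The leaves are moreover (injective) integral curves of a continuous field \<open>X\<close> of
  asymptotic directions.\<close>

definition asym_foliation ::
  "(real^3 \<Rightarrow> real^3) \<Rightarrow> (real^3) set \<Rightarrow> (real^3 \<Rightarrow> real^3) \<Rightarrow> (real^3) set set \<Rightarrow> bool" where
  "asym_foliation \<xi> M X \<F> \<longleftrightarrow> foliation M \<F> \<and> continuous_on M X \<and> (\<forall>q\<in>M. asym_dir \<xi> q (X q)) \<and>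
     (\<forall>L\<in>\<F>. \<exists>I \<sigma>. open I \<and> is_interval I \<and> I \<noteq> {} \<and> inj_on \<sigma> I \<and> \<sigma> ` I = L \<and>
        (\<forall>t\<in>(I::real set). (\<sigma> has_vector_derivative X (\<sigma> t)) (at t)))"

definition leaf_starts_at ::
  "(real^3 \<Rightarrow> real^3) \<Rightarrow> (real^3) set \<Rightarrow> (real^3) set \<Rightarrow> real^3 \<Rightarrow> bool" where
  "leaf_starts_at \<xi> W L P \<longleftrightarrow> (\<exists>\<Gamma>. asym_arc_from \<xi> W P \<Gamma> \<and> \<Gamma> - {P} \<subseteq> L)"

end

theory Submission
  imports Defs
begin

text \<open>
  Completing the square turns \<open>e dx\<^sup>2 + 2 f dx dy + g dy\<^sup>2 = 0\<close> into
  \<open>(g dy + f dx)\<^sup>2 = - \<K> dx\<^sup>2\<close>. On the double cover \<open>s\<^sup>2 = - \<K>\<close> of \<open>\<H> \<union> \<P>\<close>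
  the two asymptotic directions therefore become one direction
  \<open>T(s, p) = (1, (s - f) / g, \<dots>)\<close>, which is as smooth as \<open>e\<close>, \<open>f\<close>, \<open>g\<close> and affine in \<open>s\<close>
  (\<open>asym_dir_iff_lift_dir\<close>). The condition \<open>\<theta> \<noteq> \<pi>/2\<close> says that \<open>d\<K>(T) \<noteq> 0\<close> at \<open>0\<close>, hence nearby.
  So \<open>s\<close> itself can be the parameter of the lines: \<open>- 2 s ds = d\<K>\<close> leads to the equation
  \<open>dp/ds = s N(s, p)\<close> with \<open>N = - 2 T / d\<K>(T)\<close>. Its right-hand side is Lipschitz, and
  \<open>\<K> + s\<^sup>2\<close> is constant along solutions (\<open>first_integral\<close>).

  A solution \<open>\<gamma>\<close> that starts for \<open>s = 0\<close> at a point \<open>P\<close> of \<open>\<P>\<close> thus stays on the double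
  cover. Its part \<open>s > 0\<close> is a line of one family, its part \<open>s < 0\<close> a line of the other,
  and \<open>s = 0\<close> is where the velocity vanishes. There are no further arcs at \<open>P\<close>: along any arc
  from \<open>P\<close> the function \<open>\<K>\<close> decreases strictly, so the arc can be reparametrised by
  \<open>\<plusminus> sqrt (- \<K>)\<close>, after which it solves the same equation with the same initial value
  (\<open>arc_germ\<close>). Following the lines back to \<open>s = 0\<close> straightens each of the two families: the
  pair (starting point, \<open>s\<close>) is a continuous injective chart, by invariance of domain a
  homeomorphism onto an open set, and the leaves are its vertical lines
  (\<open>foliation_chart_leaves\<close>, \<open>asym_foliation_leaves\<close>).

  Since \<open>T\<close> is affine in \<open>s\<close> and \<open>\<gamma>(s) - P = O(s\<^sup>2)\<close>, the velocity is
  \<open>2 s A + 3 s\<^sup>2 E + O(s\<^sup>3)\<close> with independent vectors \<open>A\<close>, \<open>E\<close> of the plane at \<open>P\<close>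
  (\<open>cusp_velocity_expansion\<close>). The component along \<open>\<xi>(P)\<close> is smaller: as \<open>\<gamma>'\<close> is orthogonal
  to \<open>\<xi>(\<gamma>)\<close>, its derivative is \<open>- \<langle>\<gamma>', \<xi>(\<gamma>) - \<xi>(P)\<rangle>\<close>. There the cubic term is zero because
  \<open>A\<close> is asymptotic, and because this direction is double the term in \<open>s\<^sup>4\<close> involves only the
  skew part of \<open>d\<xi>(P)\<close>, that is \<open>\<langle>curl \<xi>, \<xi>\<rangle>\<close>
  (\<open>normal_coordinate_expansion\<close>, \<open>twist_curl\<close>). At \<open>0\<close> the coordinates are already adapted, and
  a linear change of \<open>s\<close> gives the coefficients of the theorem (\<open>cusp_constants\<close>).

  The expansion of the velocity also gives the type \<open>(t\<^sup>2, t\<^sup>3, 0)\<close>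
  (\<open>cusp_230_if_expansion\<close>): the remainder of \<open>\<gamma>\<close> after the terms \<open>s\<^sup>2 A + s\<^sup>3 E\<close> can be written
  as a \<open>C\<^sup>1\<close> function of \<open>(s\<^sup>2, s\<^sup>3)\<close> with vanishing derivative at the origin, so
  the cusp is the image of the standard one under a local diffeomorphism.
\<close>

section \<open>Ordinary differential equations with a Lipschitz right-hand side\<close>

lemma vector_derivative_within_open_interval:
  fixes f :: "real \<Rightarrow> 'a::real_normed_vector"
  assumes "t \<in> {a<..<b}"
  shows "(f has_vector_derivative d) (at t within {a..b}) \<longleftrightarrow> (f has_vector_derivative d) (at t)"
proof -
  have "at t within {a..b} = at t"
    using assms by (intro at_within_interior) auto
  then show ?thesis by simp
qed

text \<open>The interval is so short that the integral equation is a contraction with factor \<open>1/2\<close> in the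
  supremum norm. Evaluating it at the point where the difference is largest bounds this maximum
  by twice the difference at any single time.\<close>

lemma lipschitz_ode_dependence:
  fixes F :: "real \<Rightarrow> 'a::real_normed_vector \<Rightarrow> 'a"
  assumes L: "\<And>s p q. s \<in> {-S..S} \<Longrightarrow> norm (F s p - F s q) \<le> L * norm (p - q)"
    and small: "0 \<le> S" "0 \<le> L" "4 * L * S \<le> 1"
    and y1: "\<And>s. s \<in> {-S..S} \<Longrightarrow> (y1 has_vector_derivative F s (y1 s)) (at s within {-S..S})"
    and y2: "\<And>s. s \<in> {-S..S} \<Longrightarrow> (y2 has_vector_derivative F s (y2 s)) (at s within {-S..S})"
    and s: "s \<in> {-S..S}" "s' \<in> {-S..S}"
  shows "norm (y1 s - y2 s) \<le> 2 * norm (y1 s' - y2 s')"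
proof -
  define w where "w r = y1 r - y2 r" for r
  have w': "(w has_vector_derivative F r (y1 r) - F r (y2 r)) (at r within {-S..S})" if "r \<in> {-S..S}" for r
    unfolding w_def using y1 y2 that by (intro has_vector_derivative_diff) auto
  have cont: "continuous_on {-S..S} (\<lambda>r. norm (w r))"
    using w' by (intro continuous_on_norm) (meson has_vector_derivative_continuous continuous_on_eq_continuous_within)
  obtain m where m: "m \<in> {-S..S}" "\<And>r. r \<in> {-S..S} \<Longrightarrow> norm (w r) \<le> norm (w m)"
    using continuous_attains_sup[OF compact_Icc _ cont] small by auto
  have "norm (w m - w s') \<le> (L * norm (w m)) * norm (m - s')"
  proof (rule differentiable_bound[where S = "{-S..S}" and f' = "\<lambda>r h. h *\<^sub>R (F r (y1 r) - F r (y2 r))"])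
    fix r assume r: "r \<in> {-S..S}"
    show "(w has_derivative (\<lambda>h. h *\<^sub>R (F r (y1 r) - F r (y2 r)))) (at r within {-S..S})"
      using w'[OF r] by (simp add: has_vector_derivative_def)
    have "norm (F r (y1 r) - F r (y2 r)) \<le> L * norm (w r)" using L[OF r] by (simp add: w_def)
    also have "\<dots> \<le> L * norm (w m)" using m r small by (intro mult_left_mono) auto
    finally show "onorm (\<lambda>h. h *\<^sub>R (F r (y1 r) - F r (y2 r))) \<le> L * norm (w m)"
      using onorm_scaleR_left[of "\<lambda>h. h" "F r (y1 r) - F r (y2 r)"]
      by (simp add: bounded_linear_ident onorm_id)
  qed (use m s in auto)
  also have "\<dots> \<le> (L * norm (w m)) * (2 * S)"
    using m s small by (intro mult_left_mono) (auto simp: abs_le_iff)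
  also have "\<dots> = (2 * L * S) * norm (w m)" by simp
  also have "\<dots> \<le> (1/2) * norm (w m)" using small by (intro mult_right_mono) auto
  finally have "norm (w m) \<le> 2 * norm (w s')"
    using norm_triangle_ineq2[of "w m" "w s'"] by linarith
  with m(2)[OF s(1)] show ?thesis by (simp add: w_def)
qed

text \<open>Banach's fixed point theorem for the integral operator on bounded continuous functions on the
  line. Functions are read off only at the retraction \<open>c\<close> of the line to \<open>[-S, S]\<close>.\<close>

theorem lipschitz_ode_existence:
  fixes F :: "real \<Rightarrow> 'a::euclidean_space \<Rightarrow> 'a"
  assumes cont: "continuous_on ({-S..S} \<times> UNIV) (\<lambda>(s, p). F s p)"
    and L: "\<And>s p q. s \<in> {-S..S} \<Longrightarrow> norm (F s p - F s q) \<le> L * norm (p - q)"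
    and B: "\<And>s p. s \<in> {-S..S} \<Longrightarrow> norm (F s p) \<le> B"
    and small: "0 \<le> S" "0 \<le> L" "4 * L * S \<le> 1"
    and s0: "s0 \<in> {-S..S}"
  shows "\<exists>y. y s0 = q \<and> (\<forall>s\<in>{-S..S}. (y has_vector_derivative F s (y s)) (at s within {-S..S}))"
proof -
  define J where "J y s = integral {-S..s} (\<lambda>r. F r (y r))" for y :: "real \<Rightarrow> 'a" and s
  define c where "c s = max (-S) (min S s)" for s
  have c_in: "c s \<in> {-S..S}" for s using small by (auto simp: c_def)
  have c_id: "c s = s" if "s \<in> {-S..S}" for s using that by (auto simp: c_def)
  have c_cont: "continuous_on A c" for A unfolding c_def by (intro continuous_intros)
  have Fy: "continuous_on {-S..S} (\<lambda>r. F r (y r))" if "continuous_on {-S..S} y" for y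
  proof -
    have "continuous_on {-S..S} (\<lambda>r. (r, y r))" using that by (intro continuous_intros)
    from continuous_on_compose2[OF cont this] show ?thesis by auto
  qed
  have J': "(J y has_vector_derivative F s (y s)) (at s within {-S..S})"
    if "continuous_on {-S..S} y" "s \<in> {-S..S}" for y s
    unfolding J_def using integral_has_vector_derivative[OF Fy[OF that(1)] that(2)] .
  have Jc: "continuous_on UNIV (\<lambda>s. J y (c s))" if "continuous_on {-S..S} y" for y
  proof -
    have "continuous_on {-S..S} (J y)"
      using J'[OF that] by (meson has_vector_derivative_continuous continuous_on_eq_continuous_within)
    then show ?thesis by (rule continuous_on_compose2) (use c_cont c_in in auto)
  qed
  define T where "T y = (\<lambda>s. q + J y (c s) - J y (c s0))" for y
  have T_diff: "norm (T y s - T z s) \<le> (1/2) * M"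
    if y: "continuous_on {-S..S} y" and z: "continuous_on {-S..S} z"
      and M: "\<And>r. r \<in> {-S..S} \<Longrightarrow> norm (y r - z r) \<le> M" for y z s M
  proof -
    have "norm (y 0 - z 0) \<le> M" using M[of 0] small by auto
    then have M0: "0 \<le> M" by (rule order_trans[OF norm_ge_zero])
    have "norm ((J y (c s) - J z (c s)) - (J y (c s0) - J z (c s0))) \<le> (L * M) * norm (c s - c s0)"
    proof (rule differentiable_bound[where S = "{-S..S}" and f' = "\<lambda>r h. h *\<^sub>R (F r (y r) - F r (z r))"])
      fix r assume r: "r \<in> {-S..S}"
      show "((\<lambda>r. J y r - J z r) has_derivative (\<lambda>h. h *\<^sub>R (F r (y r) - F r (z r)))) (at r within {-S..S})"
        using has_vector_derivative_diff[OF J'[OF y r] J'[OF z r]] by (simp add: has_vector_derivative_def)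
      have "norm (F r (y r) - F r (z r)) \<le> L * norm (y r - z r)" using L[OF r] .
      also have "\<dots> \<le> L * M" using M r small by (intro mult_left_mono) auto
      finally show "onorm (\<lambda>h. h *\<^sub>R (F r (y r) - F r (z r))) \<le> L * M"
        using onorm_scaleR_left[of "\<lambda>h. h" "F r (y r) - F r (z r)"]
        by (simp add: bounded_linear_ident onorm_id)
    qed (use c_in in auto)
    also have "\<dots> \<le> (L * M) * (2 * S)"
      using c_in[of s] c_in[of s0] small M0 by (intro mult_left_mono) (auto simp: abs_le_iff)
    also have "\<dots> = (2 * L * S) * M" by simp
    also have "\<dots> \<le> (1/2) * M" using small M0 by (intro mult_right_mono) auto
    finally show ?thesis by (simp add: T_def algebra_simps)
  qed
  have T_bcont: "T y \<in> bcontfun" if y: "continuous_on {-S..S} y" for y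
  proof -
    have "\<exists>b. \<forall>s. norm (J y (c s)) \<le> b"
    proof -
      have "compact (J y ` {-S..S})"
        using J'[OF y] by (intro compact_continuous_image compact_Icc)
          (meson has_vector_derivative_continuous continuous_on_eq_continuous_within)
      then have "bounded (J y ` {-S..S})" by (rule compact_imp_bounded)
      then obtain b where "\<forall>v\<in>J y ` {-S..S}. norm v \<le> b" unfolding bounded_iff by auto
      then have "norm (J y (c s)) \<le> b" for s using c_in[of s] by auto
      then show ?thesis by blast
    qed
    then obtain b where b: "\<And>s. norm (J y (c s)) \<le> b" by blast
    have "norm (T y s) \<le> norm q + b + b" for s
      unfolding T_def using b[of s] b[of s0] norm_triangle_ineq[of q "J y (c s)"]
        norm_triangle_ineq4[of "q + J y (c s)" "J y (c s0)"] by linarith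
    moreover have "continuous_on UNIV (T y)" unfolding T_def by (intro continuous_intros Jc y)
    ultimately show ?thesis by (intro bcontfun_normI)
  qed
  define TT where "TT y = Bcontfun (T (apply_bcontfun y))" for y :: "real \<Rightarrow>\<^sub>C 'a"
  have TT: "apply_bcontfun (TT y) = T (apply_bcontfun y)" for y
    unfolding TT_def by (rule Bcontfun_inverse) (rule T_bcont, simp)
  have "\<exists>!y. TT y = y"
  proof (rule banach_fix_type[of "1/2"])
    show "\<forall>x y. dist (TT x) (TT y) \<le> 1 / 2 * dist x y"
    proof (intro allI)
      fix x y :: "real \<Rightarrow>\<^sub>C 'a"
      show "dist (TT x) (TT y) \<le> 1/2 * dist x y"
      proof (rule dist_bound)
        fix s
        have "norm (T x s - T y s) \<le> (1/2) * dist x y"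
          by (rule T_diff) (auto simp: dist_bounded simp flip: dist_norm)
        then show "dist (apply_bcontfun (TT x) s) (apply_bcontfun (TT y) s) \<le> 1/2 * dist x y"
          by (simp add: TT dist_norm)
      qed
    qed
  qed auto
  then obtain y where "TT y = y" by blast
  then have fix_y: "T (apply_bcontfun y) = apply_bcontfun y" by (metis TT)
  let ?y = "apply_bcontfun y"
  have "(?y has_vector_derivative F s (?y s)) (at s within {-S..S})" if s: "s \<in> {-S..S}" for s
  proof -
    have "((\<lambda>r. q + J ?y r - J ?y s0) has_vector_derivative F s (?y s)) (at s within {-S..S})"
      using J'[of ?y s] s by (auto intro!: derivative_eq_intros)
    moreover have "q + J ?y r - J ?y s0 = ?y r" if "r \<in> {-S..S}" for r
      using fun_cong[OF fix_y, of r] c_id[OF that] c_id[OF s0] by (simp add: T_def)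
    ultimately show ?thesis
      by (intro has_vector_derivative_transform[OF s, of ?y "\<lambda>r. q + J ?y r - J ?y s0"]) auto
  qed
  moreover have "?y s0 = q" using fun_cong[OF fix_y, of s0] by (simp add: T_def)
  ultimately show ?thesis by blast
qed

section \<open>Functions of class \<open>C\<^sup>k\<close>\<close>

text \<open>Only values near each point of the open set matter for iterated derivatives.\<close>

lemma Ck_on_cong:
  assumes "open S" "\<And>x. x \<in> S \<Longrightarrow> f x = g x"
  shows "Ck_on k f S \<longleftrightarrow> Ck_on k g S"
  using assms(2)
proof (induction k arbitrary: f g)
  case 0
  then show ?case by (simp cong: continuous_on_cong)
next
  case (Suc k)
  have ev: "(f has_derivative D) (at p) \<longleftrightarrow> (g has_derivative D) (at p)" if "p \<in> S" for p D
    using Suc.prems assms(1) that has_derivative_transform_within_open by metis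
  have "f differentiable (at p) \<longleftrightarrow> g differentiable (at p)"
    "frechet_derivative f (at p) = frechet_derivative g (at p)" if "p \<in> S" for p
    using ev[OF that] unfolding differentiable_def frechet_derivative_def by auto
  then show ?case using Suc.IH[of "\<lambda>p. frechet_derivative f (at p) _" "\<lambda>p. frechet_derivative g (at p) _"]
    by auto
qed

lemma Ck_on_SucD: "Ck_on (Suc k) f S \<Longrightarrow> Ck_on k f S"
proof (induction k arbitrary: f)
  case 0
  then show ?case
    by (auto intro!: continuous_at_imp_continuous_on differentiable_imp_continuous_within)
next
  case (Suc k)
  from Suc.prems have "\<forall>p\<in>S. f differentiable (at p)"
    and "\<forall>v. Ck_on (Suc k) (\<lambda>p. frechet_derivative f (at p) v) S" by simp_all
  with Suc.IH show ?case by (simp only: Ck_on.simps(2)[of k f]) blast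
qed

lemma Ck_on_le: "Ck_on k f S \<Longrightarrow> j \<le> k \<Longrightarrow> Ck_on j f S"
  by (induction k) (auto simp: le_Suc_eq simp del: Ck_on.simps dest: Ck_on_SucD)

lemma Ck_on_subset: "Ck_on k f S \<Longrightarrow> T \<subseteq> S \<Longrightarrow> Ck_on k f T"
  by (induction k arbitrary: f) (auto intro: continuous_on_subset)

text \<open>Any explicit formula for the derivative may replace \<open>frechet_derivative\<close>; this makes the closure
  properties below inductions over the usual rules of differentiation.\<close>

lemma Ck_on_SucI:
  assumes "open S" "\<And>p. p \<in> S \<Longrightarrow> (f has_derivative f' p) (at p)"
    "\<And>v. Ck_on k (\<lambda>p. f' p v) S"
  shows "Ck_on (Suc k) f S"
proof -
  have "frechet_derivative f (at p) = f' p" if "p \<in> S" for p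
    using assms(2)[OF that] frechet_derivative_at by metis
  then have "Ck_on k (\<lambda>p. frechet_derivative f (at p) v) S" for v
    using assms(3) Ck_on_cong[OF assms(1), of "\<lambda>p. frechet_derivative f (at p) v" "\<lambda>p. f' p v"] by simp
  then show ?thesis using assms(2) by (auto simp: differentiable_def)
qed

lemma Ck_on_SucE:
  assumes "Ck_on (Suc k) f S"
  shows "\<And>p. p \<in> S \<Longrightarrow> (f has_derivative frechet_derivative f (at p)) (at p)"
    "\<And>v. Ck_on k (\<lambda>p. frechet_derivative f (at p) v) S"
  using assms by (auto simp flip: frechet_derivative_works)

lemma Ck_on_const [intro, simp]: "Ck_on k (\<lambda>_. c) S"
  by (induction k arbitrary: c) auto

lemma Ck_on_bounded_linear:
  assumes "bounded_linear T" "open S" "Ck_on k f S"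
  shows "Ck_on k (\<lambda>p. T (f p)) S"
  using assms(3)
proof (induction k arbitrary: f)
  case 0
  then show ?case using assms(1)
    by (auto intro: continuous_on_compose2[OF linear_continuous_on[of T UNIV]])
next
  case (Suc k)
  note D = Ck_on_SucE[OF Suc.prems]
  show ?case
    by (rule Ck_on_SucI[OF assms(2), where f' = "\<lambda>p v. T (frechet_derivative f (at p) v)"])
      (use D Suc.IH in \<open>auto intro!: bounded_linear.has_derivative[OF assms(1)]\<close>)
qed

lemma Ck_on_add:
  assumes "open S" "Ck_on k f S" "Ck_on k g S"
  shows "Ck_on k (\<lambda>p. f p + g p) S"
  using assms(2,3)
proof (induction k arbitrary: f g)
  case 0
  then show ?case by (auto intro: continuous_intros)
next
  case (Suc k)
  note D = Ck_on_SucE[OF Suc.prems(1)] Ck_on_SucE[OF Suc.prems(2)]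
  show ?case
    by (rule Ck_on_SucI[OF assms(1)], rule has_derivative_add) (use D Suc.IH in auto)
qed

lemma Ck_on_mult:
  fixes f g :: "'a::real_normed_vector \<Rightarrow> real"
  assumes "open S" "Ck_on k f S" "Ck_on k g S"
  shows "Ck_on k (\<lambda>p. f p * g p) S"
  using assms(2,3)
proof (induction k arbitrary: f g)
  case 0
  then show ?case by (auto intro: continuous_intros)
next
  case (Suc k)
  note D = Ck_on_SucE[OF Suc.prems(1)] Ck_on_SucE[OF Suc.prems(2)]
  show ?case
    by (rule Ck_on_SucI[OF assms(1)], rule has_derivative_mult)
      (use D Suc.IH Suc.prems[THEN Ck_on_SucD] in \<open>auto intro!: Ck_on_add[OF assms(1)]\<close>)
qed

lemma Ck_on_inverse:
  fixes f :: "'a::real_normed_vector \<Rightarrow> real"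
  assumes "open S" "Ck_on k f S" "\<And>p. p \<in> S \<Longrightarrow> f p \<noteq> 0"
  shows "Ck_on k (\<lambda>p. inverse (f p)) S"
  using assms(2,3)
proof (induction k)
  case 0
  then show ?case by (auto intro: continuous_intros)
next
  case (Suc k)
  note D = Ck_on_SucE[OF Suc.prems(1)]
  have I: "Ck_on k (\<lambda>p. inverse (f p)) S" using Suc Ck_on_SucD by blast
  show ?case
  proof (rule Ck_on_SucI[OF assms(1)])
    show "((\<lambda>p. inverse (f p)) has_derivative
        (\<lambda>v. (- 1) * (inverse (f p) * frechet_derivative f (at p) v * inverse (f p)))) (at p)"
      if "p \<in> S" for p
      using Deriv.has_derivative_inverse[OF Suc.prems(2)[OF that] D(1)[OF that]] by simp
    show "Ck_on k (\<lambda>p. (- 1) * (inverse (f p) * frechet_derivative f (at p) v * inverse (f p))) S" for v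
      using D(2) I by (intro Ck_on_mult[OF assms(1)] Ck_on_const)
  qed
qed

lemma Ck_on_diff:
  fixes f g :: "'a::real_normed_vector \<Rightarrow> real"
  assumes "open S" "Ck_on k f S" "Ck_on k g S"
  shows "Ck_on k (\<lambda>p. f p - g p) S"
  using Ck_on_add[OF assms(1,2) Ck_on_mult[OF assms(1) Ck_on_const[of k "-1"] assms(3)]] by simp

lemma Ck_on_divide:
  fixes f g :: "'a::real_normed_vector \<Rightarrow> real"
  assumes "open S" "Ck_on k f S" "Ck_on k g S" "\<And>p. p \<in> S \<Longrightarrow> g p \<noteq> 0"
  shows "Ck_on k (\<lambda>p. f p / g p) S"
  unfolding divide_inverse by (intro Ck_on_mult Ck_on_inverse assms)

lemma Ck_on_power:
  fixes f :: "'a::real_normed_vector \<Rightarrow> real"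
  assumes "open S" "Ck_on k f S"
  shows "Ck_on k (\<lambda>p. f p ^ n) S"
  by (induction n) (auto intro: Ck_on_mult assms)

lemmas Ck_on_intros = Ck_on_const Ck_on_add Ck_on_diff Ck_on_mult Ck_on_divide Ck_on_power

lemma Ck_on_nth:
  fixes f :: "'a::real_normed_vector \<Rightarrow> real^'n"
  assumes "open S" "Ck_on k f S"
  shows "Ck_on k (\<lambda>p. f p $ i) S"
  by (rule Ck_on_bounded_linear[OF bounded_linear_vec_nth assms])

lemma Ck_on_pd: "Ck_on (Suc k) f S \<Longrightarrow> Ck_on k (pd i f) S"
  by (simp add: pd_def[abs_def])

lemma has_derivative_grad:
  assumes "f differentiable (at p)"
  shows "(f has_derivative (\<lambda>v. grad f p \<bullet> v)) (at p)"
proof -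
  have D: "(f has_derivative frechet_derivative f (at p)) (at p)"
    using assms frechet_derivative_works by blast
  then interpret linear "frechet_derivative f (at p)" by (rule has_derivative_linear)
  have "frechet_derivative f (at p) v = grad f p \<bullet> v" for v :: "real^3"
  proof -
    have "frechet_derivative f (at p) v = frechet_derivative f (at p) (\<Sum>i\<in>UNIV. v $ i *\<^sub>R axis i 1)"
      by (simp add: basis_expansion flip: scalar_mult_eq_scaleR)
    also have "\<dots> = grad f p \<bullet> v"
      by (simp add: sum scale inner_vec_def grad_def pd_def mult.commute)
    finally show ?thesis .
  qed
  then have "frechet_derivative f (at p) = (\<lambda>v. grad f p \<bullet> v)" by (rule ext)
  then show ?thesis using D by simp
qed

lemma Ck_on_grad:
  assumes "Ck_on 1 f S"
  shows "continuous_on S (grad f)"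
  unfolding grad_def using Ck_on_pd[of 0 f S] assms
  by (intro continuous_on_vec_lambda) auto

section \<open>Bounded Lipschitz functions\<close>

text \<open>The lifted field is an algebraic expression in the coefficients and in \<open>\<nabla>\<K>\<close>. Bounded Lipschitz
  functions are closed under the operations that occur, division by functions bounded away from
  \<open>0\<close> included, so its Lipschitz constant needs no formula for its derivative.\<close>

definition lip_bd_on :: "'a::metric_space set \<Rightarrow> ('a \<Rightarrow> 'b::real_normed_vector) \<Rightarrow> bool" where
  "lip_bd_on Z f \<longleftrightarrow> (\<exists>L\<ge>0. \<forall>x\<in>Z. norm (f x) \<le> L \<and> (\<forall>y\<in>Z. norm (f x - f y) \<le> L * dist x y))"

lemma lip_bd_onI:
  assumes "\<And>x. x \<in> Z \<Longrightarrow> norm (f x) \<le> M" "\<And>x y. x \<in> Z \<Longrightarrow> y \<in> Z \<Longrightarrow> norm (f x - f y) \<le> L * dist x y"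
  shows "lip_bd_on Z f"
  unfolding lip_bd_on_def
proof (intro exI[of _ "max 0 (max L M)"] conjI ballI)
  fix x y assume "x \<in> Z" "y \<in> Z"
  have "L * dist x y \<le> max 0 (max L M) * dist x y" by (intro mult_right_mono) auto
  with assms(2)[OF \<open>x \<in> Z\<close> \<open>y \<in> Z\<close>] show "norm (f x - f y) \<le> max 0 (max L M) * dist x y" by linarith
  show "norm (f x) \<le> max 0 (max L M)" using assms(1)[OF \<open>x \<in> Z\<close>] by auto
qed simp

lemma lip_bd_onE:
  assumes "lip_bd_on Z f"
  obtains L where "0 \<le> L" "\<And>x. x \<in> Z \<Longrightarrow> norm (f x) \<le> L"
    "\<And>x y. x \<in> Z \<Longrightarrow> y \<in> Z \<Longrightarrow> norm (f x - f y) \<le> L * dist x y"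
  using assms unfolding lip_bd_on_def by blast

lemma lip_bd_on_subset: "lip_bd_on Z f \<Longrightarrow> Y \<subseteq> Z \<Longrightarrow> lip_bd_on Y f"
  unfolding lip_bd_on_def by blast

lemma lip_bd_on_const: "lip_bd_on Z (\<lambda>_. c)"
  by (rule lip_bd_onI[of _ _ "norm c" 0]) auto

lemma lip_bd_on_add:
  assumes "lip_bd_on Z f" "lip_bd_on Z g" shows "lip_bd_on Z (\<lambda>x. f x + g x)"
proof -
  from assms(1) obtain L where L: "0 \<le> L" "\<And>x. x \<in> Z \<Longrightarrow> norm (f x) \<le> L"
    "\<And>x y. x \<in> Z \<Longrightarrow> y \<in> Z \<Longrightarrow> norm (f x - f y) \<le> L * dist x y" by (rule lip_bd_onE) (rule that; blast)
  from assms(2) obtain M where M: "0 \<le> M" "\<And>x. x \<in> Z \<Longrightarrow> norm (g x) \<le> M"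
    "\<And>x y. x \<in> Z \<Longrightarrow> y \<in> Z \<Longrightarrow> norm (g x - g y) \<le> M * dist x y" by (rule lip_bd_onE) (rule that; blast)
  show ?thesis
  proof (rule lip_bd_onI[of _ _ "L + M" "L + M"])
    fix x y assume xy: "x \<in> Z" "y \<in> Z"
    show "norm (f x + g x) \<le> L + M" using L(2) M(2) xy norm_triangle_mono by blast
    have "f x + g x - (f y + g y) = (f x - f y) + (g x - g y)" by simp
    then show "norm (f x + g x - (f y + g y)) \<le> (L + M) * dist x y"
      using norm_triangle_mono[OF L(3)[OF xy] M(3)[OF xy]] by (simp add: algebra_simps)
  qed
qed

lemma lip_bd_on_bounded_bilinear:
  assumes "bounded_bilinear bl" "lip_bd_on Z f" "lip_bd_on Z g"
  shows "lip_bd_on Z (\<lambda>x. bl (f x) (g x))"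
proof -
  interpret bounded_bilinear bl by fact
  from assms(2) obtain L where L: "0 \<le> L" "\<And>x. x \<in> Z \<Longrightarrow> norm (f x) \<le> L"
    "\<And>x y. x \<in> Z \<Longrightarrow> y \<in> Z \<Longrightarrow> norm (f x - f y) \<le> L * dist x y" by (rule lip_bd_onE) (rule that; blast)
  from assms(3) obtain M where M: "0 \<le> M" "\<And>x. x \<in> Z \<Longrightarrow> norm (g x) \<le> M"
    "\<And>x y. x \<in> Z \<Longrightarrow> y \<in> Z \<Longrightarrow> norm (g x - g y) \<le> M * dist x y" by (rule lip_bd_onE) (rule that; blast)
  obtain K where K: "0 \<le> K" "\<And>a b. norm (bl a b) \<le> norm a * norm b * K"
    using nonneg_bounded by blast
  have le: "norm (bl a b) \<le> A * B * K" if "norm a \<le> A" "norm b \<le> B" for a b A B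
  proof -
    have "0 \<le> A" using that(1) norm_ge_zero[of a] by linarith
    then have "norm a * norm b * K \<le> A * B * K"
      using that K(1) by (intro mult_right_mono mult_mono) auto
    then show ?thesis using K(2)[of a b] by linarith
  qed
  show ?thesis
  proof (rule lip_bd_onI[of _ _ "L * M * K" "2 * L * M * K"])
    fix x y assume xy: "x \<in> Z" "y \<in> Z"
    show "norm (bl (f x) (g x)) \<le> L * M * K" using le L(2) M(2) xy by blast
    have "bl (f x) (g x) - bl (f y) (g y) = bl (f x - f y) (g x) + bl (f y) (g x - g y)"
      by (simp add: diff_left diff_right)
    also have "norm \<dots> \<le> (L * dist x y) * M * K + L * (M * dist x y) * K"
      by (intro norm_triangle_mono le) (use L M xy in auto)
    finally show "norm (bl (f x) (g x) - bl (f y) (g y)) \<le> 2 * L * M * K * dist x y"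
      by (simp add: algebra_simps)
  qed
qed

lemmas lip_bd_on_mult = lip_bd_on_bounded_bilinear[OF bounded_bilinear_mult]
lemmas lip_bd_on_scaleR = lip_bd_on_bounded_bilinear[OF bounded_bilinear_scaleR]
lemmas lip_bd_on_inner = lip_bd_on_bounded_bilinear[OF bounded_bilinear_inner]

lemma lip_bd_on_diff:
  assumes "lip_bd_on Z f" "lip_bd_on Z g" shows "lip_bd_on Z (\<lambda>x. f x - g x)"
  using lip_bd_on_add[OF assms(1) lip_bd_on_scaleR[OF lip_bd_on_const[of _ "-1"] assms(2)]] by simp

lemma lip_bd_on_inverse:
  fixes f :: "_ \<Rightarrow> real"
  assumes "lip_bd_on Z f" "0 < d" "\<And>x. x \<in> Z \<Longrightarrow> d \<le> \<bar>f x\<bar>"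
  shows "lip_bd_on Z (\<lambda>x. inverse (f x))"
proof -
  from assms(1) obtain L where L: "0 \<le> L" "\<And>x. x \<in> Z \<Longrightarrow> norm (f x) \<le> L"
    "\<And>x y. x \<in> Z \<Longrightarrow> y \<in> Z \<Longrightarrow> norm (f x - f y) \<le> L * dist x y" by (rule lip_bd_onE) (rule that; blast)
  have inv: "\<bar>inverse (f x)\<bar> \<le> inverse d" if "x \<in> Z" for x
    using assms(2) assms(3)[OF that] by (simp add: abs_inverse le_imp_inverse_le)
  show ?thesis
  proof (rule lip_bd_onI[of _ _ "inverse d" "inverse d * L * inverse d"])
    fix x y assume xy: "x \<in> Z" "y \<in> Z"
    then have nz: "f x \<noteq> 0" "f y \<noteq> 0" using assms(2,3) by fastforce+
    have "norm (inverse (f x) - inverse (f y)) = \<bar>inverse (f x)\<bar> * \<bar>f x - f y\<bar> * \<bar>inverse (f y)\<bar>"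
      using inverse_diff_inverse[OF nz] by (simp add: abs_mult)
    also have "\<dots> \<le> inverse d * (L * dist x y) * inverse d"
      using inv[OF xy(1)] inv[OF xy(2)] L(3)[OF xy] assms(2) L(1) by (intro mult_mono) auto
    finally show "norm (inverse (f x) - inverse (f y)) \<le> inverse d * L * inverse d * dist x y"
      by (simp add: algebra_simps)
  qed (use inv in auto)
qed

lemma lip_bd_on_compose:
  assumes "lip_bd_on Y f" "\<And>x. x \<in> Z \<Longrightarrow> g x \<in> Y" "\<And>x y. x \<in> Z \<Longrightarrow> y \<in> Z \<Longrightarrow> dist (g x) (g y) \<le> dist x y"
  shows "lip_bd_on Z (\<lambda>x. f (g x))"
proof -
  from assms(1) obtain L where L: "0 \<le> L" "\<And>x. x \<in> Y \<Longrightarrow> norm (f x) \<le> L"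
    "\<And>x y. x \<in> Y \<Longrightarrow> y \<in> Y \<Longrightarrow> norm (f x - f y) \<le> L * dist x y" by (rule lip_bd_onE) (rule that; blast)
  show ?thesis
  proof (rule lip_bd_onI[of _ _ L L])
    fix x y assume "x \<in> Z" "y \<in> Z"
    then have "norm (f (g x) - f (g y)) \<le> L * dist (g x) (g y)" using L(3) assms(2) by blast
    also have "\<dots> \<le> L * dist x y" using assms(3) \<open>x \<in> Z\<close> \<open>y \<in> Z\<close> L(1) by (intro mult_left_mono) auto
    finally show "norm (f (g x) - f (g y)) \<le> L * dist x y" .
  qed (use L assms(2) in auto)
qed

lemma lip_bd_on_imp_continuous_on:
  assumes "lip_bd_on Z f" shows "continuous_on Z f"
proof -
  from assms obtain L where L: "0 \<le> L" "\<And>x y. x \<in> Z \<Longrightarrow> y \<in> Z \<Longrightarrow> norm (f x - f y) \<le> L * dist x y"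
    by (rule lip_bd_onE) (rule that; blast)
  have "L-lipschitz_on Z f" using L by (intro lipschitz_onI) (auto simp: dist_norm)
  then show ?thesis by (rule lipschitz_on_continuous_on)
qed

text \<open>The gradient is continuous, hence bounded on the compact ball, and the ball is convex.\<close>

lemma Ck_on_imp_lip_bd_on:
  fixes f :: "real^3 \<Rightarrow> real"
  assumes "Ck_on 1 f S" "cball x r \<subseteq> S"
  shows "lip_bd_on (cball x r) f"
proof -
  have "Ck_on 0 f S" using Ck_on_SucD[of 0 f S] assms(1) by simp
  then have "compact (f ` cball x r)" "compact (grad f ` cball x r)"
    using Ck_on_grad[OF assms(1)] assms(2)
    by (auto intro!: compact_continuous_image intro: continuous_on_subset)
  then have "bounded (f ` cball x r)" "bounded (grad f ` cball x r)"
    by (auto intro: compact_imp_bounded)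
  then obtain M N where M: "\<forall>v\<in>f ` cball x r. norm v \<le> M" and N: "\<forall>v\<in>grad f ` cball x r. norm v \<le> N"
    unfolding bounded_iff by auto
  show ?thesis
  proof (rule lip_bd_onI[of _ _ M N])
    fix y z assume yz: "y \<in> cball x r" "z \<in> cball x r"
    show "norm (f y - f z) \<le> N * dist y z" unfolding dist_norm
    proof (rule differentiable_bound[where S = "cball x r" and f' = "\<lambda>p v. grad f p \<bullet> v"])
      fix p assume p: "p \<in> cball x r"
      then have "f differentiable (at p)" using assms by auto
      then show "(f has_derivative (\<lambda>v. grad f p \<bullet> v)) (at p within cball x r)"
        using has_derivative_grad has_derivative_at_withinI by blast
      have "onorm (\<lambda>v. grad f p \<bullet> v) \<le> norm (grad f p)"
        by (rule onorm_bound) (auto simp: Cauchy_Schwarz_ineq2)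
      moreover have "norm (grad f p) \<le> N" using N p by blast
      ultimately show "onorm (\<lambda>v. grad f p \<bullet> v) \<le> N" by linarith
    qed (use yz in auto)
  qed (use M in auto)
qed

section \<open>Foliations given by an injective chart\<close>

text \<open>Over each \<open>d\<close> the image of the chart may consist of several intervals; each of them gives a leaf
  of its own, so that leaves are connected whatever the shape of \<open>M\<close>.\<close>

definition chart_leaves :: "(real^3 \<Rightarrow> (real^2) \<times> real) \<Rightarrow> (real^3) set \<Rightarrow> (real^3) set set" where
  "chart_leaves h M = {M \<inter> h -` ({d} \<times> C) | d C. C \<in> components {s. (d, s) \<in> h ` M}}"

lemma open_slice:
  assumes "open (A :: ('a::topological_space \<times> 'b::topological_space) set)"
  shows "open {s. (d, s) \<in> A}"
proof -
  have "open (Pair d -` A)" using assms by (intro open_vimage continuous_intros)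
  then show ?thesis by (simp add: vimage_def)
qed

text \<open>By invariance of domain the image of \<open>h\<close> is open and \<open>h\<close> is a homeomorphism onto it. A flow box is
  the preimage of a small product inside the image; a leaf meets that product in
  a whole vertical segment or not at all, since the segment is connected.\<close>

lemma foliation_chart_leaves:
  assumes M: "open M" and cont: "continuous_on M h" and inj: "inj_on h M"
  shows "foliation M (chart_leaves h M)"
proof -
  let ?O = "h ` M"
  define k where "k = inv_into M h"
  define sl where "sl d = {s. (d, s) \<in> ?O}" for d
  have cl: "chart_leaves h M = {M \<inter> h -` ({d} \<times> C) | d C. C \<in> components (sl d)}"
    by (simp add: chart_leaves_def sl_def)
  have dim: "DIM((real^2) \<times> real) \<le> DIM(real^3)" by simp
  have O: "open ?O" by (rule invariance_of_domain_gen[OF M cont inj dim])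
  have k_h: "k (h p) = p" if "p \<in> M" for p using that inj by (simp add: k_def)
  have h_k: "h (k z) = z" "k z \<in> M" if "z \<in> ?O" for z
    using that by (auto simp: k_def f_inv_into_f inv_into_into)
  have k_cont: "continuous_on ?O k"
    by (rule continuous_on_inverse_open[OF M cont dim]) (simp add: k_h)
  have sl_open: "open (sl d)" for d unfolding sl_def by (rule open_slice[OF O])
  have leaf_eq: "M \<inter> h -` ({d} \<times> C) = k ` ({d} \<times> C)" if C: "C \<subseteq> sl d" for d C
  proof (intro equalityI subsetI)
    fix p assume "p \<in> M \<inter> h -` ({d} \<times> C)"
    then show "p \<in> k ` ({d} \<times> C)" using k_h[of p] by (intro image_eqI[of _ _ "h p"]) auto
  next
    fix p assume "p \<in> k ` ({d} \<times> C)"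
    then obtain s where s: "p = k (d, s)" "s \<in> C" by auto
    then have "(d, s) \<in> ?O" using C by (auto simp: sl_def)
    then show "p \<in> M \<inter> h -` ({d} \<times> C)" using s h_k[of "(d, s)"] by auto
  qed
  have part: "partition_on M (chart_leaves h M)"
  proof (rule partition_onI)
    have "\<exists>L\<in>chart_leaves h M. p \<in> L" if p: "p \<in> M" for p
    proof -
      obtain d s where ds: "h p = (d, s)" by fastforce
      then have "s \<in> sl d" using p by (force simp: sl_def)
      then have "s \<in> connected_component_set (sl d) s" "connected_component_set (sl d) s \<in> components (sl d)"
        by (auto intro: componentsI connected_component_refl)
      then have "M \<inter> h -` ({d} \<times> connected_component_set (sl d) s) \<in> chart_leaves h M"
        and "p \<in> M \<inter> h -` ({d} \<times> connected_component_set (sl d) s)"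
        using p ds unfolding cl by auto
      then show ?thesis by (rule bexI[rotated])
    qed
    moreover have "L \<subseteq> M" if "L \<in> chart_leaves h M" for L using that unfolding chart_leaves_def by blast
    ultimately show "\<Union> (chart_leaves h M) = M" by (meson UnionE UnionI subset_antisym subset_iff)
  next
    fix K L assume "K \<in> chart_leaves h M" "L \<in> chart_leaves h M" "K \<noteq> L"
    then obtain d C e D where KL: "K = M \<inter> h -` ({d} \<times> C)" "L = M \<inter> h -` ({e} \<times> D)"
      "C \<in> components (sl d)" "D \<in> components (sl e)"
      unfolding cl by blast
    show "disjnt K L"
    proof (cases "d = e")
      case True
      with KL \<open>K \<noteq> L\<close> have "C \<inter> D = {}" using components_nonoverlap[of C "sl d" D] by auto
      with KL show ?thesis by (auto simp: disjnt_def)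
    qed (use KL in \<open>auto simp: disjnt_def\<close>)
  next
    have "L \<noteq> {}" if "L \<in> chart_leaves h M" for L
    proof -
      from that obtain d C where L: "L = M \<inter> h -` ({d} \<times> C)" "C \<in> components (sl d)"
        unfolding cl by blast
      then have "L = k ` ({d} \<times> C)"
        using leaf_eq[OF in_components_subset[OF L(2)]] by simp
      moreover have "C \<noteq> {}" by (rule in_components_nonempty[OF L(2)])
      ultimately show ?thesis by simp
    qed
    then show "{} \<notin> chart_leaves h M" by blast
  qed
  have conn: "connected L" if L: "L \<in> chart_leaves h M" for L
  proof -
    from L obtain d C where L: "L = M \<inter> h -` ({d} \<times> C)" "C \<in> components (sl d)"
      unfolding cl by blast
    have "connected ({d} \<times> C)" using L(2) by (intro connected_Times) (auto dest: in_components_connected)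
    moreover have "continuous_on ({d} \<times> C) k"
      using k_cont by (rule continuous_on_subset) (use L(2) in_components_subset in \<open>fastforce simp: sl_def\<close>)
    ultimately show ?thesis
      using leaf_eq[of C d] L in_components_subset[OF L(2)] connected_continuous_image[of "{d} \<times> C" k] by simp
  qed
  have box: "\<exists>V h' k. open V \<and> p \<in> V \<and> V \<subseteq> M \<and>
     homeomorphism V (ball (0::real^2) 1 \<times> {-1<..<1::real}) h' k \<and>
     (\<forall>L\<in>chart_leaves h M. \<forall>C\<in>components (L \<inter> V). \<exists>d. h' ` C = {d} \<times> {-1<..<1})"
    if p: "p \<in> M" for p
  proof -
    obtain d0 s0 where ds: "h p = (d0, s0)" by fastforce
    then have "(d0, s0) \<in> ?O" using p by force
    then obtain A B where AB: "open A" "open B" "d0 \<in> A" "s0 \<in> B" "A \<times> B \<subseteq> ?O"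
      using open_prod_elim[OF O, of "(d0, s0)"] by (metis mem_Sigma_iff)
    obtain \<epsilon>1 where e1: "\<epsilon>1 > 0" "ball d0 \<epsilon>1 \<subseteq> A" using AB open_contains_ball by metis
    obtain \<epsilon>2 where e2: "\<epsilon>2 > 0" "ball s0 \<epsilon>2 \<subseteq> B" using AB open_contains_ball by metis
    define \<epsilon> where "\<epsilon> = min \<epsilon>1 \<epsilon>2"
    have e: "\<epsilon> > 0" using e1 e2 by (simp add: \<epsilon>_def)
    define I where "I = {s0 - \<epsilon><..<s0 + \<epsilon>}"
    define Z where "Z = ball d0 \<epsilon> \<times> I"
    have "ball d0 \<epsilon> \<subseteq> A" "I \<subseteq> B" using e1 e2 unfolding \<epsilon>_def I_def
      by (auto simp: subset_iff dist_real_def)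
    then have Z: "open Z" "Z \<subseteq> ?O" using AB unfolding Z_def I_def by (auto intro: open_Times)
    define V where "V = M \<inter> h -` Z"
    define a where "a z = ((1/\<epsilon>) *\<^sub>R (fst z - d0), (1/\<epsilon>) * (snd z - s0))" for z :: "(real^2) \<times> real"
    define b where "b z = (d0 + \<epsilon> *\<^sub>R fst z, s0 + \<epsilon> * snd z)" for z :: "(real^2) \<times> real"
    have ab: "a (b z) = z" "b (a z) = z" for z using e by (auto simp: a_def b_def prod_eq_iff)
    have bZ: "b z \<in> Z \<longleftrightarrow> z \<in> ball 0 1 \<times> {-1<..<1}" for z
    proof -
      have "norm (\<epsilon> *\<^sub>R fst z) < \<epsilon> \<longleftrightarrow> norm (fst z) < 1" using e by simp
      moreover have "- \<epsilon> < \<epsilon> * snd z \<longleftrightarrow> -1 < snd z" "\<epsilon> * snd z < \<epsilon> \<longleftrightarrow> snd z < 1"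
        using e mult_less_cancel_left_pos[of \<epsilon> "-1" "snd z"] by auto
      moreover have "dist d0 (d0 + v) = norm v" for v :: "real^2" by (simp add: dist_norm)
      ultimately show ?thesis by (cases z) (auto simp: b_def Z_def I_def)
    qed
    have Vk: "V = k ` Z"
    proof (intro equalityI subsetI)
      fix q assume "q \<in> V"
      then show "q \<in> k ` Z" using k_h[of q] by (intro image_eqI[of _ _ "h q"]) (auto simp: V_def)
    next
      fix q assume "q \<in> k ` Z"
      then obtain z where z: "z \<in> Z" "q = k z" by blast
      then show "q \<in> V" using Z(2) h_k[of z] by (auto simp: V_def)
    qed
    have "open V" unfolding V_def using continuous_on_open_vimage[OF M, of h] cont Z(1) by (simp add: Int_commute)
    moreover have "p \<in> V" using p ds e by (auto simp: V_def Z_def I_def)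
    moreover have "V \<subseteq> M" by (auto simp: V_def)
    moreover have "homeomorphism V (ball (0::real^2) 1 \<times> {-1<..<1::real}) (a \<circ> h) (k \<circ> b)"
    proof (rule homeomorphismI)
      have "continuous_on V h" using cont by (rule continuous_on_subset) (auto simp: V_def)
      moreover have "continuous_on UNIV a" unfolding a_def by (intro continuous_intros)
      ultimately show "continuous_on V (a \<circ> h)"
        by (intro continuous_on_compose) (auto intro: continuous_on_subset)
      have "continuous_on UNIV b" unfolding b_def by (intro continuous_intros)
      then show "continuous_on (ball 0 1 \<times> {-1<..<1}) (k \<circ> b)"
        using bZ Z by (intro continuous_on_compose continuous_on_subset[OF k_cont]) (auto intro: continuous_on_subset)
      show "(a \<circ> h) ` V \<subseteq> ball 0 1 \<times> {-1<..<1}"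
      proof (rule image_subsetI)
        fix q assume "q \<in> V"
        then have "b (a (h q)) \<in> Z" by (simp add: ab V_def)
        then show "(a \<circ> h) q \<in> ball 0 1 \<times> {-1<..<1}" using bZ by simp
      qed
      show "(k \<circ> b) ` (ball 0 1 \<times> {-1<..<1}) \<subseteq> V" using bZ by (auto simp: Vk)
      show "(k \<circ> b) ((a \<circ> h) q) = q" if "q \<in> V" for q using that by (simp add: ab k_h V_def)
      show "(a \<circ> h) ((k \<circ> b) z) = z" if "z \<in> ball 0 1 \<times> {-1<..<1}" for z
      proof -
          have "b z \<in> ?O" using that bZ[of z] Z(2) by blast
          then show ?thesis using h_k(1)[of "b z"] by (simp add: ab)
        qed
    qed
    moreover have "\<exists>d. (a \<circ> h) ` C = {d} \<times> {-1<..<1}"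
      if L: "L \<in> chart_leaves h M" and C: "C \<in> components (L \<inter> V)" for L C
    proof -
      from L obtain d D where L: "L = M \<inter> h -` ({d} \<times> D)" "D \<in> components (sl d)"
        unfolding cl by blast
      obtain q where "q \<in> C" using C in_components_nonempty by blast
      then have "q \<in> L \<inter> V" using C in_components_subset by blast
      then obtain s where s: "h q = (d, s)" "s \<in> D" "s \<in> I" "d \<in> ball d0 \<epsilon>" by (auto simp: L V_def Z_def)
      have "I \<subseteq> sl d" using s(4) Z(2) unfolding sl_def Z_def by blast
      then have ID: "I \<subseteq> D"
        using s by (intro components_maximal[OF L(2)]) (auto simp: I_def)
      have eq: "L \<inter> V = k ` ({d} \<times> I)"
      proof -
        have "L \<inter> V = M \<inter> h -` ({d} \<times> I)" using ID s(4) by (auto simp: L V_def Z_def)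
        then show ?thesis using leaf_eq[OF \<open>I \<subseteq> sl d\<close>] by simp
      qed
      have "connected ({d} \<times> I)" by (intro connected_Times) (auto simp: I_def)
      moreover have "continuous_on ({d} \<times> I) k"
        using k_cont by (rule continuous_on_subset) (use s(4) Z(2) in \<open>auto simp: Z_def\<close>)
      ultimately have "connected (L \<inter> V)" unfolding eq by (rule connected_continuous_image[rotated])
      then have "components (L \<inter> V) = {L \<inter> V}"
        using components_eq_sing_iff[of "L \<inter> V"] \<open>q \<in> L \<inter> V\<close> by auto
      then have C: "C = k ` ({d} \<times> I)" using C eq by simp
      have "{d} \<times> I \<subseteq> ?O" using s(4) Z(2) by (auto simp: Z_def)
      then have "h (k z) = z" if "z \<in> {d} \<times> I" for z using h_k(1) that by blast
      then have "(\<lambda>z. h (k z)) ` ({d} \<times> I) = (\<lambda>z. z) ` ({d} \<times> I)" by (intro image_cong refl)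
      then have "h ` C = {d} \<times> I" by (simp add: C image_image)
      then have "(a \<circ> h) ` C = a ` ({d} \<times> I)" by (simp only: image_comp[symmetric])
      also have "\<dots> = {(1/\<epsilon>) *\<^sub>R (d - d0)} \<times> ((\<lambda>s. (1/\<epsilon>) * (s - s0)) ` I)"
        unfolding a_def by force
      finally have "(a \<circ> h) ` C = {(1/\<epsilon>) *\<^sub>R (d - d0)} \<times> ((\<lambda>s. (1/\<epsilon>) * (s - s0)) ` I)" .
      moreover have "(\<lambda>s. (1/\<epsilon>) * (s - s0)) ` I = {-1<..<1}"
      proof (intro equalityI subsetI)
        fix t assume t: "t \<in> {-1<..<1::real}"
        have "\<epsilon> * t < \<epsilon> * 1" "\<epsilon> * (-1) < \<epsilon> * t"
          using t e by (intro mult_strict_left_mono; simp)+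
        then show "t \<in> (\<lambda>s. (1/\<epsilon>) * (s - s0)) ` I"
          using e by (intro image_eqI[of _ _ "s0 + \<epsilon> * t"]) (auto simp: I_def)
      qed (use e in \<open>auto simp: I_def field_simps\<close>)
      ultimately show ?thesis by (intro exI[of _ "(1/\<epsilon>) *\<^sub>R (d - d0)"]) simp
    qed
    ultimately show ?thesis by blast
  qed
  show ?thesis unfolding foliation_def by (intro conjI ballI part conn box)
qed

section \<open>Recognising a cusp from its velocity\<close>

lemma Ck_on_1I:
  assumes "open S" "\<And>p. p \<in> S \<Longrightarrow> (f has_derivative f' p) (at p)"
    "\<And>v. continuous_on S (\<lambda>p. f' p v)"
  shows "Ck_on 1 f S"
  using Ck_on_SucI[of S f f' 0] assms by simp

text \<open>The inverse function theorem gives the differentiable inverse; continuity of its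
  derivative follows from the lower bound \<open>norm u \<le> 2 * norm (\<theta>' z u)\<close> valid where the
  derivative of \<open>\<rho>\<close> has norm below \<open>1/2\<close>.\<close>

lemma local_diffeo_near_identity:
  fixes \<rho> :: "'a::euclidean_space \<Rightarrow> 'a"
  assumes U: "open U" "0 \<in> U"
    and der: "\<And>z. z \<in> U \<Longrightarrow> (\<rho> has_derivative blinfun_apply (\<rho>' z)) (at z)"
    and cont: "continuous_on U \<rho>'" and zero: "\<rho> 0 = 0" "\<rho>' 0 = 0"
  obtains U' V g where "open U'" "0 \<in> U'" "U' \<subseteq> U" "open V" "0 \<in> V"
    "homeomorphism U' V (\<lambda>z. z + \<rho> z) g" "Ck_on 1 (\<lambda>z. z + \<rho> z) U'" "Ck_on 1 g V"
proof -
  define W where "W = {z \<in> U. norm (\<rho>' z) < 1/2}"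
  have cn: "continuous_on U (\<lambda>z. norm (\<rho>' z))" using cont by (intro continuous_intros)
  have "W = U \<inter> (\<lambda>z. norm (\<rho>' z)) -` {..<1/2}" unfolding W_def by auto
  then have W: "open W" using continuous_on_open_vimage[OF U(1), of "\<lambda>z. norm (\<rho>' z)"] cn by (simp add: Int_commute)
  have W0: "0 \<in> W" using U zero by (simp add: W_def)
  let ?\<theta> = "\<lambda>z. z + \<rho> z"
  define \<theta>' where "\<theta>' z = id_blinfun + \<rho>' z" for z
  have d\<theta>: "(?\<theta> has_derivative blinfun_apply (\<theta>' z)) (at z)" if "z \<in> W" for z
    using der[of z] that unfolding \<theta>'_def W_def
    by (auto simp: plus_blinfun.rep_eq intro!: derivative_eq_intros)
  have c\<theta>: "continuous_on W \<theta>'"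
    unfolding \<theta>'_def using cont by (intro continuous_intros) (auto simp: W_def intro: continuous_on_subset)
  have inv0: "id_blinfun o\<^sub>L \<theta>' 0 = id_blinfun" by (intro blinfun_eqI) (simp add: \<theta>'_def zero)
  show thesis
  proof (rule inverse_function_theorem[OF W d\<theta> c\<theta> W0 inv0])
    fix U' V g g'
    assume g: "open U'" "U' \<subseteq> W" "0 \<in> U'" "open V" "?\<theta> 0 \<in> V" "homeomorphism U' V ?\<theta> g"
      "\<And>y. y \<in> V \<Longrightarrow> (g has_derivative (g' y)) (at y)"
      "\<And>y. y \<in> V \<Longrightarrow> g' y = inv (blinfun_apply (\<theta>' (g y)))"
      "\<And>y. y \<in> V \<Longrightarrow> bij (blinfun_apply (\<theta>' (g y)))"
    have gU: "g y \<in> U'" if "y \<in> V" for y using g(6) that by (auto simp: homeomorphism_def)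
    have gc: "continuous_on V g" using g(6) by (simp add: homeomorphism_def)
    have low: "norm u \<le> 2 * norm (blinfun_apply (\<theta>' z) u)" if "z \<in> W" for z u
    proof -
      have "norm (blinfun_apply (\<rho>' z) u) \<le> norm (\<rho>' z) * norm u" by (rule norm_blinfun)
      also have "\<dots> \<le> 1/2 * norm u" using that by (intro mult_right_mono) (auto simp: W_def)
      finally show ?thesis
        using norm_diff_ineq[of u "blinfun_apply (\<rho>' z) u"] by (simp add: \<theta>'_def plus_blinfun.rep_eq)
    qed
    have "continuous_on V (\<lambda>y. g' y v)" for v
    proof (clarsimp simp: continuous_on_def)
      fix y0 assume y0: "y0 \<in> V"
      define w where "w = g' y0 v"
      have inv: "blinfun_apply (\<theta>' (g y)) (g' y u) = u" if "y \<in> V" for y u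
        using g(8,9)[OF that] by (simp add: bij_is_surj surj_f_inv_f)
      have lim0: "((\<lambda>y. blinfun_apply (\<theta>' (g y)) w) \<longlongrightarrow> blinfun_apply (\<theta>' (g y0)) w) (at y0 within V)"
      proof -
        have "continuous_on V (\<lambda>y. \<theta>' (g y))"
          by (rule continuous_on_compose2[OF c\<theta> gc]) (use gU g(2) in auto)
        then have "continuous_on V (\<lambda>y. blinfun_apply (\<theta>' (g y)) w)" by (intro continuous_intros)
        then show ?thesis using y0 by (simp add: continuous_on_def)
      qed
      have lim: "((\<lambda>y. 2 * norm (blinfun_apply (\<theta>' (g y0)) w - blinfun_apply (\<theta>' (g y)) w)) \<longlongrightarrow> 0) (at y0 within V)"
        using tendsto_mult[OF tendsto_const[of "2::real"] tendsto_norm[OF tendsto_diff[OF tendsto_const[of "blinfun_apply (\<theta>' (g y0)) w"] lim0]]] by simp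
      have ev: "\<forall>\<^sub>F y in at y0 within V. y \<in> V"
        by (auto simp: eventually_at_filter)
      show "((\<lambda>y. g' y v) \<longlongrightarrow> g' y0 v) (at y0 within V)"
      proof (rule LIM_zero_cancel, rule Lim_null_comparison[OF _ lim])
        show "\<forall>\<^sub>F y in at y0 within V. norm (g' y v - g' y0 v)
            \<le> 2 * norm (blinfun_apply (\<theta>' (g y0)) w - blinfun_apply (\<theta>' (g y)) w)"
          using ev
        proof eventually_elim
          case (elim y)
          have "norm (g' y v - w) \<le> 2 * norm (blinfun_apply (\<theta>' (g y)) (g' y v - w))"
            by (rule low) (use gU[OF elim] g(2) in auto)
          also have "blinfun_apply (\<theta>' (g y)) (g' y v - w) = blinfun_apply (\<theta>' (g y0)) w - blinfun_apply (\<theta>' (g y)) w"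
            using inv[OF elim, of v] inv[OF y0, of v] by (simp add: blinfun.diff_right w_def)
          finally show ?case by (simp add: w_def)
        qed
      qed
    qed
    then have "Ck_on 1 g V" using g(4,7) by (intro Ck_on_1I)
    moreover have "Ck_on 1 ?\<theta> U'"
    proof (rule Ck_on_1I[OF g(1)])
      show "(?\<theta> has_derivative blinfun_apply (\<theta>' z)) (at z)" if "z \<in> U'" for z using d\<theta> that g(2) by blast
      show "continuous_on U' (\<lambda>p. blinfun_apply (\<theta>' p) v)" for v
        using c\<theta> g(2) by (intro continuous_intros) (auto intro: continuous_on_subset)
    qed
    moreover have "0 \<in> V" using g(5) zero by simp
    moreover have "U' \<subseteq> U" using g(2) by (auto simp: W_def)
    ultimately show thesis using that[of U' V g] g by blast
  qed
qed

text \<open>The weight \<open>2 v / (1 + v\<^sup>2)\<close> with \<open>v = u / t\<^sup>3\<close> equals \<open>1\<close> on the branch \<open>u = t\<^sup>3\<close> of the cusp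
  and \<open>-1\<close> on the branch \<open>u = - t\<^sup>3\<close>. Together with \<open>v\<close> times its derivative it is bounded on the whole half plane,
  which keeps its partial derivatives under control off the cusp too.\<close>

lemma cusp_weight_bounds:
  fixes t u :: real
  assumes "t > 0"
  shows "\<bar>2 * u * t^3 / (t^6 + u^2)\<bar> \<le> 1"
    and "\<bar>6 * u * t^2 * (u^2 - t^6) / (t^6 + u^2)^2\<bar> \<le> 3 / t"
    and "\<bar>2 * t^3 * (t^6 - u^2) / (t^6 + u^2)^2\<bar> \<le> 2 / t^3"
proof -
  define q where "q = t^6 + u^2"
  have q: "q > 0" using assms by (simp add: q_def add_pos_nonneg)
  have "0 \<le> (t^3 - \<bar>u\<bar>)^2" by simp
  then have le: "2 * \<bar>u\<bar> * t^3 \<le> q" by (simp add: q_def power2_diff mult_ac flip: power_mult)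
  show a: "\<bar>2 * u * t^3 / (t^6 + u^2)\<bar> \<le> 1"
    using le q assms unfolding q_def[symmetric] by (simp add: abs_mult)
  have d: "\<bar>u^2 - t^6\<bar> \<le> q" unfolding q_def by (simp add: abs_le_iff)
  have "\<bar>6 * u * t^2 * (u^2 - t^6) / q^2\<bar> = (3/t) * (2 * \<bar>u\<bar> * t^3 / q) * (\<bar>u^2 - t^6\<bar> / q)"
    using assms q by (simp add: abs_mult power2_eq_square power3_eq_cube)
  also have "\<dots> \<le> (3/t) * 1 * 1"
    by (intro mult_mono) (use le d q assms in auto)
  finally show "\<bar>6 * u * t^2 * (u^2 - t^6) / (t^6 + u^2)^2\<bar> \<le> 3 / t" by (simp add: q_def)
  have "t^6 / q \<le> 1" using q by (simp add: q_def)
  have "\<bar>2 * t^3 * (t^6 - u^2) / q^2\<bar> = (2/t^3) * (t^6 / q) * (\<bar>u^2 - t^6\<bar> / q)"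
  proof -
    define a where "a = t^3"
    have a: "t^6 = a * a" "a > 0" using assms by (simp_all add: a_def flip: power_add)
    have "(2/t^3) * (t^6 / q) = 2 * t^3 / q" unfolding a(1) a_def[symmetric] using a(2) by simp
    then show ?thesis using assms q abs_minus_commute[of "t^6" "u^2"]
      by (simp add: abs_mult power2_eq_square)
  qed
  also have "\<dots> \<le> (2/t^3) * 1 * 1"
    by (intro mult_mono) (use \<open>t^6 / q \<le> 1\<close> d q assms in auto)
  finally show "\<bar>2 * t^3 * (t^6 - u^2) / (t^6 + u^2)^2\<bar> \<le> 2 / t^3" by (simp add: q_def)
qed

lemma cusp_weight_has_derivative:
  fixes t u :: "'a::real_normed_vector \<Rightarrow> real"
  assumes t: "(t has_derivative t') (at z)" and u: "(u has_derivative u') (at z)" and pos: "t z > 0"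
  shows "((\<lambda>z. 2 * u z * t z^3 / (t z^6 + u z^2)) has_derivative
    (\<lambda>h. t' h * (6 * u z * t z^2 * (u z^2 - t z^6) / (t z^6 + u z^2)^2) +
         u' h * (2 * t z^3 * (t z^6 - u z^2) / (t z^6 + u z^2)^2))) (at z)"
proof -
  have q: "t z^6 + u z^2 \<noteq> 0" using pos by (simp add: add_pos_nonneg less_imp_neq[symmetric])
  have n: "((\<lambda>z. 2 * u z * t z^3) has_derivative (\<lambda>h. 2 * u' h * t z^3 + 2 * u z * (3 * t z^2 * t' h))) (at z)"
    by (rule derivative_eq_intros t u | simp add: algebra_simps)+
  have d: "((\<lambda>z. t z^6 + u z^2) has_derivative (\<lambda>h. 6 * t z^5 * t' h + 2 * u z * u' h)) (at z)"
    by (rule derivative_eq_intros t u | simp add: algebra_simps)+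
  have e: "(2 * U * t z^3 + 2 * u z * (3 * t z^2 * S)) * (t z^6 + u z^2)
      - 2 * u z * t z^3 * (6 * t z^5 * S + 2 * u z * U)
      = S * (6 * u z * t z^2 * (u z^2 - t z^6)) + U * (2 * t z^3 * (t z^6 - u z^2))" for U S
    by algebra
  show ?thesis
    by (rule has_derivative_eq_rhs[OF has_derivative_divide'[OF n d q]], rule ext)
      (simp only: e, simp add: add_divide_distrib power2_eq_square)
qed

lemma continuous_on_half_space_zero_extension:
  fixes f :: "real^'n \<Rightarrow> 'b::real_normed_vector"
  assumes U: "open U" and cont: "continuous_on (U \<inter> {z. z $ i > 0}) f"
    and bd: "\<And>z. z \<in> U \<Longrightarrow> z $ i > 0 \<Longrightarrow> norm (f z) \<le> K * sqrt (z $ i)"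
  shows "continuous_on U (\<lambda>z. if z $ i > 0 then f z else 0)"
proof (rule continuous_at_imp_continuous_on, rule ballI)
  let ?g = "\<lambda>z. if z $ i > 0 then f z else 0"
  fix z0 assume z0: "z0 \<in> U"
  have op: "open (U \<inter> {z. z $ i > 0})"
    using U by (intro open_Int open_Collect_less continuous_intros)
  show "isCont ?g z0"
  proof (cases "z0 $ i > 0")
    case True
    have "continuous_on (U \<inter> {z. z $ i > 0}) ?g"
      using cont by (rule continuous_on_eq) auto
    then show ?thesis using continuous_on_eq_continuous_at[OF op] True z0 by auto
  next
    case False
    have "((\<lambda>z. \<bar>K\<bar> * sqrt (max 0 (z $ i))) \<longlongrightarrow> \<bar>K\<bar> * sqrt (max 0 (z0 $ i))) (at z0)"
      by (intro tendsto_intros)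
    then have lim: "((\<lambda>z. \<bar>K\<bar> * sqrt (max 0 (z $ i))) \<longlongrightarrow> 0) (at z0)"
      using False by (simp add: max_absorb1)
    have "\<forall>\<^sub>F z in at z0. z \<in> U" using U z0 eventually_at_topological by blast
    then have "\<forall>\<^sub>F z in at z0. norm (?g z) \<le> \<bar>K\<bar> * sqrt (max 0 (z $ i))"
    proof eventually_elim
      case (elim z)
      show ?case
      proof (cases "z $ i > 0")
        case True
        then have "K * sqrt (z $ i) \<le> \<bar>K\<bar> * sqrt (z $ i)" by (intro mult_right_mono) auto
        from order_trans[OF bd[OF elim True] this] show ?thesis using True by (simp add: max_absorb2)
      qed simp
    qed
    from Lim_null_comparison[OF this lim] show ?thesis using False by (simp add: isCont_def)
  qed
qed

text \<open>A function of the parameter of the cusp \<open>(t\<^sup>2, t\<^sup>3)\<close> that is small enough at \<open>0\<close> comes from a \<open>C\<^sup>1\<close> function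
  of the plane. The even part of \<open>R\<close> is a function of \<open>t\<^sup>2\<close> alone; the odd part, which has opposite signs on the two
  branches, is taken at \<open>sqrt x\<close> and multiplied by the weight that distinguishes the branches. Where \<open>x \<le> 0\<close> the
  extension is \<open>0\<close>, and the bounds on \<open>R\<close> and \<open>R'\<close> make both pieces fit to first order along \<open>x = 0\<close>.\<close>

lemma cusp_remainder_extension:
  fixes R R' :: "real \<Rightarrow> 'a::real_normed_vector"
  assumes eps: "0 < \<epsilon>" and der: "\<And>t. \<bar>t\<bar> < \<epsilon> \<Longrightarrow> (R has_vector_derivative R' t) (at t)"
    and cont: "continuous_on {-\<epsilon><..<\<epsilon>} R'"
    and bd: "\<And>t. \<bar>t\<bar> < \<epsilon> \<Longrightarrow> norm (R t) \<le> C * t^4" "\<And>t. \<bar>t\<bar> < \<epsilon> \<Longrightarrow> norm (R' t) \<le> C * \<bar>t\<bar>^3"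
  obtains \<rho> :: "real^3 \<Rightarrow> 'a" and \<rho>' U where "open U" "0 \<in> U"
    "\<And>z. z \<in> U \<Longrightarrow> (\<rho> has_derivative blinfun_apply (\<rho>' z)) (at z)"
    "continuous_on U \<rho>'" "\<rho> 0 = 0" "\<rho>' 0 = 0" "\<And>t. \<bar>t\<bar> < \<epsilon> \<Longrightarrow> \<rho> (vector [t^2, t^3, 0]) = R t"
proof -
  have C: "0 \<le> C"
  proof -
    have "0 \<le> C * (\<epsilon>/2)^4" using order_trans[OF norm_ge_zero bd(1)[of "\<epsilon>/2"]] eps by simp
    then show ?thesis using eps by (simp add: zero_le_mult_iff)
  qed
  define E where "E t = (1/2) *\<^sub>R (R t + R (-t))" for t
  define F where "F t = (1/2) *\<^sub>R (R t - R (-t))" for t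
  define E' where "E' t = (1/2) *\<^sub>R (R' t - R' (-t))" for t
  define F' where "F' t = (1/2) *\<^sub>R (R' t + R' (-t))" for t
  have Rm: "((\<lambda>t. R (-t)) has_vector_derivative - R' (-t)) (at t)" if "\<bar>t\<bar> < \<epsilon>" for t
  proof -
    have "((\<lambda>t. - t) has_vector_derivative - 1) (at t)" by (auto intro!: derivative_eq_intros)
    from vector_diff_chain_at[OF this, of R "R' (-t)"] show ?thesis
      using der[of "-t"] that by (simp add: o_def)
  qed
  have dE: "(E has_vector_derivative E' t) (at t)" and dF: "(F has_vector_derivative F' t) (at t)" if "\<bar>t\<bar> < \<epsilon>" for t
    unfolding E_def[abs_def] E'_def F_def[abs_def] F'_def
    using der[OF that] Rm[OF that] by (auto intro!: derivative_eq_intros simp: scaleR_diff_right scaleR_add_right)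
  have bE: "norm (E t) \<le> C * t^4" and bF: "norm (F t) \<le> C * t^4" if "\<bar>t\<bar> < \<epsilon>" for t
    using bd(1)[of t] bd(1)[of "-t"] that norm_triangle_ineq[of "R t" "R (-t)"] norm_triangle_ineq4[of "R t" "R (-t)"]
    by (simp_all add: E_def F_def)
  have bE': "norm (E' t) \<le> C * \<bar>t\<bar>^3" and bF': "norm (F' t) \<le> C * \<bar>t\<bar>^3" if "\<bar>t\<bar> < \<epsilon>" for t
    using bd(2)[of t] bd(2)[of "-t"] that norm_triangle_ineq[of "R' t" "R' (-t)"] norm_triangle_ineq4[of "R' t" "R' (-t)"]
    by (simp_all add: E'_def F'_def)
  have cm: "continuous_on {-\<epsilon><..<\<epsilon>} (\<lambda>t. R' (-t))"
    by (rule continuous_on_compose2[OF cont]) (auto intro!: continuous_intros)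
  have cE': "continuous_on {-\<epsilon><..<\<epsilon>} E'" and cF': "continuous_on {-\<epsilon><..<\<epsilon>} F'"
    unfolding E'_def F'_def by (intro continuous_intros cont cm)+
  have cF: "continuous_on {-\<epsilon><..<\<epsilon>} F"
    using has_vector_derivative_continuous[OF dF] by (intro continuous_at_imp_continuous_on) auto
  \<comment> \<open>the weight and its two partial derivatives\<close>
  define chi where "chi t u = 2 * u * t^3 / (t^6 + u^2)" for t u :: real
  define chit where "chit t u = 6 * u * t^2 * (u^2 - t^6) / (t^6 + u^2)^2" for t u :: real
  define chiu where "chiu t u = 2 * t^3 * (t^6 - u^2) / (t^6 + u^2)^2" for t u :: real
  have bchi: "\<bar>chi t u\<bar> \<le> 1" "\<bar>chit t u\<bar> \<le> 3 / t" "\<bar>chiu t u\<bar> \<le> 2 / t^3" if "t > 0" for t u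
    unfolding chi_def chit_def chiu_def by (fact cusp_weight_bounds[OF that])+
  define U where "U = {z :: real^3. z $ 1 < \<epsilon>^2}"
  have U: "open U" unfolding U_def by (intro open_Collect_less continuous_intros)
  define T where "T z = sqrt (z $ 1)" for z :: "real^3"
  have T: "0 < T z" "\<bar>T z\<bar> < \<epsilon>" "T z^2 = z $ 1" "T z \<in> {-\<epsilon><..<\<epsilon>}" if "z \<in> U" "z $ 1 > 0" for z
  proof -
    have "T z < \<epsilon>" "0 < T z"
      using that eps real_sqrt_less_mono[of "z $ 1" "\<epsilon>^2"] by (auto simp: U_def T_def)
    then show "0 < T z" "\<bar>T z\<bar> < \<epsilon>" "T z \<in> {-\<epsilon><..<\<epsilon>}" using eps by auto
    show "T z^2 = z $ 1" using that by (simp add: T_def)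
  qed
  define \<rho> where "\<rho> z = (if z $ 1 > 0 then E (T z) + chi (T z) (z $ 2) *\<^sub>R F (T z) else 0)" for z
  define P1 where "P1 z = (if z $ 1 > 0 then (1 / (2 * T z)) *\<^sub>R
    (E' (T z) + chi (T z) (z $ 2) *\<^sub>R F' (T z) + chit (T z) (z $ 2) *\<^sub>R F (T z)) else 0)" for z
  define P2 where "P2 z = (if z $ 1 > 0 then chiu (T z) (z $ 2) *\<^sub>R F (T z) else 0)" for z
  have bl: "bounded_linear (\<lambda>h :: real^3. h $ 1 *\<^sub>R P1 z + h $ 2 *\<^sub>R P2 z)" for z
    by (intro bounded_linear_add bounded_linear_scaleR_const bounded_linear_vec_nth)
  define \<rho>' where "\<rho>' z = Blinfun (\<lambda>h :: real^3. h $ 1 *\<^sub>R P1 z + h $ 2 *\<^sub>R P2 z)" for z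
  have \<rho>'_apply: "blinfun_apply (\<rho>' z) = (\<lambda>h. h $ 1 *\<^sub>R P1 z + h $ 2 *\<^sub>R P2 z)" for z
    unfolding \<rho>'_def using bl by (rule bounded_linear_Blinfun_apply)
  let ?Up = "U \<inter> {z. z $ 1 > 0}"
  have cT: "continuous_on A T" for A unfolding T_def by (intro continuous_intros)
  have comp: "continuous_on ?Up (\<lambda>z. g (T z))" if "continuous_on {-\<epsilon><..<\<epsilon>} g" for g :: "real \<Rightarrow> 'a"
    by (rule continuous_on_compose2[OF that cT]) (use T(4) in auto)
  have qz: "T z^6 + (z $ 2)^2 \<noteq> 0" if "z \<in> ?Up" for z
    using T(1)[of z] that by (simp add: add_pos_nonneg less_imp_neq[symmetric])
  have cchi: "continuous_on ?Up (\<lambda>z. chi (T z) (z $ 2))" "continuous_on ?Up (\<lambda>z. chit (T z) (z $ 2))"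
    "continuous_on ?Up (\<lambda>z. chiu (T z) (z $ 2))"
    unfolding chi_def chit_def chiu_def by (intro continuous_intros cT; use qz in force)+
  have cP1: "continuous_on U P1"
    unfolding P1_def
  proof (rule continuous_on_half_space_zero_extension[OF U, where K = "5/2 * C * \<epsilon>"])
    show "continuous_on ?Up (\<lambda>z. (1 / (2 * T z)) *\<^sub>R
      (E' (T z) + chi (T z) (z $ 2) *\<^sub>R F' (T z) + chit (T z) (z $ 2) *\<^sub>R F (T z)))"
      by (intro continuous_intros cT comp cE' cF' cF cchi) (use T in force)
    fix z assume z: "z \<in> U" "z $ 1 > 0"
    let ?t = "T z"
    note T = T[OF z] and b = bchi[OF T(1), of "z $ 2"]
    have "norm (chi ?t (z $ 2) *\<^sub>R F' ?t) \<le> 1 * (C * ?t^3)"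
      unfolding norm_scaleR using b bF'[OF T(2)] T by (intro mult_mono) auto
    moreover have "norm (chit ?t (z $ 2) *\<^sub>R F ?t) \<le> (3 / ?t) * (C * ?t^4)"
      unfolding norm_scaleR using b bF[OF T(2)] T by (intro mult_mono) auto
    moreover have "(3 / ?t) * (C * ?t^4) = 3 * C * ?t^3"
      using T(1) by (simp add: power_numeral_reduce)
    moreover have "norm (E' ?t) \<le> C * ?t^3" using bE'[OF T(2)] T by simp
    ultimately have "norm (E' ?t + chi ?t (z $ 2) *\<^sub>R F' ?t + chit ?t (z $ 2) *\<^sub>R F ?t) \<le> 5 * C * ?t^3"
      using norm_triangle_ineq[of "E' ?t + chi ?t (z $ 2) *\<^sub>R F' ?t" "chit ?t (z $ 2) *\<^sub>R F ?t"]
        norm_triangle_ineq[of "E' ?t" "chi ?t (z $ 2) *\<^sub>R F' ?t"] by linarith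
    then have "norm ((1 / (2 * ?t)) *\<^sub>R (E' ?t + chi ?t (z $ 2) *\<^sub>R F' ?t + chit ?t (z $ 2) *\<^sub>R F ?t))
      \<le> (1 / (2 * ?t)) * (5 * C * ?t^3)"
      using T(1) by (simp add: divide_right_mono)
    also have "\<dots> = 5/2 * C * ?t * ?t" using T(1) by (simp add: power_numeral_reduce)
    also have "\<dots> \<le> 5/2 * C * \<epsilon> * ?t" using T C by (intro mult_right_mono mult_left_mono) auto
    finally show "norm ((1 / (2 * ?t)) *\<^sub>R (E' ?t + chi ?t (z $ 2) *\<^sub>R F' ?t + chit ?t (z $ 2) *\<^sub>R F ?t))
      \<le> 5/2 * C * \<epsilon> * sqrt (z $ 1)" by (simp add: T_def)
  qed
  have cP2: "continuous_on U P2"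
    unfolding P2_def
  proof (rule continuous_on_half_space_zero_extension[OF U, where K = "2 * C"])
    show "continuous_on ?Up (\<lambda>z. chiu (T z) (z $ 2) *\<^sub>R F (T z))"
      by (intro continuous_intros comp cF cchi)
    fix z assume z: "z \<in> U" "z $ 1 > 0"
    let ?t = "T z"
    note T = T[OF z] and b = bchi[OF T(1), of "z $ 2"]
    have "norm (chiu ?t (z $ 2) *\<^sub>R F ?t) \<le> (2 / ?t^3) * (C * ?t^4)"
      unfolding norm_scaleR using b bF[OF T(2)] T by (intro mult_mono) auto
    also have "\<dots> = 2 * C * ?t" using T(1) by (simp add: power_numeral_reduce)
    finally show "norm (chiu ?t (z $ 2) *\<^sub>R F ?t) \<le> 2 * C * sqrt (z $ 1)" by (simp add: T_def)
  qed
  have c\<rho>': "continuous_on U \<rho>'"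
    by (rule continuous_on_blinfun_componentwise) (unfold \<rho>'_apply, intro continuous_intros cP1 cP2)
  have b\<rho>: "norm (\<rho> z) \<le> 2 * C * (z $ 1)^2" if z: "z \<in> U" "z $ 1 > 0" for z
  proof -
    note T = T[OF z] and b = bchi[OF T(1), of "z $ 2"]
    have "norm (chi (T z) (z $ 2) *\<^sub>R F (T z)) \<le> 1 * (C * T z^4)"
      unfolding norm_scaleR using b bF[OF T(2)] by (intro mult_mono) auto
    then have "norm (\<rho> z) \<le> 2 * C * T z^4"
      using bE[OF T(2)] norm_triangle_ineq[of "E (T z)" "chi (T z) (z $ 2) *\<^sub>R F (T z)"] z by (simp add: \<rho>_def)
    also have "T z^4 = (T z^2)^2" by simp
    finally show ?thesis unfolding T(3) .
  qed
  have d\<rho>: "(\<rho> has_derivative blinfun_apply (\<rho>' z)) (at z)" if z: "z \<in> U" for z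
  proof (cases "z $ 1 > 0")
    case True
    note T = T[OF z True]
    have dT: "(T has_derivative (\<lambda>h. h $ 1 / (2 * T z))) (at z)"
    proof -
      have d1: "((\<lambda>z :: real^3. z $ 1) has_derivative (\<lambda>h. h $ 1)) (at z)"
        by (rule bounded_linear_imp_has_derivative[OF bounded_linear_vec_nth])
      show ?thesis unfolding T_def[abs_def] using True
        by (auto intro!: derivative_eq_intros d1 simp: divide_simps)
    qed
    have dET: "((\<lambda>z. E (T z)) has_derivative (\<lambda>h. (h $ 1 / (2 * T z)) *\<^sub>R E' (T z))) (at z)"
      using has_derivative_compose[OF dT dE[OF T(2), unfolded has_vector_derivative_def]] .
    have dFT: "((\<lambda>z. F (T z)) has_derivative (\<lambda>h. (h $ 1 / (2 * T z)) *\<^sub>R F' (T z))) (at z)"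
      using has_derivative_compose[OF dT dF[OF T(2), unfolded has_vector_derivative_def]] .
    have d2: "((\<lambda>z :: real^3. z $ 2) has_derivative (\<lambda>h. h $ 2)) (at z)"
      by (rule bounded_linear_imp_has_derivative[OF bounded_linear_vec_nth])
    have dchi: "((\<lambda>z. chi (T z) (z $ 2)) has_derivative
       (\<lambda>h. (h $ 1 / (2 * T z)) * chit (T z) (z $ 2) + h $ 2 * chiu (T z) (z $ 2))) (at z)"
      unfolding chi_def chit_def chiu_def by (rule cusp_weight_has_derivative[OF dT d2 T(1)])
    have "((\<lambda>z. E (T z) + chi (T z) (z $ 2) *\<^sub>R F (T z)) has_derivative blinfun_apply (\<rho>' z)) (at z)"
      by (rule has_derivative_eq_rhs[OF has_derivative_add[OF dET has_derivative_scaleR[OF dchi dFT]]])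
        (use True in \<open>simp add: fun_eq_iff \<rho>'_apply P1_def P2_def algebra_simps\<close>)
    then show ?thesis
      by (rule has_derivative_transform_within_open[of _ _ _ _ "{z. z $ 1 > 0}"])
        (use True in \<open>auto simp: \<rho>_def intro!: open_Collect_less continuous_intros\<close>)
  next
    case False
    have 0: "blinfun_apply (\<rho>' z) = (\<lambda>h. 0)" using False by (simp add: \<rho>'_apply P1_def P2_def)
    obtain d where d: "d > 0" "ball z d \<subseteq> U" using U z open_contains_ball by blast
    show ?thesis unfolding 0 has_derivative_at_alt
    proof (intro conjI allI impI)
      fix e :: real assume e: "e > 0"
      define d' where "d' = min d (e / (2 * C + 1))"
      have d': "d' > 0" using d e C by (simp add: d'_def)
      have "norm (\<rho> y) \<le> e * norm (y - z)" if y: "norm (y - z) < d'" for y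
      proof (cases "y $ 1 > 0")
        case True
        have "y \<in> U" using d(2) y by (auto simp: d'_def dist_norm norm_minus_commute subset_iff)
        have "y $ 1 \<le> norm (y - z)" using False component_le_norm_cart[of "y - z" 1] by simp
        then have "(y $ 1)^2 \<le> norm (y - z) * d'"
          unfolding power2_eq_square using y True by (intro mult_mono) auto
        then have "norm (\<rho> y) \<le> 2 * C * (norm (y - z) * d')"
          using b\<rho>[OF \<open>y \<in> U\<close> True] C by (meson mult_left_mono order_trans zero_le_mult_iff zero_le_numeral)
        also have "\<dots> = (2 * C * d') * norm (y - z)" by simp
        also have "\<dots> \<le> e * norm (y - z)"
        proof (rule mult_right_mono)
          have "2 * C * d' \<le> (2 * C + 1) * (e / (2 * C + 1))"
            using C d' by (intro mult_mono) (auto simp: d'_def)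
          then show "2 * C * d' \<le> e" using C by simp
        qed simp
        finally show ?thesis .
      qed (use e in \<open>simp add: \<rho>_def\<close>)
      then show "\<exists>d>0. \<forall>y. norm (y - z) < d \<longrightarrow> norm (\<rho> y - \<rho> z - 0) \<le> e * norm (y - z)"
        using d' False by (intro exI[of _ d']) (auto simp: \<rho>_def)
    qed simp
  qed
  have val: "\<rho> (vector [t^2, t^3, 0]) = R t" if t: "\<bar>t\<bar> < \<epsilon>" for t
  proof (cases "t = 0")
    case True
    then show ?thesis using bd(1)[of 0] eps by (simp add: \<rho>_def)
  next
    case False
    have T: "T (vector [t^2, t^3, 0]) = \<bar>t\<bar>" by (simp add: T_def)
    have six: "t^6 + (t^3)^2 = 2 * t^6" "t^3 * \<bar>t\<bar>^3 = sgn t * t^6"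
      using False by (simp_all add: sgn_if abs_if flip: power_mult power_add)
    have "chi \<bar>t\<bar> (t^3) = sgn t"
      using False six by (simp add: chi_def mult.assoc)
    then have "\<rho> (vector [t^2, t^3, 0]) = E \<bar>t\<bar> + sgn t *\<^sub>R F \<bar>t\<bar>"
      using False by (simp add: \<rho>_def T)
    also have "\<dots> = R t"
      using False by (cases "t > 0")
        (simp_all add: E_def F_def sgn_if abs_if algebra_simps flip: scaleR_add_left)
    finally show ?thesis .
  qed
  show thesis
    by (rule that[OF U _ d\<rho> c\<rho>' _ _ val])
      (use eps in \<open>auto simp: U_def \<rho>_def intro!: blinfun_eqI simp: \<rho>'_apply P1_def P2_def\<close>)
qed

text \<open>All asymptotic expansions below are integrated with this estimate, at the price of a constant that is
  not the best one.\<close>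

lemma power_bound_from_derivative:
  fixes f :: "real \<Rightarrow> 'a::real_normed_vector"
  assumes der: "\<And>t. \<bar>t\<bar> < \<epsilon> \<Longrightarrow> (f has_vector_derivative f' t) (at t)" and "f 0 = 0"
    and bd: "\<And>t. \<bar>t\<bar> < \<epsilon> \<Longrightarrow> norm (f' t) \<le> C * \<bar>t\<bar>^n" and t: "\<bar>t\<bar> < \<epsilon>"
  shows "norm (f t) \<le> C * \<bar>t\<bar>^Suc n"
proof (cases "t = 0")
  case False
  have "0 \<le> C * \<bar>t\<bar>^n" using order_trans[OF norm_ge_zero bd[OF t]] .
  moreover have "0 < \<bar>t\<bar>^n" using False by simp
  ultimately have C: "0 \<le> C" by (simp add: zero_le_mult_iff)
  have "norm (f t - f 0) \<le> (C * \<bar>t\<bar>^n) * norm (t - 0)"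
  proof (rule differentiable_bound[where S = "{-\<bar>t\<bar>..\<bar>t\<bar>}" and f' = "\<lambda>s h. h *\<^sub>R f' s"])
    fix s assume s: "s \<in> {-\<bar>t\<bar>..\<bar>t\<bar>}"
    then have s': "\<bar>s\<bar> < \<epsilon>" "\<bar>s\<bar> \<le> \<bar>t\<bar>" using t by auto
    show "(f has_derivative (\<lambda>h. h *\<^sub>R f' s)) (at s within {-\<bar>t\<bar>..\<bar>t\<bar>})"
      using der[OF s'(1)] by (simp add: has_vector_derivative_def has_derivative_at_withinI)
    have "norm (f' s) \<le> C * \<bar>t\<bar>^n"
      using order_trans[OF bd[OF s'(1)] mult_left_mono[OF power_mono[OF s'(2)] C]] by simp
    then show "onorm (\<lambda>h. h *\<^sub>R f' s) \<le> C * \<bar>t\<bar>^n"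
      using onorm_scaleR_left[of "\<lambda>h. h" "f' s"] by (simp add: bounded_linear_ident onorm_id)
  qed auto
  then show ?thesis using assms(2) by (simp add: mult_ac)
qed (use assms(2) in simp)

text \<open>In the coordinates of the basis \<open>A\<close>, \<open>E\<close>, \<open>A \<times> E\<close> centred at \<open>P\<close> the curve is the standard cusp plus a
  remainder \<open>R\<close>. With the extension \<open>\<rho>\<close> of \<open>R\<close> the map \<open>z \<mapsto> P + T (z + \<rho> z)\<close> is a local diffeomorphism which sends
  \<open>(t\<^sup>2, t\<^sup>3, 0)\<close> to the point of the curve, so the parameter is not changed at all.\<close>

lemma cusp_230_if_expansion:
  fixes \<gamma> \<gamma>' :: "real \<Rightarrow> real^3"
  assumes eps: "0 < \<epsilon>" and der: "\<And>t. \<bar>t\<bar> < \<epsilon> \<Longrightarrow> (\<gamma> has_vector_derivative \<gamma>' t) (at t)"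
    and cont: "continuous_on {-\<epsilon><..<\<epsilon>} \<gamma>'" and \<gamma>0: "\<gamma> 0 = P"
    and bd: "\<And>t. \<bar>t\<bar> < \<epsilon> \<Longrightarrow> norm (\<gamma>' t - (2 * t) *\<^sub>R A - (3 * t^2) *\<^sub>R E) \<le> C * \<bar>t\<bar>^3"
    and indep: "cross3 A E \<noteq> 0"
  shows "cusp_230 P \<gamma>"
proof -
  define N where "N = cross3 A E"
  define T where "T z = z $ 1 *\<^sub>R A + z $ 2 *\<^sub>R E + z $ 3 *\<^sub>R N" for z :: "real^3"
  have linT: "linear T" unfolding T_def[abs_def]
    by (intro linearI) (simp_all add: algebra_simps)
  have "inj T"
  proof (subst linear_injective_0[OF linT], intro allI impI)
    fix z assume "T z = 0"
    then have eq: "z $ 1 *\<^sub>R A + z $ 2 *\<^sub>R E + z $ 3 *\<^sub>R N = 0" by (simp add: T_def)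
    have ortho: "A \<bullet> N = 0" "E \<bullet> N = 0" by (simp_all add: N_def dot_cross_self)
    have "(z $ 1 *\<^sub>R A + z $ 2 *\<^sub>R E + z $ 3 *\<^sub>R N) \<bullet> N = z $ 3 * (N \<bullet> N)"
      by (simp add: inner_add_left ortho)
    then have z3: "z $ 3 = 0" using eq indep by (simp add: N_def)
    have "cross3 (z $ 1 *\<^sub>R A + z $ 2 *\<^sub>R E) E = z $ 1 *\<^sub>R N"
      "cross3 A (z $ 1 *\<^sub>R A + z $ 2 *\<^sub>R E) = z $ 2 *\<^sub>R N"
      by (simp_all add: cross_add_left cross_add_right cross_mult_left cross_mult_right N_def)
    moreover have "z $ 1 *\<^sub>R A + z $ 2 *\<^sub>R E = 0" using eq z3 by simp
    ultimately have "z $ 1 *\<^sub>R N = 0" "z $ 2 *\<^sub>R N = 0" by (simp_all only: cross_zero_left cross_zero_right)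
    then have "z $ 1 = 0" "z $ 2 = 0" using indep by (simp_all add: N_def)
    then show "z = 0" using z3 by (simp add: vec_eq_iff forall_3)
  qed
  then obtain S where S: "linear S" "\<And>z. S (T z) = z" "\<And>v. T (S v) = v"
    using linear_injective_isomorphism[OF linT] by blast
  have blS: "bounded_linear S" and blT: "bounded_linear T" using S(1) linT by (simp_all add: linear_conv_bounded_linear)
  obtain K where K: "0 \<le> K" "\<And>v. norm (S v) \<le> norm v * K" using bounded_linear.nonneg_bounded[OF blS] by blast
  define R where "R t = S (\<gamma> t - P - t^2 *\<^sub>R A - t^3 *\<^sub>R E)" for t
  define R' where "R' t = S (\<gamma>' t - (2 * t) *\<^sub>R A - (3 * t^2) *\<^sub>R E)" for t
  have dR: "(R has_vector_derivative R' t) (at t)" if "\<bar>t\<bar> < \<epsilon>" for t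
    unfolding R_def[abs_def] R'_def
    by (rule bounded_linear.has_vector_derivative[OF blS])
      (use der[OF that] in \<open>auto intro!: derivative_eq_intros simp: power2_eq_square\<close>)
  have cR: "continuous_on {-\<epsilon><..<\<epsilon>} R'"
    unfolding R'_def
    by (rule continuous_on_compose2[OF linear_continuous_on[OF blS, of UNIV]])
       (intro continuous_intros cont, simp)
  have bR': "norm (R' t) \<le> (C * K) * \<bar>t\<bar>^3" if "\<bar>t\<bar> < \<epsilon>" for t
    using order_trans[OF K(2) mult_right_mono[OF bd[OF that] K(1)]] by (simp add: R'_def mult_ac)
  have R0: "R 0 = 0" using \<gamma>0 S(1) by (simp add: R_def linear_0)
  have bR: "norm (R t) \<le> (C * K) * t^4" if "\<bar>t\<bar> < \<epsilon>" for t
    using power_bound_from_derivative[OF dR R0 bR' that] by simp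
  show ?thesis
  proof (rule cusp_remainder_extension[OF eps dR cR bR bR'])
    fix \<rho> :: "real^3 \<Rightarrow> real^3" and \<rho>' U
    assume \<rho>: "open U" "0 \<in> U"
      "\<And>z. z \<in> U \<Longrightarrow> (\<rho> has_derivative blinfun_apply (\<rho>' z)) (at z)"
      "continuous_on U \<rho>'" "\<rho> 0 = 0" "\<rho>' 0 = 0" "\<And>t. \<bar>t\<bar> < \<epsilon> \<Longrightarrow> \<rho> (vector [t^2, t^3, 0]) = R t"
    let ?\<theta> = "\<lambda>z. z + \<rho> z"
    obtain U' V g where g: "open U'" "0 \<in> U'" "U' \<subseteq> U" "open V" "0 \<in> V"
      "homeomorphism U' V ?\<theta> g" "Ck_on 1 ?\<theta> U'" "Ck_on 1 g V"
      using local_diffeo_near_identity[OF \<rho>(1-6)] by blast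
    define q where "q p = S (p - P)" for p
    define V0 where "V0 = q -` V"
    have q0: "q P = 0" using S(1) by (simp add: q_def linear_0)
    have cq: "continuous_on B q" for B
      unfolding q_def by (rule continuous_on_compose2[OF linear_continuous_on[OF blS, of UNIV]])
        (intro continuous_intros, simp)
    have "(q has_derivative S) (at p)" for p
    proof -
      have "((\<lambda>p. p - P) has_derivative (\<lambda>h. h)) (at p)" by (auto intro!: derivative_eq_intros)
      from bounded_linear.has_derivative[OF blS this] show ?thesis by (simp add: q_def[abs_def])
    qed
    note dq = this
    have \<theta>g: "?\<theta> z \<in> V" "g (?\<theta> z) = z" if "z \<in> U'" for z using g(6) that by (auto simp: homeomorphism_def)
    have g\<theta>: "g y \<in> U'" "?\<theta> (g y) = y" if "y \<in> V" for y using g(6) that by (auto simp: homeomorphism_def)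
    have qT: "q (P + T v) = v" for v by (simp add: q_def S)
    have Tq: "P + T (q p) = p" for p by (simp add: q_def S)
    let ?\<Phi> = "\<lambda>p. g (q p)" and ?\<Psi> = "\<lambda>z. P + T (?\<theta> z)"
    have V0: "open V0" unfolding V0_def using g(4) cq by (intro open_vimage) auto
    have hom: "homeomorphism V0 U' ?\<Phi> ?\<Psi>"
    proof (rule homeomorphismI)
      show "continuous_on V0 ?\<Phi>"
        by (rule continuous_on_compose2[OF homeomorphism_cont2[OF g(6)] cq]) (auto simp: V0_def)
      have "continuous_on U' (\<lambda>z. T (?\<theta> z))"
        by (rule continuous_on_compose2[OF linear_continuous_on[OF blT, of UNIV] homeomorphism_cont1[OF g(6)]]) auto
      then show "continuous_on U' ?\<Psi>" by (intro continuous_intros)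
      show "?\<Phi> ` V0 \<subseteq> U'" using g\<theta>(1) by (auto simp: V0_def)
      show "?\<Psi> ` U' \<subseteq> V0" using \<theta>g(1) by (auto simp: V0_def qT)
      show "?\<Psi> (?\<Phi> p) = p" if "p \<in> V0" for p using g\<theta>(2)[of "q p"] that by (simp add: V0_def Tq)
      show "?\<Phi> (?\<Psi> z) = z" if "z \<in> U'" for z using \<theta>g(2)[OF that] by (simp add: qT)
    qed
    note Dg = Ck_on_SucE[of 0 g V, unfolded One_nat_def[symmetric], OF g(8)]
    have CkP: "Ck_on 1 ?\<Phi> V0"
    proof (rule Ck_on_1I[OF V0])
      show "(?\<Phi> has_derivative (\<lambda>h. frechet_derivative g (at (q p)) (S h))) (at p)" if "p \<in> V0" for p
        using has_derivative_compose[OF dq Dg(1)] that by (simp add: V0_def)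
      show "continuous_on V0 (\<lambda>p. frechet_derivative g (at (q p)) (S v))" for v
        using Dg(2)[of "S v"] by (intro continuous_on_compose2[OF _ cq]) (auto simp: V0_def)
    qed
    have CkS: "Ck_on 1 ?\<Psi> U'"
      by (intro Ck_on_add[OF g(1)] Ck_on_const Ck_on_bounded_linear[OF blT g(1)] g(7))
    have c: "((\<lambda>s :: real. vector [s^2, s^3, 0] :: real^3) \<longlongrightarrow> 0) (at 0)"
    proof (rule vec_tendstoI)
      fix i :: 3
      show "((\<lambda>s :: real. vector [s^2, s^3, 0] $ i) \<longlongrightarrow> (0 :: real^3) $ i) (at 0)"
        using exhaust_3[of i] by (elim disjE) (auto intro!: tendsto_eq_intros)
    qed
    have v0: "(vector [0, 0, 0] :: real^3) = 0" by (simp add: vec_eq_iff forall_3)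
    obtain \<eta>1 where \<eta>1: "\<eta>1 > 0" "\<And>s. s \<noteq> 0 \<Longrightarrow> \<bar>s\<bar> < \<eta>1 \<Longrightarrow> (vector [s^2, s^3, 0] :: real^3) \<in> U'"
      using topological_tendstoD[OF c g(1,2)] unfolding eventually_at by (auto simp: dist_real_def)
    define \<eta> where "\<eta> = min \<eta>1 \<epsilon>"
    have key: "\<gamma> s \<in> V0 \<and> ?\<Phi> (\<gamma> s) = vector [s^2, s^3, 0]" if s: "s \<in> {-\<eta><..<\<eta>}" for s
    proof -
      have s': "\<bar>s\<bar> < \<eta>1" "\<bar>s\<bar> < \<epsilon>" using s by (auto simp: \<eta>_def)
      have inU: "vector [s^2, s^3, 0] \<in> U'" using \<eta>1(2) s' g(2) v0 by (cases "s = 0") auto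
      have "q (\<gamma> s) = S (s^2 *\<^sub>R A + s^3 *\<^sub>R E) + R s"
        using S(1) by (simp add: q_def R_def flip: linear_add)
      also have "s^2 *\<^sub>R A + s^3 *\<^sub>R E = T (vector [s^2, s^3, 0])" by (simp add: T_def)
      finally have "q (\<gamma> s) = ?\<theta> (vector [s^2, s^3, 0])" using \<rho>(7)[OF s'(2)] by (simp add: S)
      then show ?thesis using \<theta>g[OF inU] by (simp add: V0_def)
    qed
    show ?thesis unfolding cusp_230_def
    proof (rule exI[of _ V0], rule exI[of _ U'], rule exI[of _ ?\<Phi>], rule exI[of _ ?\<Psi>],
        rule exI[of _ "\<lambda>s. s"], rule exI[of _ \<eta>], intro conjI)
      show "P \<in> V0" using q0 g(5) by (simp add: V0_def)
      show "?\<Phi> P = 0" using \<theta>g(2)[OF g(2)] by (simp add: q0 \<rho>(5))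
      show "\<eta> > 0" using eps \<eta>1 by (simp add: \<eta>_def)
      show "\<forall>s\<in>{-\<eta><..<\<eta>}. vector_derivative (\<lambda>s. s) (at s) \<noteq> 0" by simp
      show "\<forall>s\<in>{-\<eta><..<\<eta>}. \<gamma> s \<in> V0 \<and> ?\<Phi> (\<gamma> s) = vector [s^2, s^3, 0]" using key by blast
    qed (use V0 g(1) hom CkP CkS in auto)
  qed
qed

section \<open>Asymptotic directions on the double cover\<close>

lemma frechet_derivative_nth:
  fixes \<xi> :: "real^3 \<Rightarrow> real^3"
  assumes "\<xi> differentiable (at p)"
  shows "frechet_derivative \<xi> (at p) v $ j = grad (\<lambda>q. \<xi> q $ j) p \<bullet> v"
proof -
  have "(\<xi> has_derivative frechet_derivative \<xi> (at p)) (at p)"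
    using assms frechet_derivative_works by blast
  then have D: "((\<lambda>q. \<xi> q $ j) has_derivative (\<lambda>v. frechet_derivative \<xi> (at p) v $ j)) (at p)"
    by (rule bounded_linear.has_derivative[OF bounded_linear_vec_nth])
  then have "(\<lambda>q. \<xi> q $ j) differentiable (at p)" by (auto simp: differentiable_def)
  from has_derivative_unique[OF D has_derivative_grad[OF this]] show ?thesis by (rule fun_cong)
qed

text \<open>The skew part of the derivative of a vector field on three-space is the cross product with half its curl.\<close>

lemma frechet_derivative_inner_curl:
  fixes \<xi> :: "real^3 \<Rightarrow> real^3"
  assumes "\<xi> differentiable (at p)"
  shows "frechet_derivative \<xi> (at p) v \<bullet> w - frechet_derivative \<xi> (at p) w \<bullet> v = curl \<xi> p \<bullet> cross3 v w"
  by (simp add: inner_vec_def sum_3 frechet_derivative_nth[OF assms] grad_def curl_def cross3_def algebra_simps)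

lemma frechet_derivative_quadratic_form:
  fixes \<xi> :: "real^3 \<Rightarrow> real^3"
  assumes "\<xi> differentiable (at p)" and c: "\<xi> p $ 3 \<noteq> 0" and v: "\<xi> p \<bullet> v = 0"
  shows "frechet_derivative \<xi> (at p) v \<bullet> v
    = e_coeff \<xi> p * (v $ 1)^2 + 2 * f_coeff \<xi> p * (v $ 1) * (v $ 2) + g_coeff \<xi> p * (v $ 2)^2"
proof -
  define a b c where "a = \<xi> p $ 1" and "b = \<xi> p $ 2" and "c = \<xi> p $ 3"
  have v3: "v $ 3 = - (a / c) * v $ 1 - (b / c) * v $ 2"
    using v c by (simp add: inner_vec_def sum_3 a_def b_def c_def field_simps)
  have c0: "c \<noteq> 0" using c by (simp add: c_def)
  define A B where "A = a / c" and "B = b / c"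
  have e: "e_coeff \<xi> p = pd 1 (\<lambda>q. \<xi> q $ 1) p
     - (pd 3 (\<lambda>q. \<xi> q $ 1) p + pd 1 (\<lambda>q. \<xi> q $ 3) p) * A + A^2 * pd 3 (\<lambda>q. \<xi> q $ 3) p"
    by (simp add: e_coeff_def Let_def A_def a_def c_def power_divide)
  have g: "g_coeff \<xi> p = pd 2 (\<lambda>q. \<xi> q $ 2) p
     - (pd 3 (\<lambda>q. \<xi> q $ 2) p + pd 2 (\<lambda>q. \<xi> q $ 3) p) * B + B^2 * pd 3 (\<lambda>q. \<xi> q $ 3) p"
    by (simp add: g_coeff_def Let_def B_def b_def c_def power_divide)
  have f: "2 * f_coeff \<xi> p = pd 2 (\<lambda>q. \<xi> q $ 1) p + pd 1 (\<lambda>q. \<xi> q $ 2) p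
     - (pd 3 (\<lambda>q. \<xi> q $ 1) p + pd 1 (\<lambda>q. \<xi> q $ 3) p) * B
     - (pd 3 (\<lambda>q. \<xi> q $ 2) p + pd 2 (\<lambda>q. \<xi> q $ 3) p) * A + 2 * A * B * pd 3 (\<lambda>q. \<xi> q $ 3) p"
    using c0 unfolding f_coeff_def Let_def A_def B_def a_def[symmetric] b_def[symmetric] c_def[symmetric]
    by (simp add: field_simps power2_eq_square)
  have v3': "v $ 3 = - A * v $ 1 - B * v $ 2" using v3 by (simp add: A_def B_def)
  have "frechet_derivative \<xi> (at p) v \<bullet> v = (\<Sum>j\<in>UNIV. (\<Sum>i\<in>UNIV. pd i (\<lambda>q. \<xi> q $ j) p * v $ i) * v $ j)"
    by (simp add: inner_vec_def frechet_derivative_nth[OF assms(1)] grad_def)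
  also have "\<dots> = e_coeff \<xi> p * (v $ 1)^2 + (2 * f_coeff \<xi> p) * (v $ 1) * (v $ 2) + g_coeff \<xi> p * (v $ 2)^2"
    unfolding e f g sum_3 v3' by (simp add: algebra_simps power2_eq_square)
  finally show ?thesis .
qed

text \<open>Where \<open>c \<noteq> 0\<close> the orthogonality condition determines \<open>dz\<close>, and substituting it into the second
  fundamental form yields the binary equation with the coefficients \<open>e\<close>, \<open>f\<close>, \<open>g\<close>.\<close>

lemma asym_dir_iff:
  assumes "\<xi> differentiable (at p)" and c: "\<xi> p $ 3 \<noteq> 0"
  shows "asym_dir \<xi> p v \<longleftrightarrow> v \<noteq> 0 \<and> v $ 3 = - (\<xi> p $ 1 / \<xi> p $ 3) * v $ 1 - (\<xi> p $ 2 / \<xi> p $ 3) * v $ 2 \<and>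
     e_coeff \<xi> p * (v $ 1)^2 + 2 * f_coeff \<xi> p * (v $ 1) * (v $ 2) + g_coeff \<xi> p * (v $ 2)^2 = 0"
proof -
  have "\<xi> p \<bullet> v = 0 \<longleftrightarrow> v $ 3 = - (\<xi> p $ 1 / \<xi> p $ 3) * v $ 1 - (\<xi> p $ 2 / \<xi> p $ 3) * v $ 2"
    using c by (simp add: inner_vec_def sum_3 field_simps) argo
  then show ?thesis
    using frechet_derivative_quadratic_form[OF assms] unfolding asym_dir_def by auto
qed

text \<open>The asymptotic direction on the double cover, normalised by \<open>dx = 1\<close>, is \<open>dir0 + s dir1\<close>. Both
  parts lie in the plane of the field, and \<open>s\<close> is one of the square roots of \<open>- \<K>\<close>.\<close>

definition dir0 :: "(real^3 \<Rightarrow> real^3) \<Rightarrow> real^3 \<Rightarrow> real^3" where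
  "dir0 \<xi> p = vector [1, - (f_coeff \<xi> p / g_coeff \<xi> p),
     - (\<xi> p $ 1 / \<xi> p $ 3) + (\<xi> p $ 2 / \<xi> p $ 3) * (f_coeff \<xi> p / g_coeff \<xi> p)]"

definition dir1 :: "(real^3 \<Rightarrow> real^3) \<Rightarrow> real^3 \<Rightarrow> real^3" where
  "dir1 \<xi> p = vector [0, 1 / g_coeff \<xi> p, - (\<xi> p $ 2 / \<xi> p $ 3) * (1 / g_coeff \<xi> p)]"

definition lift_dir :: "(real^3 \<Rightarrow> real^3) \<Rightarrow> real \<Rightarrow> real^3 \<Rightarrow> real^3" where
  "lift_dir \<xi> s p = dir0 \<xi> p + s *\<^sub>R dir1 \<xi> p"

lemma lift_dir_nth:
  "lift_dir \<xi> s p $ 1 = 1" "lift_dir \<xi> s p $ 2 = (s - f_coeff \<xi> p) / g_coeff \<xi> p"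
  "lift_dir \<xi> s p $ 3 = - (\<xi> p $ 1 / \<xi> p $ 3) - (\<xi> p $ 2 / \<xi> p $ 3) * ((s - f_coeff \<xi> p) / g_coeff \<xi> p)"
  by (simp_all add: lift_dir_def dir0_def dir1_def diff_divide_distrib algebra_simps)

lemma lift_dir_nonzero: "lift_dir \<xi> s p \<noteq> 0"
  using lift_dir_nth(1)[of \<xi> s p] by (metis zero_index zero_neq_one)

lemma xi_inner_dirs:
  assumes "\<xi> p $ 3 \<noteq> 0"
  shows "\<xi> p \<bullet> dir0 \<xi> p = 0" "\<xi> p \<bullet> dir1 \<xi> p = 0" "\<xi> p \<bullet> lift_dir \<xi> s p = 0"
  using assms by (simp_all add: lift_dir_def inner_vec_def sum_3 dir0_def dir1_def field_simps)

lemma lift_dir_eq_iff: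
  assumes "g_coeff \<xi> p \<noteq> 0"
  shows "r *\<^sub>R lift_dir \<xi> s p = r' *\<^sub>R lift_dir \<xi> s' p \<longleftrightarrow> r = r' \<and> (r = 0 \<or> s = s')"
proof
  assume eq: "r *\<^sub>R lift_dir \<xi> s p = r' *\<^sub>R lift_dir \<xi> s' p"
  have "(r *\<^sub>R lift_dir \<xi> s p) $ 1 = (r' *\<^sub>R lift_dir \<xi> s' p) $ 1" by (simp add: eq)
  then have r: "r = r'" by (simp add: lift_dir_nth)
  have "(r *\<^sub>R lift_dir \<xi> s p) $ 2 = (r' *\<^sub>R lift_dir \<xi> s' p) $ 2" by (simp add: eq)
  then show "r = r' \<and> (r = 0 \<or> s = s')" using r assms by (auto simp: lift_dir_nth)
qed auto

text \<open>Multiplied by \<open>g\<close>, the binary form is the difference \<open>(g dy + f dx)\<^sup>2 - s\<^sup>2 dx\<^sup>2\<close>, which factors.\<close>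

lemma asym_dir_iff_lift_dir:
  assumes d: "\<xi> differentiable (at p)" and c: "\<xi> p $ 3 \<noteq> 0" and g: "g_coeff \<xi> p \<noteq> 0" and K: "KK \<xi> p = - (s^2)"
  shows "asym_dir \<xi> p v \<longleftrightarrow> (\<exists>r. r \<noteq> 0 \<and> (v = r *\<^sub>R lift_dir \<xi> s p \<or> v = r *\<^sub>R lift_dir \<xi> (-s) p))"
proof -
  let ?e = "e_coeff \<xi> p" and ?f = "f_coeff \<xi> p" and ?g = "g_coeff \<xi> p"
  have eg: "?e * ?g = ?f^2 - s^2" using K by (simp add: KK_def)
  have "?e * x^2 + 2 * ?f * x * y + ?g * y^2 = 0 \<longleftrightarrow> y = x * ((s - ?f) / ?g) \<or> y = x * ((- s - ?f) / ?g)" for x y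
  proof -
    have "?g * (?e * x^2 + 2 * ?f * x * y + ?g * y^2) = (?g * y + ?f * x - s * x) * (?g * y + ?f * x + s * x)"
      using eg by algebra
    then have "?e * x^2 + 2 * ?f * x * y + ?g * y^2 = 0 \<longleftrightarrow> ?g * y + ?f * x - s * x = 0 \<or> ?g * y + ?f * x + s * x = 0"
      using g by (metis mult_eq_0_iff)
    also have "\<dots> \<longleftrightarrow> y = x * ((s - ?f) / ?g) \<or> y = x * ((- s - ?f) / ?g)"
      using g by (auto simp: field_simps)
    finally show ?thesis .
  qed
  note quad = this
  show ?thesis
  proof
    assume "asym_dir \<xi> p v"
    then have v: "v \<noteq> 0" "v $ 3 = - (\<xi> p $ 1 / \<xi> p $ 3) * v $ 1 - (\<xi> p $ 2 / \<xi> p $ 3) * v $ 2"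
      and "v $ 2 = v $ 1 * ((s - ?f) / ?g) \<or> v $ 2 = v $ 1 * ((- s - ?f) / ?g)"
      unfolding asym_dir_iff[OF d c] quad by auto
    then have "v = v $ 1 *\<^sub>R lift_dir \<xi> s p \<or> v = v $ 1 *\<^sub>R lift_dir \<xi> (-s) p"
      by (auto simp: vec_eq_iff forall_3 lift_dir_nth algebra_simps)
    moreover have "v $ 1 \<noteq> 0" using v calculation by auto
    ultimately show "\<exists>r. r \<noteq> 0 \<and> (v = r *\<^sub>R lift_dir \<xi> s p \<or> v = r *\<^sub>R lift_dir \<xi> (-s) p)" by blast
  next
    assume "\<exists>r. r \<noteq> 0 \<and> (v = r *\<^sub>R lift_dir \<xi> s p \<or> v = r *\<^sub>R lift_dir \<xi> (-s) p)"
    then obtain r where "r \<noteq> 0" "v = r *\<^sub>R lift_dir \<xi> s p \<or> v = r *\<^sub>R lift_dir \<xi> (-s) p" by blast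
    then show "asym_dir \<xi> p v"
      unfolding asym_dir_iff[OF d c] quad
      using lift_dir_nonzero by (auto simp: lift_dir_nth algebra_simps)
  qed
qed

text \<open>The binary form at \<open>0\<close> has \<open>dy = 0\<close> as its only root, so it is a nonzero multiple of \<open>dy\<^sup>2\<close>.\<close>

lemma parabolic_normal_form:
  fixes \<xi> :: "real^3 \<Rightarrow> real^3"
  assumes d: "\<xi> differentiable (at 0)" and \<xi>0: "\<xi> 0 = vector [0, 0, 1]"
    and A: "{v. asym_dir \<xi> 0 v} = {r *\<^sub>R vector [1, 0, 0] | r. r \<noteq> 0}"
  shows "e_coeff \<xi> 0 = 0" "f_coeff \<xi> 0 = 0" "g_coeff \<xi> 0 \<noteq> 0"
proof -
  have iff: "asym_dir \<xi> 0 v \<longleftrightarrow> v \<noteq> 0 \<and> v $ 3 = 0 \<and>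
     e_coeff \<xi> 0 * (v $ 1)^2 + 2 * f_coeff \<xi> 0 * (v $ 1) * (v $ 2) + g_coeff \<xi> 0 * (v $ 2)^2 = 0" for v
    using asym_dir_iff[OF d, of v] \<xi>0 by simp
  have two: "v $ 2 = 0" if "asym_dir \<xi> 0 v" for v
  proof -
    have "v \<in> {r *\<^sub>R vector [1, 0, 0] | r. r \<noteq> 0}" using that A by blast
    then show ?thesis by auto
  qed
  have "vector [1, 0, 0] \<in> {r *\<^sub>R (vector [1, 0, 0] :: real^3) | r. r \<noteq> 0}"
    by (rule CollectI, rule exI[of _ 1]) simp
  then have "asym_dir \<xi> 0 (vector [1, 0, 0])" using A by blast
  then show e: "e_coeff \<xi> 0 = 0" unfolding iff by simp
  show f: "f_coeff \<xi> 0 = 0"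
  proof (rule ccontr)
    assume f: "f_coeff \<xi> 0 \<noteq> 0"
    define v :: "real^3" where "v = vector [- g_coeff \<xi> 0, 2 * f_coeff \<xi> 0, 0]"
    have "v $ 2 \<noteq> 0" "v $ 3 = 0" using f by (simp_all add: v_def)
    moreover from this have "v \<noteq> 0" by (metis zero_index)
    moreover have "e_coeff \<xi> 0 * (v $ 1)^2 + 2 * f_coeff \<xi> 0 * (v $ 1) * (v $ 2) + g_coeff \<xi> 0 * (v $ 2)^2 = 0"
      by (simp add: v_def e power2_eq_square)
    ultimately show False using iff two by blast
  qed
  show "g_coeff \<xi> 0 \<noteq> 0"
  proof
    assume g: "g_coeff \<xi> 0 = 0"
    define v :: "real^3" where "v = vector [0, 1, 0]"
    have "v $ 2 \<noteq> 0" "v $ 3 = 0" by (simp_all add: v_def)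
    moreover from this have "v \<noteq> 0" by (metis zero_index)
    ultimately show False using iff two g e f by (metis add_0 mult_zero_left mult_zero_right)
  qed
qed

lemma pd_eq_deriv:
  assumes "(f has_derivative f') (at p)"
  shows "pd i f p = f' (axis i 1)"
  using frechet_derivative_at[OF assms] by (simp add: pd_def)

lemma Ck_on_coeffs:
  assumes W: "open W" and \<xi>: "Ck_on (Suc k) \<xi> W" and c: "\<And>p. p \<in> W \<Longrightarrow> \<xi> p $ 3 \<noteq> 0"
  shows "Ck_on k (e_coeff \<xi>) W" "Ck_on k (f_coeff \<xi>) W" "Ck_on k (g_coeff \<xi>) W" "Ck_on k (KK \<xi>) W"
    "Ck_on k (\<lambda>p. \<xi> p $ 1 / \<xi> p $ 3) W" "Ck_on k (\<lambda>p. \<xi> p $ 2 / \<xi> p $ 3) W"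
proof -
  have n: "Ck_on (Suc k) (\<lambda>p. \<xi> p $ j) W" for j by (rule Ck_on_nth[OF W \<xi>])
  have n': "Ck_on k (\<lambda>p. \<xi> p $ j) W" for j by (rule Ck_on_SucD[OF n])
  have p: "Ck_on k (pd i (\<lambda>p. \<xi> p $ j)) W" for i j by (rule Ck_on_pd[OF n])
  show e: "Ck_on k (e_coeff \<xi>) W"
    unfolding e_coeff_def[abs_def] Let_def by (intro Ck_on_intros W n' p) (use c in auto)
  show f: "Ck_on k (f_coeff \<xi>) W"
    unfolding f_coeff_def[abs_def] Let_def by (intro Ck_on_intros W n' p) (use c in auto)
  show g: "Ck_on k (g_coeff \<xi>) W"
    unfolding g_coeff_def[abs_def] Let_def by (intro Ck_on_intros W n' p) (use c in auto)
  show "Ck_on k (KK \<xi>) W"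
    unfolding KK_def[abs_def] by (intro Ck_on_intros W e f g)
  show "Ck_on k (\<lambda>p. \<xi> p $ 1 / \<xi> p $ 3) W" "Ck_on k (\<lambda>p. \<xi> p $ 2 / \<xi> p $ 3) W"
    by (intro Ck_on_intros W n' c; assumption)+
qed

text \<open>In \<open>\<K> = e g - f\<^sup>2\<close> only the derivative of \<open>e\<close> survives at \<open>0\<close>. In \<open>e\<close> only that of
  \<open>a\<^sub>x\<close> does, because \<open>a\<close> and \<open>a\<^sub>x\<close> vanish there.\<close>

lemma pd1_KK_normal_form:
  assumes W: "open W" "0 \<in> W" and \<xi>: "Ck_on 2 \<xi> W" and c: "\<And>p. p \<in> W \<Longrightarrow> \<xi> p $ 3 \<noteq> 0"
    and \<xi>0: "\<xi> 0 = vector [0, 0, 1]" and e: "e_coeff \<xi> 0 = 0" and f: "f_coeff \<xi> 0 = 0"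
  shows "pd 1 (KK \<xi>) 0 = pd 1 (pd 1 (\<lambda>p. \<xi> p $ 1)) 0 * g_coeff \<xi> 0"
proof -
  have \<xi>1: "Ck_on (Suc 1) \<xi> W" using \<xi> by (simp add: numeral_2_eq_2)
  note C = Ck_on_coeffs[OF W(1) \<xi>1 c]
  have D: "(h has_derivative (\<lambda>v. grad h 0 \<bullet> v)) (at 0)" if "Ck_on 1 h W" for h
    using has_derivative_grad[of h 0] that W(2) by auto
  have g1: "grad h 0 \<bullet> axis 1 1 = pd 1 h 0" for h by (simp add: grad_def inner_axis)
  define a where "a p = \<xi> p $ 1" for p
  define c' where "c' p = \<xi> p $ 3" for p
  have n: "Ck_on (Suc 1) (\<lambda>p. \<xi> p $ j) W" for j by (rule Ck_on_nth[OF W(1) \<xi>1])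
  have Da: "(a has_derivative (\<lambda>v. grad a 0 \<bullet> v)) (at 0)"
    unfolding a_def[abs_def] by (rule D[OF Ck_on_SucD[OF n]])
  have Dac: "((\<lambda>p. a p / c' p) has_derivative (\<lambda>v. grad (\<lambda>p. a p / c' p) 0 \<bullet> v)) (at 0)"
    unfolding a_def c'_def by (rule D[OF C(5)])
  have a0: "a 0 = 0" "c' 0 = 1" using \<xi>0 by (simp_all add: a_def c'_def)
  have pda: "pd 1 a 0 = 0" using e \<xi>0 by (simp add: e_coeff_def Let_def a_def[abs_def])
  have pdac: "pd 1 (\<lambda>p. a p / c' p) 0 = 0"
  proof -
    have "(c' has_derivative (\<lambda>v. grad c' 0 \<bullet> v)) (at 0)"
      unfolding c'_def[abs_def] by (rule D[OF Ck_on_SucD[OF n]])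
    from has_derivative_divide'[OF Da this] a0
    have "((\<lambda>p. a p / c' p) has_derivative (\<lambda>v. grad a 0 \<bullet> v)) (at 0)" by simp
    from pd_eq_deriv[OF this, of 1] show ?thesis using pda g1[of a] by simp
  qed
  define h1 where "h1 p = pd 3 a p + pd 1 c' p" for p
  define h2 where "h2 p = pd 3 c' p" for p
  have Dp: "(pd i (\<lambda>p. \<xi> p $ j) has_derivative (\<lambda>v. grad (pd i (\<lambda>p. \<xi> p $ j)) 0 \<bullet> v)) (at 0)" for i j
    by (rule D[OF Ck_on_pd[OF n]])
  have Dh: "(h1 has_derivative (\<lambda>v. grad h1 0 \<bullet> v)) (at 0)" "(h2 has_derivative (\<lambda>v. grad h2 0 \<bullet> v)) (at 0)"
    unfolding h1_def[abs_def] h2_def[abs_def] a_def[abs_def] c'_def[abs_def]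
    by (intro D Ck_on_add[OF W(1)] Ck_on_pd[OF n])+
  have e_eq: "e_coeff \<xi> = (\<lambda>p. pd 1 a p - h1 p * (a p / c' p) + (a p / c' p)^2 * h2 p)"
    by (simp add: fun_eq_iff e_coeff_def Let_def h1_def h2_def a_def[abs_def] c'_def[abs_def] power_divide)
  have Dpa: "(pd 1 a has_derivative (\<lambda>v. grad (pd 1 a) 0 \<bullet> v)) (at 0)"
    unfolding a_def[abs_def] by (rule Dp)
  have "(e_coeff \<xi> has_derivative (\<lambda>v. grad (pd 1 a) 0 \<bullet> v - h1 0 * (grad (\<lambda>p. a p / c' p) 0 \<bullet> v))) (at 0)"
    unfolding e_eq by (rule derivative_eq_intros Dpa Dh Dac | simp add: a0)+
  from pd_eq_deriv[OF this, of 1] have pde: "pd 1 (e_coeff \<xi>) 0 = pd 1 (pd 1 a) 0"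
    using pdac by (simp add: g1)
  have "(KK \<xi> has_derivative (\<lambda>v. (grad (e_coeff \<xi>) 0 \<bullet> v) * g_coeff \<xi> 0)) (at 0)"
    unfolding KK_def[abs_def]
    by (rule derivative_eq_intros D[OF C(1)] D[OF C(2)] D[OF C(3)] | simp add: e f)+
  from pd_eq_deriv[OF this, of 1] show ?thesis by (simp add: g1 pde a_def[abs_def])
qed

section \<open>The lifted field and its solutions\<close>

text \<open>The velocity \<open>dp/d(s\<^sup>2/2)\<close>: the factor is chosen so that \<open>\<K>\<close> changes at the rate \<open>-2\<close>. Times \<open>s\<close> it is the
  velocity with respect to \<open>s\<close>, along which \<open>\<K> + s\<^sup>2\<close> is constant.\<close>

definition lift_vel :: "(real^3 \<Rightarrow> real^3) \<Rightarrow> real \<Rightarrow> real^3 \<Rightarrow> real^3" where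
  "lift_vel \<xi> s p = (- 2 / (grad (KK \<xi>) p \<bullet> lift_dir \<xi> s p)) *\<^sub>R lift_dir \<xi> s p"

text \<open>The parameter runs through \<open>[-S, S]\<close> and the points through the ball of radius \<open>r\<close>; there the lifted
  velocity has bound \<open>\<beta>\<close> and Lipschitz constant \<open>\<Lambda>\<close>, and \<open>\<kappa>\<close> is the constant of the second order Taylor formula of \<open>\<xi>\<close>.
  The bound on \<open>\<Lambda> S\<close> makes the integral equation a contraction; the bound on \<open>\<beta> S\<close> keeps solutions
  that meet the ball of radius \<open>r / 2\<close> inside the ball of radius \<open>r\<close>. The foliations will live on the ball of
  radius \<open>u\<close>, where the square root of \<open>- \<K>\<close> is less than \<open>S\<close>.\<close>

locale cusp_box =
  fixes \<xi> :: "real^3 \<Rightarrow> real^3" and W :: "(real^3) set" and r S \<Lambda> \<beta> \<kappa> u :: real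
  assumes r: "0 < r" and S: "0 < S" "S \<le> 1" "4 * \<Lambda> * S \<le> 1" "4 * \<beta> * S \<le> r" and LBC: "0 \<le> \<Lambda>" "0 \<le> \<beta>" "0 \<le> \<kappa>"
    and u: "0 < u" "u \<le> r / 2" "\<And>p. p \<in> ball 0 u \<Longrightarrow> \<bar>KK \<xi> p\<bar> < S^2"
    and sub: "cball 0 r \<subseteq> W"
    and c0: "\<And>p. p \<in> cball 0 r \<Longrightarrow> \<xi> p $ 3 \<noteq> 0"
    and g0: "\<And>p. p \<in> cball 0 r \<Longrightarrow> g_coeff \<xi> p \<noteq> 0"
    and norm1: "\<And>p. p \<in> cball 0 r \<Longrightarrow> norm (\<xi> p) = 1"
    and K_der: "\<And>p. p \<in> cball 0 r \<Longrightarrow> (KK \<xi> has_derivative (\<lambda>v. grad (KK \<xi>) p \<bullet> v)) (at p)"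
    and grad_cont: "continuous_on (cball 0 r) (grad (KK \<xi>))"
    and Kx: "\<And>p. p \<in> cball 0 r \<Longrightarrow> grad (KK \<xi>) p $ 1 \<noteq> 0"
    and rate0: "\<And>p s. p \<in> cball 0 r \<Longrightarrow> \<bar>s\<bar> \<le> S \<Longrightarrow> grad (KK \<xi>) p \<bullet> lift_dir \<xi> s p \<noteq> 0"
    and xi_diff: "\<And>p. p \<in> cball 0 r \<Longrightarrow> \<xi> differentiable (at p)"
    and xi_taylor: "\<And>p q. p \<in> cball 0 r \<Longrightarrow> q \<in> cball 0 r \<Longrightarrow>
      norm (\<xi> q - \<xi> p - frechet_derivative \<xi> (at p) (q - p)) \<le> \<kappa> * norm (q - p)^2"
    and vel_bd: "\<And>p s. p \<in> cball 0 r \<Longrightarrow> \<bar>s\<bar> \<le> S \<Longrightarrow> norm (lift_vel \<xi> s p) \<le> \<beta>"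
    and vel_lip: "\<And>p s p' s'. p \<in> cball 0 r \<Longrightarrow> p' \<in> cball 0 r \<Longrightarrow> \<bar>s\<bar> \<le> S \<Longrightarrow> \<bar>s'\<bar> \<le> S \<Longrightarrow>
      norm (lift_vel \<xi> s p - lift_vel \<xi> s' p') \<le> \<Lambda> * dist (s, p) (s', p')"
begin

abbreviation "K \<equiv> KK \<xi>"
abbreviation "I \<equiv> {-S..S}"

definition field :: "real \<Rightarrow> real^3 \<Rightarrow> real^3" where
  "field s p = s *\<^sub>R lift_vel \<xi> s p"

text \<open>Composing the field with the nearest point retraction to the ball makes it Lipschitz on the whole space,
  so that solutions exist on all of \<open>[-S, S]\<close> whatever the initial value.\<close>

definition cl :: "real^3 \<Rightarrow> real^3" where "cl = closest_point (cball 0 r)"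

lemma cl_in: "cl p \<in> cball 0 r"
  unfolding cl_def by (rule closest_point_in_set) (use r in auto)

lemma cl_id: "p \<in> cball 0 r \<Longrightarrow> cl p = p"
  unfolding cl_def by (rule closest_point_self)

lemma cl_lip: "norm (cl p - cl q) \<le> norm (p - q)"
  unfolding cl_def dist_norm[symmetric] by (rule closest_point_lipschitz) (use r in auto)

lemma I_iff: "s \<in> I \<longleftrightarrow> \<bar>s\<bar> \<le> S" by auto

lemma field_bd: "p \<in> cball 0 r \<Longrightarrow> s \<in> I \<Longrightarrow> norm (field s p) \<le> \<beta> * \<bar>s\<bar>"
  using mult_left_mono[OF vel_bd[of p s], of "\<bar>s\<bar>"] by (auto simp: field_def mult.commute)

lemma field_cl_lip:
  assumes s: "s \<in> I"
  shows "norm (field s (cl p) - field s (cl q)) \<le> \<Lambda> * norm (p - q)"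
proof -
  have "norm (field s (cl p) - field s (cl q)) = \<bar>s\<bar> * norm (lift_vel \<xi> s (cl p) - lift_vel \<xi> s (cl q))"
    by (simp add: field_def flip: scaleR_diff_right)
  also have "\<dots> \<le> 1 * (\<Lambda> * dist (s, cl p) (s, cl q))"
    using vel_lip[OF cl_in cl_in] s S by (intro mult_mono) (auto simp: I_iff)
  also have "\<dots> \<le> \<Lambda> * norm (p - q)"
    using cl_lip[of p q] LBC by (simp add: dist_Pair_Pair dist_norm mult_left_mono)
  finally show ?thesis .
qed

lemma field_cl_cont: "continuous_on (I \<times> UNIV) (\<lambda>(s, p). field s (cl p))"
proof -
  have "\<Lambda>-lipschitz_on (I \<times> UNIV) (\<lambda>z. lift_vel \<xi> (fst z) (cl (snd z)))"
  proof (rule lipschitz_onI)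
    fix z z' :: "real \<times> (real^3)" assume "z \<in> I \<times> UNIV" "z' \<in> I \<times> UNIV"
    then have "norm (lift_vel \<xi> (fst z) (cl (snd z)) - lift_vel \<xi> (fst z') (cl (snd z')))
      \<le> \<Lambda> * dist (fst z, cl (snd z)) (fst z', cl (snd z'))"
      using vel_lip[OF cl_in cl_in] by (auto simp: I_iff)
    also have "dist (fst z, cl (snd z)) (fst z', cl (snd z')) \<le> dist z z'"
      using cl_lip[of "snd z" "snd z'"]
      by (auto simp: dist_prod_def dist_norm intro!: real_sqrt_le_mono power_mono)
    finally show "dist (lift_vel \<xi> (fst z) (cl (snd z))) (lift_vel \<xi> (fst z') (cl (snd z'))) \<le> \<Lambda> * dist z z'"
      using LBC by (simp add: dist_norm mult_left_mono)
  qed (use LBC in simp)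
  from lipschitz_on_continuous_on[OF this]
  have "continuous_on (I \<times> UNIV) (\<lambda>z. fst z *\<^sub>R lift_vel \<xi> (fst z) (cl (snd z)))"
    by (intro continuous_intros)
  then show ?thesis by (simp add: field_def case_prod_beta')
qed

lemma solution_exists:
  assumes "s0 \<in> I"
  shows "\<exists>y. y s0 = q \<and> (\<forall>s\<in>I. (y has_vector_derivative field s (cl (y s))) (at s within I))"
proof (rule lipschitz_ode_existence[where L = \<Lambda> and B = "\<beta> * S"])
  show "norm (field s (cl p)) \<le> \<beta> * S" if "s \<in> I" for s p
    using field_bd[OF cl_in that, of p] that LBC by (meson I_iff mult_left_mono order_trans)
qed (use field_cl_lip field_cl_cont S LBC assms in auto)

definition sol :: "real \<Rightarrow> real^3 \<Rightarrow> real \<Rightarrow> real^3" where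
  "sol s0 q = (SOME y. y s0 = q \<and> (\<forall>s\<in>I. (y has_vector_derivative field s (cl (y s))) (at s within I)))"

lemma sol:
  assumes "s0 \<in> I"
  shows sol_init: "sol s0 q s0 = q"
    and sol_cl_der: "s \<in> I \<Longrightarrow> (sol s0 q has_vector_derivative field s (cl (sol s0 q s))) (at s within I)"
  using someI_ex[OF solution_exists[OF assms, of q]] unfolding sol_def by blast+

lemma solution_dependence:
  assumes "\<And>s. s \<in> I \<Longrightarrow> (y1 has_vector_derivative field s (cl (y1 s))) (at s within I)"
    "\<And>s. s \<in> I \<Longrightarrow> (y2 has_vector_derivative field s (cl (y2 s))) (at s within I)" "s \<in> I" "s' \<in> I"
  shows "norm (y1 s - y2 s) \<le> 2 * norm (y1 s' - y2 s')"
  by (rule lipschitz_ode_dependence[where F = "\<lambda>s p. field s (cl p)" and L = \<Lambda> and S = S])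
    (use assms field_cl_lip S LBC in auto)

lemma sol_unique:
  assumes "\<And>s. s \<in> I \<Longrightarrow> (y has_vector_derivative field s (cl (y s))) (at s within I)" "s0 \<in> I" "s \<in> I" "s1 \<in> I"
    "y s1 = sol s0 q s1"
  shows "y s = sol s0 q s"
  using solution_dependence[of y "sol s0 q" s s1] sol_cl_der[OF assms(2)] assms by simp

lemma sol_sol:
  assumes "s0 \<in> I" "s1 \<in> I" "s \<in> I"
  shows "sol s1 (sol s0 q s1) s = sol s0 q s"
  by (rule sol_unique[of _ s0 s s1]) (use sol_cl_der sol_init assms in auto)

lemma sol_lip:
  assumes "s0 \<in> I" "s \<in> I" "s' \<in> I"
  shows "norm (sol s0 q s - sol s0 q s') \<le> \<beta> * S * \<bar>s - s'\<bar>"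
proof -
  have "norm (sol s0 q s - sol s0 q s') \<le> \<beta> * S * norm (s - s')"
  proof (rule differentiable_bound[where S = I and f' = "\<lambda>s h. h *\<^sub>R field s (cl (sol s0 q s))"])
    fix t assume t: "t \<in> I"
    show "(sol s0 q has_derivative (\<lambda>h. h *\<^sub>R field t (cl (sol s0 q t)))) (at t within I)"
      using sol_cl_der[OF assms(1) t] by (simp add: has_vector_derivative_def)
    have "norm (field t (cl (sol s0 q t))) \<le> \<beta> * S"
      using field_bd[OF cl_in t] t LBC by (meson I_iff mult_left_mono order_trans)
    then show "onorm (\<lambda>h. h *\<^sub>R field t (cl (sol s0 q t))) \<le> \<beta> * S"
      using onorm_scaleR_left[of "\<lambda>h. h" "field t (cl (sol s0 q t))"] by (simp add: bounded_linear_ident onorm_id)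
  qed (use assms in auto)
  then show ?thesis by simp
qed

lemma sol_cont: "s0 \<in> I \<Longrightarrow> continuous_on I (sol s0 q)"
  using sol_cl_der by (meson has_vector_derivative_continuous continuous_on_eq_continuous_within)

text \<open>Solutions that stay in the box are genuine solutions of the equation.\<close>

definition stays :: "real \<Rightarrow> real^3 \<Rightarrow> bool" where
  "stays s0 q \<longleftrightarrow> s0 \<in> I \<and> (\<forall>s\<in>I. sol s0 q s \<in> cball 0 r)"

lemma staysI:
  assumes "s0 \<in> I" "q \<in> cball 0 (r/2)"
  shows "stays s0 q"
  unfolding stays_def
proof (intro conjI ballI assms(1))
  fix s assume s: "s \<in> I"
  have "norm (sol s0 q s - sol s0 q s0) \<le> \<beta> * S * \<bar>s - s0\<bar>" by (rule sol_lip) (use assms s in auto)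
  also have "\<dots> \<le> \<beta> * S * 2" using s assms(1) S LBC by (intro mult_left_mono) auto
  also have "\<dots> \<le> r / 2" using S by simp
  finally have "norm (sol s0 q s - q) \<le> r / 2" using sol_init[OF assms(1)] by simp
  then show "sol s0 q s \<in> cball 0 r"
    using assms(2) norm_triangle_sub[of "sol s0 q s" q] by (simp add: dist_norm)
qed

lemma stays_sol: "stays s0 q \<Longrightarrow> s1 \<in> I \<Longrightarrow> stays s1 (sol s0 q s1)"
  unfolding stays_def using sol_sol by auto

lemma staysD: "stays s0 q \<Longrightarrow> s0 \<in> I" "stays s0 q \<Longrightarrow> s \<in> I \<Longrightarrow> sol s0 q s \<in> cball 0 r"
  by (auto simp: stays_def)

lemma sol_der_within:
  assumes "stays s0 q" "s \<in> I"
  shows "(sol s0 q has_vector_derivative field s (sol s0 q s)) (at s within I)"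
  using sol_cl_der[OF staysD(1)[OF assms(1)] assms(2)] cl_id[OF staysD(2)[OF assms]] by metis

lemma sol_der:
  assumes "stays s0 q" "\<bar>s\<bar> < S"
  shows "(sol s0 q has_vector_derivative field s (sol s0 q s)) (at s)"
proof -
  have s: "s \<in> {-S<..<S}" "s \<in> I" using assms(2) by auto
  show ?thesis
    using sol_der_within[OF assms(1) s(2)] vector_derivative_within_open_interval[OF s(1)] by blast
qed

lemma first_integral:
  assumes st: "stays s0 q" and "s \<in> I"
  shows "K (sol s0 q s) + s^2 = K q + s0^2"
proof -
  let ?y = "sol s0 q"
  have "\<exists>c. \<forall>s\<in>I. K (?y s) + s^2 = c"
  proof (rule has_derivative_zero_constant)
    fix s assume s: "s \<in> I"
    note y = staysD(2)[OF st s]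
    have dK: "((\<lambda>s. K (?y s)) has_derivative (\<lambda>h. grad K (?y s) \<bullet> (h *\<^sub>R field s (?y s)))) (at s within I)"
      by (rule has_derivative_compose[OF sol_der_within[OF st s, unfolded has_vector_derivative_def] K_der[OF y]])
    have "grad K (?y s) \<bullet> field s (?y s) = - 2 * s"
      using rate0[OF y] s by (auto simp: field_def lift_vel_def I_iff)
    then show "((\<lambda>s. K (?y s) + s^2) has_derivative (\<lambda>h. 0)) (at s within I)"
      by (auto intro!: derivative_eq_intros dK)
  qed simp
  then obtain c where "\<forall>s\<in>I. K (?y s) + s^2 = c" by blast
  then have "K (?y s) + s^2 = K (?y s0) + s0^2" using assms(2) staysD(1)[OF st] by metis
  then show ?thesis using sol_init[OF staysD(1)[OF st]] by simp
qed

text \<open>On lines parallel to the first axis \<open>\<K>\<close> is strictly monotone, so the last two coordinates are injective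
  on the parabolic set.\<close>

lemma K_injective_on_lines:
  assumes "p \<in> cball 0 r" "q \<in> cball 0 r" "K p = K q" "p $ 2 = q $ 2" "p $ 3 = q $ 3"
  shows "p = q"
proof (rule ccontr)
  assume ne: "p \<noteq> q"
  define f where "f t = K (p + t *\<^sub>R (q - p))" for t :: real
  have in_ball: "p + t *\<^sub>R (q - p) \<in> cball 0 r" if "t \<in> {0..1}" for t
  proof -
    have "(1 - t) *\<^sub>R p + t *\<^sub>R q \<in> cball 0 r"
      using assms(1,2) that by (intro convexD[OF convex_cball]) auto
    then show ?thesis by (simp add: algebra_simps)
  qed
  have df: "(f has_derivative (\<lambda>h. grad K (p + t *\<^sub>R (q - p)) \<bullet> (h *\<^sub>R (q - p)))) (at t)" if "t \<in> {0..1}" for t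
  proof -
    have "((\<lambda>t. p + t *\<^sub>R (q - p)) has_derivative (\<lambda>h. h *\<^sub>R (q - p))) (at t)"
      by (auto intro!: derivative_eq_intros)
    from has_derivative_compose[OF this K_der[OF in_ball[OF that]]] show ?thesis
      by (simp add: f_def[abs_def])
  qed
  have "\<exists>t. 0 < t \<and> t < 1 \<and> (\<lambda>h. grad K (p + t *\<^sub>R (q - p)) \<bullet> (h *\<^sub>R (q - p))) = (\<lambda>h. 0)"
  proof (rule Rolle_deriv)
    show "f 0 = f 1" using assms(3) by (simp add: f_def)
    show "continuous_on {0..1} f"
      using df by (intro continuous_at_imp_continuous_on ballI has_derivative_continuous)
  qed (use df in auto)
  then obtain t where t: "0 < t" "t < 1"
    "(\<lambda>h. grad K (p + t *\<^sub>R (q - p)) \<bullet> (h *\<^sub>R (q - p))) = (\<lambda>h. 0)" by blast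
  from fun_cong[OF t(3), of 1] have "grad K (p + t *\<^sub>R (q - p)) \<bullet> (q - p) = 0" by simp
  then have "grad K (p + t *\<^sub>R (q - p)) $ 1 * (q $ 1 - p $ 1) = 0"
    using assms(4,5) by (simp add: inner_vec_def sum_3)
  then have "q $ 1 = p $ 1" using Kx[OF in_ball[of t]] t by simp
  then show False using ne assms(4,5) by (simp add: vec_eq_iff forall_3)
qed

lemma asym_dir_lift_vel:
  assumes "p \<in> cball 0 r" "\<bar>s\<bar> \<le> S" "K p = - (s^2)" "t \<noteq> 0"
  shows "asym_dir \<xi> p (t *\<^sub>R lift_vel \<xi> s p)"
proof -
  have "t *\<^sub>R lift_vel \<xi> s p = (t * (- 2 / (grad K p \<bullet> lift_dir \<xi> s p))) *\<^sub>R lift_dir \<xi> s p"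
    by (simp add: lift_vel_def)
  moreover have "t * (- 2 / (grad K p \<bullet> lift_dir \<xi> s p)) \<noteq> 0"
    using assms rate0 by simp
  ultimately show ?thesis
    unfolding asym_dir_iff_lift_dir[OF xi_diff[OF assms(1)] c0[OF assms(1)] g0[OF assms(1)] assms(3)] by blast
qed

lemma mem_hyperbolic: "p \<in> cball 0 r \<Longrightarrow> p \<in> hyperbolic_set \<xi> W \<longleftrightarrow> K p < 0"
  and mem_parabolic: "p \<in> cball 0 r \<Longrightarrow> p \<in> parabolic_set \<xi> W \<longleftrightarrow> K p = 0"
  using sub c0 by (auto simp: hyperbolic_set_def parabolic_set_def)

end

section \<open>Straightening the asymptotic lines\<close>

context cusp_box begin

abbreviation "U \<equiv> ball (0 :: real^3) u"
abbreviation "N \<equiv> {q \<in> U. K q \<le> 0}"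
abbreviation "M \<equiv> U \<inter> hyperbolic_set \<xi> W"

lemma U_sub: "p \<in> U \<Longrightarrow> p \<in> cball 0 (r/2)" "p \<in> U \<Longrightarrow> p \<in> cball 0 r"
  using u r by auto

lemma M_eq: "M = {q \<in> U. K q < 0}"
  using mem_hyperbolic U_sub by blast

lemma K_cont: "continuous_on (cball 0 r) K"
  using K_der by (intro continuous_at_imp_continuous_on ballI has_derivative_continuous)

lemma K_cont_U: "continuous_on U K"
  using K_cont U_sub by (blast intro: continuous_on_subset)

lemma open_level: "open {q \<in> U. a < K q}" "open {q \<in> U. K q < a}"
proof -
  have "open (U \<inter> K -` {a<..})" "open (U \<inter> K -` {..<a})"
    using continuous_open_preimage[OF K_cont_U] by auto
  then show "open {q \<in> U. a < K q}" "open {q \<in> U. K q < a}"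
    by (simp_all add: Int_def vimage_def)
qed

lemma open_M: "open M"
  unfolding M_eq by (rule open_level)

definition lev :: "real^3 \<Rightarrow> real" where "lev q = sqrt (- K q)"

lemma lev:
  assumes "q \<in> N"
  shows "0 \<le> lev q" "lev q < S" "(lev q)^2 = - K q"
proof -
  show "0 \<le> lev q" "(lev q)^2 = - K q" using assms by (auto simp: lev_def)
  have "- K q < S^2" using u(3)[of q] assms by auto
  then have "sqrt (- K q) < sqrt (S^2)" by (rule real_sqrt_less_mono)
  then show "lev q < S" using S by (simp add: lev_def)
qed

lemma lev_cont: "continuous_on U lev"
  unfolding lev_def by (intro continuous_intros K_cont_U)

text \<open>The point of the parabolic set from which the line through \<open>q\<close> of the family \<open>e = 1\<close> or \<open>e = -1\<close> starts:
  the solution through \<open>q\<close>, at the time \<open>e sqrt (- \<K>)\<close>, is followed back to the time \<open>0\<close>.\<close>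

definition foot :: "real \<Rightarrow> real^3 \<Rightarrow> real^3" where "foot e q = sol (e * lev q) q 0"

definition proj :: "real^3 \<Rightarrow> real^2" where "proj p = vector [p $ 2, p $ 3]"

definition chart :: "real \<Rightarrow> real^3 \<Rightarrow> (real^2) \<times> real" where
  "chart e q = (proj (foot e q), e * lev q)"

lemma proj_cont: "continuous_on A proj"
proof -
  have "continuous_on A (\<lambda>p. \<chi> i. proj p $ i)"
  proof (rule continuous_on_vec_lambda)
    show "continuous_on A (\<lambda>p. proj p $ i)" for i
      using exhaust_2[of i] unfolding proj_def by (elim disjE) (auto intro!: continuous_intros)
  qed
  then show ?thesis by simp
qed

lemma proj_eq_iff: "proj p = proj q \<longleftrightarrow> p $ 2 = q $ 2 \<and> p $ 3 = q $ 3"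
  by (simp add: proj_def vec_eq_iff forall_2)

lemma zero_I: "0 \<in> I" using S by simp

lemma foot:
  assumes e: "\<bar>e\<bar> = 1" and q: "q \<in> N"
  shows "\<bar>e * lev q\<bar> < S" "e * lev q \<in> I" "stays 0 (foot e q)" "foot e q \<in> cball 0 r"
    "K (foot e q) = 0" "sol 0 (foot e q) (e * lev q) = q"
proof -
  show i: "\<bar>e * lev q\<bar> < S" using lev[OF q] e by (simp add: abs_mult)
  then show i': "e * lev q \<in> I" by auto
  have st: "stays (e * lev q) q" using staysI[OF i'] U_sub q by blast
  show "stays 0 (foot e q)" unfolding foot_def by (rule stays_sol[OF st zero_I])
  show "foot e q \<in> cball 0 r" unfolding foot_def by (rule staysD(2)[OF st zero_I])
  have "(e * lev q)^2 = - K q" using lev(3)[OF q] e by (simp add: power_mult_distrib abs_square_eq_1 flip: power2_abs[of e])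
  then show "K (foot e q) = 0" using first_integral[OF st zero_I] by (simp add: foot_def)
  show "sol 0 (foot e q) (e * lev q) = q"
    unfolding foot_def using sol_sol[OF i' zero_I i'] sol_init[OF i'] by simp
qed

lemma chart_sol:
  assumes e: "\<bar>e\<bar> = 1" and P: "stays 0 P" "K P = 0" and s: "\<bar>s\<bar> \<le> S" "0 \<le> e * s" and q: "sol 0 P s \<in> U"
  shows "K (sol 0 P s) = - (s^2)" "foot e (sol 0 P s) = P" "chart e (sol 0 P s) = (proj P, s)"
proof -
  have sI: "s \<in> I" using s by auto
  show Kq: "K (sol 0 P s) = - (s^2)" using first_integral[OF P(1) sI] P(2) by simp
  then have l: "lev (sol 0 P s) = \<bar>s\<bar>" by (simp add: lev_def)
  have es: "e * \<bar>s\<bar> = s"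
    using e s(2) by (cases "e = 1") (auto simp: abs_if zero_le_mult_iff split: if_splits)
  show f: "foot e (sol 0 P s) = P"
    unfolding foot_def l es using sol_sol[OF zero_I sI zero_I] sol_init[OF zero_I] by simp
  show "chart e (sol 0 P s) = (proj P, s)" by (simp add: chart_def f l es)
qed

lemma chart_eqD:
  assumes e: "\<bar>e\<bar> = 1" and q: "q \<in> N" and P: "P \<in> cball 0 r" "K P = 0" and c: "chart e q = (proj P, s)"
  shows "s = e * lev q" "foot e q = P" "q = sol 0 P s"
proof -
  show s: "s = e * lev q" using c by (simp add: chart_def)
  show f: "foot e q = P"
    using c foot[OF e q] P by (intro K_injective_on_lines) (auto simp: chart_def proj_eq_iff)
  show "q = sol 0 P s" using foot(6)[OF e q] f s by simp
qed

text \<open>Two solutions whose values at some time are close are close at the time \<open>0\<close>; the times at which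
  they pass through \<open>q\<close> and \<open>q0\<close> differ little because \<open>lev\<close> is continuous.\<close>

lemma foot_cont:
  assumes e: "\<bar>e\<bar> = 1"
  shows "continuous_on N (foot e)"
  unfolding continuous_on_def
proof
  fix q0 assume q0: "q0 \<in> N"
  have lc: "continuous_on N lev" using lev_cont by (rule continuous_on_subset) auto
  have "((\<lambda>q. 2 * (norm (q - q0) + \<beta> * S * \<bar>e * lev q0 - e * lev q\<bar>))
      \<longlongrightarrow> 2 * (norm (q0 - q0) + \<beta> * S * \<bar>e * lev q0 - e * lev q0\<bar>)) (at q0 within N)"
    using lc q0 by (intro tendsto_intros) (auto simp: continuous_on_def)
  then have lim: "((\<lambda>q. 2 * (norm (q - q0) + \<beta> * S * \<bar>e * lev q0 - e * lev q\<bar>)) \<longlongrightarrow> 0) (at q0 within N)"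
    by simp
  have "\<forall>\<^sub>F q in at q0 within N. norm (foot e q - foot e q0) \<le> 2 * (norm (q - q0) + \<beta> * S * \<bar>e * lev q0 - e * lev q\<bar>)"
    unfolding eventually_at_filter
  proof (rule always_eventually, intro allI impI)
    fix q assume q: "q \<in> N"
    let ?v = "e * lev q" and ?w = "e * lev q0"
    note i = foot(2)[OF e q] foot(2)[OF e q0]
    have "norm (foot e q - foot e q0) \<le> 2 * norm (sol ?v q ?v - sol ?w q0 ?v)"
      unfolding foot_def
      by (rule solution_dependence[where ?y1.0 = "sol ?v q" and ?y2.0 = "sol ?w q0" and s = 0 and s' = ?v]) (use sol_cl_der i zero_I in auto)
    also have "norm (sol ?v q ?v - sol ?w q0 ?v) \<le> norm (q - q0) + norm (sol ?w q0 ?w - sol ?w q0 ?v)"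
      using norm_triangle_ineq[of "q - q0" "q0 - sol ?w q0 ?v"] sol_init i by simp
    also have "norm (sol ?w q0 ?w - sol ?w q0 ?v) \<le> \<beta> * S * \<bar>?w - ?v\<bar>"
      by (rule sol_lip) (use i in auto)
    finally show "norm (foot e q - foot e q0) \<le> 2 * (norm (q - q0) + \<beta> * S * \<bar>?w - ?v\<bar>)" by simp
  qed
  from Lim_null_comparison[OF this lim] show "(foot e \<longlongrightarrow> foot e q0) (at q0 within N)"
    by (rule LIM_zero_cancel)
qed

lemma chart_cont: "\<bar>e\<bar> = 1 \<Longrightarrow> continuous_on N (chart e)"
  unfolding chart_def[abs_def]
  by (intro continuous_on_Pair continuous_on_compose2[OF proj_cont foot_cont] continuous_intros
    continuous_on_subset[OF lev_cont]) auto

lemma chart_inj: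
  assumes e: "\<bar>e\<bar> = 1"
  shows "inj_on (chart e) N"
proof (rule inj_onI)
  fix q q' assume q: "q \<in> N" "q' \<in> N" and eq: "chart e q = chart e q'"
  note f' = foot[OF e q(2)]
  have "chart e q = (proj (foot e q'), e * lev q')" using eq by (simp add: chart_def)
  from chart_eqD(3)[OF e q(1) f'(4,5) this] show "q = q'" using f'(6) by simp
qed

lemma MN: "q \<in> M \<Longrightarrow> q \<in> N"
  unfolding M_eq by auto

definition leaves :: "real \<Rightarrow> (real^3) set set" where "leaves e = chart_leaves (chart e) M"

definition leaf_field :: "real \<Rightarrow> real^3 \<Rightarrow> real^3" where "leaf_field e q = field (e * lev q) q"

lemma foliation_leaves:
  assumes e: "\<bar>e\<bar> = 1"
  shows "foliation M (leaves e)"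
  unfolding leaves_def
proof (rule foliation_chart_leaves[OF open_M])
  have sub: "M \<subseteq> N" using MN by blast
  show "continuous_on M (chart e)" by (rule continuous_on_subset[OF chart_cont[OF e] sub])
  show "inj_on (chart e) M" by (rule inj_on_subset[OF chart_inj[OF e] sub])
qed

lemma leafE:
  assumes e: "\<bar>e\<bar> = 1" and L: "L \<in> leaves e"
  obtains d C where "L = M \<inter> chart e -` ({d} \<times> C)" "C \<in> components {s. (d, s) \<in> chart e ` M}"
    "open C" "is_interval C" "C \<noteq> {}"
    "\<And>s. s \<in> C \<Longrightarrow> \<exists>q\<in>L. chart e q = (d, s)" "\<And>s. s \<in> C \<Longrightarrow> 0 < e * s"
proof -
  define sl where "sl d = {s. (d, s) \<in> chart e ` M}" for d
  have "leaves e = {M \<inter> chart e -` ({d} \<times> C) | d C. C \<in> components (sl d)}"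
    by (simp add: leaves_def chart_leaves_def sl_def)
  with L obtain d C where dC: "L = M \<inter> chart e -` ({d} \<times> C)" "C \<in> components (sl d)" by blast
  have "open (chart e ` M)"
  proof (rule invariance_of_domain_gen[OF open_M])
    have sub: "M \<subseteq> N" using MN by blast
    show "continuous_on M (chart e)" by (rule continuous_on_subset[OF chart_cont[OF e] sub])
    show "inj_on (chart e) M" by (rule inj_on_subset[OF chart_inj[OF e] sub])
  qed simp
  from open_components[OF open_slice[OF this, of d, folded sl_def] dC(2)] have "open C" .
  moreover have "is_interval C"
    using in_components_connected[OF dC(2)] by (simp add: is_interval_connected_1)
  moreover have "C \<noteq> {}" by (rule in_components_nonempty[OF dC(2)])
  moreover have ex: "\<exists>q\<in>L. chart e q = (d, s)" if "s \<in> C" for s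
  proof -
    have "s \<in> sl d" using in_components_subset[OF dC(2)] that by blast
    then obtain q where "q \<in> M" "chart e q = (d, s)" unfolding sl_def by fastforce
    then show ?thesis using that by (intro bexI[of _ q]) (auto simp: dC(1))
  qed
  moreover have "0 < e * s" if sC: "s \<in> C" for s
  proof -
    obtain q where q: "q \<in> L" "chart e q = (d, s)" using ex[OF sC] by blast
    then have "K q < 0" "s = e * lev q" unfolding dC(1) M_eq by (auto simp: chart_def)
    moreover have "0 < lev q" using calculation(1) by (simp add: lev_def)
    moreover have "e * e = 1" using e by (auto simp: abs_if split: if_splits)
    ultimately show ?thesis by (simp flip: mult.assoc)
  qed
  ultimately show thesis using that[OF dC(1) dC(2)[unfolded sl_def]] by simp
qed

text \<open>Inverting the chart along a vertical line reproduces a solution starting on the parabolic set, since the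
  chart of a solution is (its starting point, the time). The leaves are thus integral curves.\<close>

lemma asym_foliation_leaves:
  assumes e: "\<bar>e\<bar> = 1"
  shows "asym_foliation \<xi> M (leaf_field e) (leaves e)"
  unfolding asym_foliation_def
proof (intro conjI ballI foliation_leaves[OF e])
  have lv: "\<Lambda>-lipschitz_on (I \<times> cball 0 r) (\<lambda>z. lift_vel \<xi> (fst z) (snd z))"
    using vel_lip LBC by (intro lipschitz_onI) (auto simp: I_iff dist_norm)
  have "continuous_on M (\<lambda>q. (e * lev q, q))"
    by (intro continuous_intros continuous_on_subset[OF lev_cont]) auto
  from continuous_on_compose2[OF lipschitz_on_continuous_on[OF lv] this]
  have "continuous_on M (\<lambda>q. lift_vel \<xi> (e * lev q) q)"
    using foot(2)[OF e MN] U_sub by (auto simp: image_subset_iff)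
  then show "continuous_on M (leaf_field e)"
    unfolding leaf_field_def[abs_def] field_def
    by (intro continuous_intros continuous_on_subset[OF lev_cont]) auto
next
  fix q assume q: "q \<in> M"
  note qN = MN[OF q]
  have l: "0 < lev q" using q unfolding M_eq lev_def by simp
  have e2: "e * e = 1" using e by (auto simp: abs_if split: if_splits)
  show "asym_dir \<xi> q (leaf_field e q)"
    unfolding leaf_field_def field_def
  proof (rule asym_dir_lift_vel)
    show "q \<in> cball 0 r" using U_sub qN by blast
    show "K q = - ((e * lev q)^2)" using lev(3)[OF qN] e2 by (simp add: power_mult_distrib power2_eq_square[of e])
    show "\<bar>e * lev q\<bar> \<le> S" using foot(1)[OF e qN] by simp
    show "e * lev q \<noteq> 0" using l e2 by auto
  qed
next
  fix L assume L: "L \<in> leaves e"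
  obtain d C where dC: "L = M \<inter> chart e -` ({d} \<times> C)" "open C" "is_interval C" "C \<noteq> {}"
    "\<And>s. s \<in> C \<Longrightarrow> \<exists>q\<in>L. chart e q = (d, s)" "\<And>s. s \<in> C \<Longrightarrow> 0 < e * s"
    by (rule leafE[OF e L]) (rule that; assumption)
  have inj: "inj_on (chart e) M" using chart_inj[OF e] by (rule inj_on_subset) (use MN in blast)
  define \<sigma> where "\<sigma> s = inv_into M (chart e) (d, s)" for s
  have \<sigma>_eq: "\<sigma> s = q" if "q \<in> M" "chart e q = (d, s)" for q s
    using inv_into_f_f[OF inj that(1)] that(2) by (simp add: \<sigma>_def)
  have \<sigma>: "\<sigma> s \<in> L" "\<sigma> s \<in> M" "chart e (\<sigma> s) = (d, s)" if "s \<in> C" for s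
  proof -
    obtain q where q: "q \<in> L" "chart e q = (d, s)" using dC(5)[OF \<open>s \<in> C\<close>] by blast
    then have "q \<in> M" unfolding dC(1) by blast
    then show "\<sigma> s \<in> L" "\<sigma> s \<in> M" "chart e (\<sigma> s) = (d, s)" using \<sigma>_eq q by auto
  qed
  have "inj_on \<sigma> C" using \<sigma>(3) by (metis inj_onI snd_conv)
  moreover have "\<sigma> ` C = L"
  proof (intro equalityI subsetI)
    fix q assume "q \<in> L"
    then have q: "q \<in> M" "chart e q \<in> {d} \<times> C" unfolding dC(1) by auto
    then obtain s where "s \<in> C" "chart e q = (d, s)" by auto
    then show "q \<in> \<sigma> ` C" using \<sigma>_eq[OF q(1)] by (metis imageI)
  qed (use \<sigma> in auto)
  moreover have "(\<sigma> has_vector_derivative leaf_field e (\<sigma> s0)) (at s0)" if s0: "s0 \<in> C" for s0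
  proof -
    note q0 = \<sigma>[OF s0]
    define P where "P = foot e (\<sigma> s0)"
    note f = foot[OF e MN[OF q0(2)], folded P_def]
    have s0_eq: "e * lev (\<sigma> s0) = s0" and dP: "d = proj P" using q0(3) by (auto simp: chart_def P_def)
    have P0: "sol 0 P s0 = \<sigma> s0" using f(6) s0_eq by simp
    define Q where "Q = {-S<..<S} \<inter> sol 0 P -` U \<inter> {s. 0 < e * s}"
    have "continuous_on {-S<..<S} (sol 0 P)" using sol_cont[OF zero_I] by (rule continuous_on_subset) auto
    from continuous_open_preimage[OF this open_greaterThanLessThan open_ball]
    have "open ({-S<..<S} \<inter> sol 0 P -` U)" .
    then have "open Q" unfolding Q_def
      by (rule open_Int) (intro open_Collect_less continuous_intros)
    moreover have "s0 \<in> Q" using f(1) s0_eq dC(6)[OF s0] q0(2) P0 by (auto simp: Q_def abs_less_iff)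
    moreover have "sol 0 P s = \<sigma> s" if "s \<in> Q" for s
    proof -
      have s: "\<bar>s\<bar> \<le> S" "0 < e * s" "sol 0 P s \<in> U" using that by (auto simp: Q_def)
      note c = chart_sol[OF e f(3,5) s(1) less_imp_le[OF s(2)] s(3)]
      have "s \<noteq> 0" using s(2) by auto
      then have "sol 0 P s \<in> M" unfolding M_eq using s(3) c(1) by simp
      then show ?thesis using \<sigma>_eq c(3) dP by simp
    qed
    moreover have "(sol 0 P has_vector_derivative leaf_field e (\<sigma> s0)) (at s0)"
      using sol_der[OF f(3), of s0] f(1) by (simp add: leaf_field_def s0_eq P0)
    ultimately show ?thesis using has_vector_derivative_transform_within_open by metis
  qed
  ultimately show "\<exists>J \<sigma>. open J \<and> is_interval J \<and> J \<noteq> {} \<and> inj_on \<sigma> J \<and> \<sigma> ` J = L \<and>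
    (\<forall>t\<in>(J::real set). (\<sigma> has_vector_derivative leaf_field e (\<sigma> t)) (at t))"
    using dC(2-4) by blast
qed

end

section \<open>Leaves starting on the parabolic set\<close>

lemma same_germ_sym: "same_germ P A B \<Longrightarrow> same_germ P B A"
  unfolding same_germ_def by metis

lemma same_germ_trans:
  assumes "same_germ P A B" "same_germ P B C"
  shows "same_germ P A C"
proof -
  obtain V V' where V: "open V" "P \<in> V" "A \<inter> V = B \<inter> V" "open V'" "P \<in> V'" "B \<inter> V' = C \<inter> V'"
    using assms unfolding same_germ_def by blast
  then have "A \<inter> (V \<inter> V') = C \<inter> (V \<inter> V')" by blast
  then show ?thesis using V unfolding same_germ_def by (intro exI[of _ "V \<inter> V'"]) auto
qed

lemma same_germI:
  assumes "open V" "P \<in> V" "\<And>q. q \<in> V \<Longrightarrow> q \<in> A \<longleftrightarrow> q \<in> B"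
  shows "same_germ P A B"
  unfolding same_germ_def using assms by (intro exI[of _ V]) auto

context cusp_box begin

text \<open>One of the two halves, according to the sign \<open>e\<close>, of the curve through \<open>P\<close>.\<close>

definition half :: "real^3 \<Rightarrow> real \<Rightarrow> real \<Rightarrow> (real^3) set" where
  "half P e \<eta> = (\<lambda>s. sol 0 P (e * s)) ` {0..<\<eta>}"

lemma U_stays: "P \<in> U \<Longrightarrow> stays 0 P"
  using staysI[OF zero_I] U_sub by blast

lemma sol_0 [simp]: "sol 0 P 0 = P"
  by (rule sol_init[OF zero_I])

lemma K_sol:
  assumes "P \<in> U" "K P = 0" "\<bar>s\<bar> \<le> S"
  shows "K (sol 0 P s) = - (s^2)"
  using first_integral[OF U_stays[OF assms(1)], of s] assms by (simp add: eq_neg_iff_add_eq_0 abs_le_iff minus_le_iff)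

lemma abs_sign_mult: "\<bar>e :: real\<bar> = 1 \<Longrightarrow> \<bar>e * s\<bar> = \<bar>s\<bar>" "\<bar>e :: real\<bar> = 1 \<Longrightarrow> (e * s)^2 = s^2"
  "\<bar>e :: real\<bar> = 1 \<Longrightarrow> e * (e * s) = s" "\<bar>e :: real\<bar> = 1 \<Longrightarrow> e * e = 1"
  by (auto simp: abs_mult power_mult_distrib abs_if split: if_splits)

text \<open>Since \<open>\<K> = - s\<^sup>2\<close> on the curve, the part with small \<open>\<bar>s\<bar>\<close> is cut out by an open condition on \<open>\<K>\<close>.\<close>

lemma half_germ:
  assumes P: "P \<in> U" "K P = 0" and e: "\<bar>e\<bar> = 1" and \<eta>: "0 < \<eta>" "\<eta> \<le> S" "0 < \<eta>'" "\<eta>' \<le> S"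
  shows "same_germ P (half P e \<eta>) (half P e \<eta>')"
proof (rule same_germI)
  let ?m = "min \<eta> \<eta>'"
  show "open {q \<in> U. - (?m^2) < K q}" by (rule open_level)
  show "P \<in> {q \<in> U. - (?m^2) < K q}" using P \<eta> by simp
  fix q assume q: "q \<in> {q \<in> U. - (?m^2) < K q}"
  have "s < ?m" if "q = sol 0 P (e * s)" "0 \<le> s" "s \<le> S" for s
  proof -
    have "s^2 < ?m^2" using q K_sol[OF P, of "e * s"] that abs_sign_mult(1-3)[OF e, of s] by auto
    then show ?thesis using \<eta> power2_less_imp_less[of s ?m] by simp
  qed
  then show "q \<in> half P e \<eta> \<longleftrightarrow> q \<in> half P e \<eta>'"
    unfolding half_def using \<eta> by fastforce
qed

lemma lift_vel_cont: "continuous_on (I \<times> cball 0 r) (\<lambda>z. lift_vel \<xi> (fst z) (snd z))"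
proof -
  have "\<Lambda>-lipschitz_on (I \<times> cball 0 r) (\<lambda>z. lift_vel \<xi> (fst z) (snd z))"
    using vel_lip LBC by (intro lipschitz_onI) (auto simp: I_iff dist_norm)
  then show ?thesis by (rule lipschitz_on_continuous_on)
qed

text \<open>The velocity with respect to \<open>s\<close> vanishes at \<open>P\<close>. The parameter \<open>t = s\<^sup>2\<close> has velocity \<open>lift_vel / 2\<close>, which
  is continuous and nonzero up to the end point.\<close>

lemma arc_half:
  assumes P: "P \<in> U" "K P = 0" and e: "\<bar>e\<bar> = 1" and \<eta>: "0 < \<eta>" "\<eta> < S"
  shows "asym_arc_from \<xi> W P ((\<lambda>s. sol 0 P (e * s)) ` {0..\<eta>})"
proof -
  let ?y = "sol 0 P"
  note st = U_stays[OF P(1)]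
  define \<sigma> where "\<sigma> t = ?y (e * sqrt t)" for t
  define w where "w t = (1/2) *\<^sub>R lift_vel \<xi> (e * sqrt t) (\<sigma> t)" for t
  have sq: "0 \<le> sqrt t" "sqrt t \<le> \<eta>" "\<bar>e * sqrt t\<bar> \<le> S" "e * sqrt t \<in> I" if "t \<in> {0..\<eta>^2}" for t
  proof -
    show "0 \<le> sqrt t" using that by simp
    show "sqrt t \<le> \<eta>" using that \<eta> by (simp add: real_le_lsqrt)
    then show "\<bar>e * sqrt t\<bar> \<le> S" using \<eta> that abs_sign_mult(1)[OF e, of "sqrt t"] by simp
    then show "e * sqrt t \<in> I" by auto
  qed
  have in_ball: "\<sigma> t \<in> cball 0 r" if "t \<in> {0..\<eta>^2}" for t
    unfolding \<sigma>_def using staysD(2)[OF st] sq(4)[OF that] by blast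
  have K\<sigma>: "K (\<sigma> t) = - t" if "t \<in> {0..\<eta>^2}" for t
    unfolding \<sigma>_def using K_sol[OF P sq(3)[OF that]] abs_sign_mult[OF e] that by simp
  have ce: "continuous_on {0..\<eta>^2} (\<lambda>t. e * sqrt t)" by (intro continuous_intros)
  have c\<sigma>: "continuous_on {0..\<eta>^2} \<sigma>"
    unfolding \<sigma>_def[abs_def] by (rule continuous_on_compose2[OF sol_cont[OF zero_I] ce]) (use sq(4) in auto)
  have "continuous_on {0..\<eta>^2} (\<lambda>t. lift_vel \<xi> (e * sqrt t) (\<sigma> t))"
    using continuous_on_compose2[OF lift_vel_cont continuous_on_Pair[OF ce c\<sigma>]] sq(4) in_ball
    by (auto simp: image_subset_iff)
  then have cw: "continuous_on {0..\<eta>^2} w" unfolding w_def[abs_def] by (intro continuous_intros)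
  have d: "(\<sigma> has_vector_derivative w t) (at t)" if t: "t \<in> {0<..<\<eta>^2}" for t
  proof -
    have t': "t \<in> {0..\<eta>^2}" "0 < t" using t by auto
    have "sqrt t < sqrt (\<eta>^2)" using t by (intro real_sqrt_less_mono) simp
    then have "sqrt t < \<eta>" using \<eta> by simp
    then have lt: "\<bar>e * sqrt t\<bar> < S" using \<eta> t' abs_sign_mult(1)[OF e, of "sqrt t"] by simp
    have "((\<lambda>t. e * sqrt t) has_vector_derivative e / (2 * sqrt t)) (at t)"
      unfolding has_real_derivative_iff_has_vector_derivative[symmetric]
      using t' by (auto intro!: derivative_eq_intros simp: divide_simps)
    from vector_diff_chain_at[OF this sol_der[OF st lt]]
    have "(\<sigma> has_vector_derivative (e / (2 * sqrt t)) *\<^sub>R field (e * sqrt t) (\<sigma> t)) (at t)"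
      by (simp add: o_def \<sigma>_def[abs_def])
    also have "(e / (2 * sqrt t)) *\<^sub>R field (e * sqrt t) (\<sigma> t) = w t"
      using t' abs_sign_mult(4)[OF e] by (simp add: field_def w_def)
    finally show ?thesis .
  qed
  \<comment> \<open>at the end point the square root is not differentiable, so the derivative comes from the integral of \<open>w\<close>\<close>
  have d': "(\<sigma> has_vector_derivative w t) (at t within {0..\<eta>^2})" if t: "t \<in> {0..\<eta>^2}" for t
  proof -
    have "((\<lambda>t. \<sigma> 0 + integral {0..t} w) has_vector_derivative w t) (at t within {0..\<eta>^2})"
      using integral_has_vector_derivative[OF cw t] by (auto intro!: derivative_eq_intros)
    moreover have "\<sigma> t = \<sigma> 0 + integral {0..t} w" if t: "t \<in> {0..\<eta>^2}" for t
    proof -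
      have "(w has_integral (\<sigma> t - \<sigma> 0)) {0..t}"
        using t c\<sigma> d by (intro fundamental_theorem_of_calculus_interior) (auto intro: continuous_on_subset)
      then show ?thesis by (simp add: integral_unique)
    qed
    ultimately show ?thesis
      using has_vector_derivative_transform[OF t, of \<sigma> "\<lambda>t. \<sigma> 0 + integral {0..t} w"] by blast
  qed
  have img: "(\<lambda>s. ?y (e * s)) ` {0..\<eta>} = \<sigma> ` {0..\<eta>^2}"
  proof (intro equalityI subsetI)
    fix q assume "q \<in> (\<lambda>s. ?y (e * s)) ` {0..\<eta>}"
    then obtain s where s: "0 \<le> s" "s \<le> \<eta>" "q = ?y (e * s)" by auto
    then show "q \<in> \<sigma> ` {0..\<eta>^2}" by (intro image_eqI[of _ _ "s^2"]) (auto simp: \<sigma>_def power_mono)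
  next
    fix q assume "q \<in> \<sigma> ` {0..\<eta>^2}"
    then obtain t where t: "t \<in> {0..\<eta>^2}" "q = \<sigma> t" by auto
    then show "q \<in> (\<lambda>s. ?y (e * s)) ` {0..\<eta>}" using sq by (intro image_eqI[of _ _ "sqrt t"]) (auto simp: \<sigma>_def)
  qed
  show ?thesis unfolding asym_arc_from_def
  proof (intro exI conjI ballI)
    show "0 < \<eta>^2" using \<eta> by simp
    show "\<sigma> 0 = P" by (simp add: \<sigma>_def)
    show "(\<lambda>s. ?y (e * s)) ` {0..\<eta>} = \<sigma> ` {0..\<eta>^2}" by (rule img)
    show "inj_on \<sigma> {0..\<eta>^2}" using K\<sigma> by (metis inj_onI neg_equal_iff_equal)
    show "continuous_on {0..\<eta>^2} w" by (rule cw)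
    fix t assume t: "t \<in> {0..\<eta>^2}"
    show "(\<sigma> has_vector_derivative w t) (at t within {0..\<eta>^2})" by (rule d'[OF t])
    show "\<sigma> t \<in> hyperbolic_set \<xi> W \<union> parabolic_set \<xi> W"
      using mem_hyperbolic[OF in_ball[OF t]] mem_parabolic[OF in_ball[OF t]] K\<sigma>[OF t] t by auto
    show "asym_dir \<xi> (\<sigma> t) (w t)"
      unfolding w_def
      by (rule asym_dir_lift_vel) (use in_ball[OF t] sq(3)[OF t] K\<sigma>[OF t] t abs_sign_mult(2)[OF e] in auto)
  qed
qed

text \<open>The chart extends continuously to the parabolic set and its first component is constant on the leaf, so at
  the end of an arc in the leaf it is the starting point \<open>P\<close>. The leaf therefore consists of points of the
  solution through \<open>P\<close>; by the intermediate value theorem all small times occur.\<close>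

lemma leaf_germ:
  assumes P: "P \<in> U" "K P = 0" and e: "\<bar>e\<bar> = 1" and L: "L \<in> leaves e" "leaf_starts_at \<xi> W L P"
  shows "\<exists>\<eta>>0. \<forall>s. 0 < s \<and> s \<le> \<eta> \<longrightarrow> sol 0 P (e * s) \<in> L"
    and "same_germ P (insert P L) (half P e S)"
proof -
  obtain d C where dC: "L = M \<inter> chart e -` ({d} \<times> C)"
    by (rule leafE[OF e L(1)]) (rule that; assumption)
  then have LM: "L \<subseteq> M" by blast
  obtain \<Gamma> where \<Gamma>: "asym_arc_from \<xi> W P \<Gamma>" "\<Gamma> - {P} \<subseteq> L" using L(2) unfolding leaf_starts_at_def by blast
  then obtain \<delta> :: real and \<sigma> \<sigma>' where \<sigma>: "\<delta> > 0" "\<sigma> 0 = P" "\<Gamma> = \<sigma> ` {0..\<delta>}" "inj_on \<sigma> {0..\<delta>}"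
    "\<forall>t\<in>{0..\<delta>}. (\<sigma> has_vector_derivative \<sigma>' t) (at t within {0..\<delta>})"
    unfolding asym_arc_from_def by blast
  have c\<sigma>: "continuous_on {0..\<delta>} \<sigma>"
    using \<sigma>(5) by (meson has_vector_derivative_continuous continuous_on_eq_continuous_within)
  have inL: "\<sigma> t \<in> L" if "0 < t" "t \<le> \<delta>" for t
  proof -
    have "\<sigma> t \<noteq> \<sigma> 0" using inj_onD[OF \<sigma>(4), of t 0] that by auto
    then show ?thesis using \<Gamma>(2) \<sigma>(2,3) that by auto
  qed
  have PN: "P \<in> N" using P by simp
  have inN: "\<sigma> t \<in> N" if "t \<in> {0..\<delta>}" for t
  proof (cases "t = 0")
    case True
    then show ?thesis using PN \<sigma>(2) by simp
  next
    case False
    then have "\<sigma> t \<in> M" using inL[of t] LM that by auto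
    then show ?thesis by (rule MN)
  qed
  have cch: "continuous_on {0..\<delta>} (\<lambda>t. chart e (\<sigma> t))"
    by (rule continuous_on_compose2[OF chart_cont[OF e] c\<sigma>]) (use inN in blast)
  have chP: "chart e P = (proj P, 0)"
    using chart_sol(3)[OF e U_stays[OF P(1)] P(2), of 0] S P(1) by simp
  have "fst (chart e (\<sigma> 0)) = d"
  proof (rule continuous_constant_on_closure[of "{0<..<\<delta>}" "\<lambda>t. fst (chart e (\<sigma> t))"])
    show "continuous_on (closure {0<..<\<delta>}) (\<lambda>t. fst (chart e (\<sigma> t)))"
      using \<sigma>(1) cch by (auto intro!: continuous_intros)
    show "fst (chart e (\<sigma> t)) = d" if "t \<in> {0<..<\<delta>}" for t using inL[of t] that by (auto simp: dC)
  qed (use \<sigma>(1) in auto)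
  then have d: "d = proj P" using chP \<sigma>(2) by simp
  define \<eta> where "\<eta> = lev (\<sigma> \<delta>)"
  have levP: "lev (\<sigma> 0) = 0" using P(2) \<sigma>(2) by (simp add: lev_def)
  have clev: "continuous_on {0..\<delta>} (\<lambda>t. lev (\<sigma> t))"
    by (rule continuous_on_compose2[OF lev_cont c\<sigma>]) (use inN in auto)
  have "\<sigma> \<delta> \<in> M" using inL[of \<delta>] \<sigma>(1) LM by auto
  then have \<eta>: "0 < \<eta>" unfolding \<eta>_def M_eq lev_def by simp
  note Pc = U_sub(2)[OF P(1)]
  have key: "sol 0 P (e * s) \<in> L" if s: "0 < s" "s \<le> \<eta>" for s
  proof -
    obtain t where t: "0 \<le> t" "t \<le> \<delta>" "lev (\<sigma> t) = s"
      using IVT'[of "\<lambda>t. lev (\<sigma> t)" 0 s \<delta>] s levP clev \<sigma>(1) by (auto simp: \<eta>_def)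
    have "t \<noteq> 0" using t(3) s levP by auto
    then have tL: "\<sigma> t \<in> L" using inL[of t] t by simp
    then have "chart e (\<sigma> t) = (proj P, e * s)" using t(3) d by (auto simp: dC chart_def)
    from chart_eqD(3)[OF e inN Pc P(2) this] show ?thesis using t tL by simp
  qed
  then show "\<exists>\<eta>>0. \<forall>s. 0 < s \<and> s \<le> \<eta> \<longrightarrow> sol 0 P (e * s) \<in> L" using \<eta> by blast
  show "same_germ P (insert P L) (half P e S)"
  proof (rule same_germI)
    show "open {q \<in> U. - (\<eta>^2) < K q}" by (rule open_level)
    show "P \<in> {q \<in> U. - (\<eta>^2) < K q}" using P \<eta> by simp
    fix q assume q: "q \<in> {q \<in> U. - (\<eta>^2) < K q}"
    show "q \<in> insert P L \<longleftrightarrow> q \<in> half P e S"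
    proof
      assume "q \<in> insert P L"
      then show "q \<in> half P e S"
      proof
        assume "q = P"
        then show ?thesis unfolding half_def using S by (intro image_eqI[of _ _ 0]) auto
      next
        assume qL: "q \<in> L"
        then have qN: "q \<in> N" using LM MN by blast
        have "chart e q = (proj P, e * lev q)" using qL d by (auto simp: dC chart_def)
        from chart_eqD(3)[OF e qN Pc P(2) this] show ?thesis
          unfolding half_def using lev[OF qN] by (intro image_eqI[of _ _ "lev q"]) auto
      qed
    next
      assume "q \<in> half P e S"
      then obtain s where s: "0 \<le> s" "s < S" "q = sol 0 P (e * s)" unfolding half_def by auto
      have "s^2 < \<eta>^2" using q s K_sol[OF P, of "e * s"] abs_sign_mult(1-3)[OF e, of s] by auto
      then have "s < \<eta>" using \<eta> power2_less_imp_less[of s \<eta>] by simp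
      then show "q \<in> insert P L" using key[of s] s by (cases "s = 0") auto
    qed
  qed
qed

text \<open>Short pieces of the half curve lie in one interval of the slice over \<open>proj P\<close>, hence in one leaf. Two leaves
  starting at \<open>P\<close> share such a piece.\<close>

lemma unique_leaf:
  assumes P: "P \<in> U" "K P = 0" and e: "\<bar>e\<bar> = 1"
  shows "\<exists>!L. L \<in> leaves e \<and> leaf_starts_at \<xi> W L P"
proof (rule ex_ex1I)
  have "continuous_on {-S<..<S} (sol 0 P)" using sol_cont[OF zero_I] by (rule continuous_on_subset) auto
  from continuous_open_preimage[OF this open_greaterThanLessThan open_ball]
  have "open ({-S<..<S} \<inter> sol 0 P -` U)" .
  moreover have "0 \<in> {-S<..<S} \<inter> sol 0 P -` U" using P S by simp
  ultimately obtain \<epsilon> where \<epsilon>: "\<epsilon> > 0" "ball 0 \<epsilon> \<subseteq> {-S<..<S} \<inter> sol 0 P -` U"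
    using open_contains_ball by blast
  define \<eta> where "\<eta> = \<epsilon> / 2"
  have es: "sol 0 P (e * s) \<in> U" "\<bar>e * s\<bar> < S" if "0 \<le> s" "s \<le> \<eta>" for s
  proof -
    have "e * s \<in> ball 0 \<epsilon>" using that \<epsilon>(1) abs_sign_mult(1)[OF e, of s] by (auto simp: \<eta>_def dist_real_def)
    then have "e * s \<in> {-S<..<S} \<inter> sol 0 P -` U" using \<epsilon>(2) by blast
    then show "sol 0 P (e * s) \<in> U" "\<bar>e * s\<bar> < S" by auto
  qed
  have \<eta>: "0 < \<eta>" using \<epsilon> by (simp add: \<eta>_def)
  have "\<eta> < S" using es(2)[of \<eta>] \<eta> abs_sign_mult(1)[OF e, of \<eta>] by simp
  have inM: "sol 0 P (e * s) \<in> M" "chart e (sol 0 P (e * s)) = (proj P, e * s)" if s: "0 < s" "s \<le> \<eta>" for s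
  proof -
    have s': "\<bar>e * s\<bar> \<le> S" "0 \<le> e * (e * s)" "sol 0 P (e * s) \<in> U"
      unfolding abs_sign_mult(3)[OF e] using es[of s] s by auto
    note c = chart_sol[OF e U_stays[OF P(1)] P(2) s']
    show "chart e (sol 0 P (e * s)) = (proj P, e * s)" by (rule c(3))
    have "0 < (e * s)^2" using abs_sign_mult(2)[OF e, of s] s by simp
    then show "sol 0 P (e * s) \<in> M" unfolding M_eq using c(1) s'(3) by simp
  qed
  define sl where "sl = {s. (proj P, s) \<in> chart e ` M}"
  define J where "J = (\<lambda>s. e * s) ` {0<..\<eta>}"
  have J: "J \<subseteq> sl"
  proof
    fix x assume "x \<in> J"
    then obtain s where s: "0 < s" "s \<le> \<eta>" "x = e * s" by (auto simp: J_def)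
    have "chart e (sol 0 P (e * s)) \<in> chart e ` M" using inM(1)[OF s(1,2)] by (rule imageI)
    then show "x \<in> sl" using inM(2)[OF s(1,2)] s(3) by (simp add: sl_def)
  qed
  have cJ: "connected J" unfolding J_def by (intro connected_continuous_image continuous_intros) auto
  have eJ: "e * \<eta> \<in> J" unfolding J_def using \<eta> by auto
  define C where "C = connected_component_set sl (e * \<eta>)"
  have JC: "J \<subseteq> C" unfolding C_def by (rule connected_component_maximal[OF eJ cJ J])
  have "C \<in> components sl" unfolding C_def using eJ J by (intro componentsI) auto
  define L where "L = M \<inter> chart e -` ({proj P} \<times> C)"
  have "L \<in> leaves e"
    unfolding leaves_def chart_leaves_def L_def using \<open>C \<in> components sl\<close> unfolding sl_def by auto
  moreover have "leaf_starts_at \<xi> W L P"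
    unfolding leaf_starts_at_def
  proof (intro exI conjI)
    show "asym_arc_from \<xi> W P ((\<lambda>s. sol 0 P (e * s)) ` {0..\<eta>})" by (rule arc_half[OF P e \<eta> \<open>\<eta> < S\<close>])
    show "(\<lambda>s. sol 0 P (e * s)) ` {0..\<eta>} - {P} \<subseteq> L"
    proof
      fix q assume "q \<in> (\<lambda>s. sol 0 P (e * s)) ` {0..\<eta>} - {P}"
      then obtain s where s: "0 \<le> s" "s \<le> \<eta>" "q = sol 0 P (e * s)" "q \<noteq> P" by auto
      then have "s \<noteq> 0" by auto
      have "e * s \<in> J" unfolding J_def by (rule imageI) (use s \<open>s \<noteq> 0\<close> in auto)
      then have "e * s \<in> C" using JC by blast
      then show "q \<in> L" using inM[of s] s \<open>s \<noteq> 0\<close> by (auto simp: L_def)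
    qed
  qed
  ultimately show "\<exists>L. L \<in> leaves e \<and> leaf_starts_at \<xi> W L P" by blast
next
  fix L L' assume L: "L \<in> leaves e \<and> leaf_starts_at \<xi> W L P" "L' \<in> leaves e \<and> leaf_starts_at \<xi> W L' P"
  obtain \<eta> where \<eta>: "\<eta> > 0" "\<And>s. 0 < s \<Longrightarrow> s \<le> \<eta> \<Longrightarrow> sol 0 P (e * s) \<in> L"
    using leaf_germ(1)[OF P e] L(1) by blast
  obtain \<eta>' where \<eta>': "\<eta>' > 0" "\<And>s. 0 < s \<Longrightarrow> s \<le> \<eta>' \<Longrightarrow> sol 0 P (e * s) \<in> L'"
    using leaf_germ(1)[OF P e] L(2) by blast
  have "sol 0 P (e * min \<eta> \<eta>') \<in> L \<inter> L'" using \<eta> \<eta>' by auto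
  moreover have "partition_on M (leaves e)" using foliation_leaves[OF e] by (simp add: foliation_def)
  then have "disjoint (leaves e)" by (rule partition_onD2)
  from disjointD[OF this, of L L'] have "L = L' \<or> L \<inter> L' = {}" using L by blast
  ultimately show "L = L'" by blast
qed

end

section \<open>Arcs starting on the parabolic set\<close>

context cusp_box begin

text \<open>Along the arc \<open>\<K>\<close> is differentiable with nonzero derivative at \<open>P\<close>, because the velocity is a multiple
  of the double asymptotic direction; being nonpositive, \<open>\<K>\<close> must decrease. On the rest of the arc the velocity picks one of
  the two directions, always the same by connectedness. In the parameter \<open>\<plusminus> sqrt (- \<K>)\<close> the arc solves the
  lifted equation, and the contraction estimate identifies it with the solution from \<open>P\<close>.\<close>

lemma arc_germ:
  assumes P: "P \<in> U" "K P = 0" and \<Gamma>: "asym_arc_from \<xi> W P \<Gamma>"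
  shows "\<exists>e. \<bar>e\<bar> = 1 \<and> same_germ P \<Gamma> (half P e S)"
proof -
  obtain \<delta> :: real and \<sigma> \<sigma>' where \<sigma>: "\<delta> > 0" "\<sigma> 0 = P" "\<Gamma> = \<sigma> ` {0..\<delta>}" "inj_on \<sigma> {0..\<delta>}"
    and d\<sigma>: "\<And>t. t \<in> {0..\<delta>} \<Longrightarrow> (\<sigma> has_vector_derivative \<sigma>' t) (at t within {0..\<delta>})"
    and c\<sigma>': "continuous_on {0..\<delta>} \<sigma>'"
    and HP: "\<And>t. t \<in> {0..\<delta>} \<Longrightarrow> \<sigma> t \<in> hyperbolic_set \<xi> W \<union> parabolic_set \<xi> W"
    and as: "\<And>t. t \<in> {0..\<delta>} \<Longrightarrow> asym_dir \<xi> (\<sigma> t) (\<sigma>' t)"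
    using \<Gamma> unfolding asym_arc_from_def by blast
  have c\<sigma>: "continuous_on {0..\<delta>} \<sigma>"
    using d\<sigma> by (meson has_vector_derivative_continuous continuous_on_eq_continuous_within)
  have Kle: "K (\<sigma> t) \<le> 0" if "t \<in> {0..\<delta>}" for t
    using HP[OF that] by (auto simp: hyperbolic_set_def parabolic_set_def)
  have zero_in: "0 \<in> {0..\<delta>}" using \<sigma>(1) by simp
  obtain d1 where d1: "d1 > 0" "\<And>t. t \<in> {0..\<delta>} \<Longrightarrow> t < d1 \<Longrightarrow> \<sigma> t \<in> U"
  proof -
    obtain \<epsilon> where \<epsilon>: "\<epsilon> > 0" "ball P \<epsilon> \<subseteq> U" using P(1) open_contains_ball[of U] by blast
    obtain d1 where "d1 > 0" "\<And>t. t \<in> {0..\<delta>} \<Longrightarrow> dist t 0 < d1 \<Longrightarrow> dist (\<sigma> t) (\<sigma> 0) < \<epsilon>"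
      using c\<sigma> zero_in \<epsilon>(1) unfolding continuous_on_iff by metis
    then show thesis using that[of d1] \<epsilon>(2) \<sigma>(2) by (auto simp: dist_commute subset_iff)
  qed
  define k where "k t = K (\<sigma> t)" for t
  define k' where "k' t = grad K (\<sigma> t) \<bullet> \<sigma>' t" for t
  define b where "b = min \<delta> (d1 / 2)"
  have b: "0 < b" "b \<le> \<delta>" using d1 \<sigma>(1) by (auto simp: b_def)
  have inU: "\<sigma> t \<in> U" if "t \<in> {0..b}" for t using that d1 by (intro d1(2)) (auto simp: b_def)
  have sub_b: "{0..b} \<subseteq> {0..\<delta>}" using b by auto
  have dk: "(k has_vector_derivative k' t) (at t within {0..b})" if t: "t \<in> {0..b}" for t
  proof -
    have "(\<sigma> has_derivative (\<lambda>h. h *\<^sub>R \<sigma>' t)) (at t within {0..b})"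
      using d\<sigma>[of t] t sub_b unfolding has_vector_derivative_def by (blast intro: has_derivative_subset)
    from has_derivative_compose[OF this K_der[OF U_sub(2)[OF inU[OF t]]]] show ?thesis
      by (simp add: k_def[abs_def] k'_def has_vector_derivative_def)
  qed
  have ck': "continuous_on {0..b} k'"
    unfolding k'_def
  proof (intro continuous_on_inner)
    show "continuous_on {0..b} (\<lambda>t. grad K (\<sigma> t))"
      by (rule continuous_on_compose2[OF grad_cont continuous_on_subset[OF c\<sigma> sub_b]]) (use inU U_sub in blast)
    show "continuous_on {0..b} \<sigma>'" by (rule continuous_on_subset[OF c\<sigma>' sub_b])
  qed
  have k0: "k 0 = 0" using P \<sigma>(2) by (simp add: k_def)
  have k'0: "k' 0 \<noteq> 0"
  proof -
    note Pc = U_sub(2)[OF P(1)]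
    obtain v where v: "v \<noteq> 0" "\<sigma>' 0 = v *\<^sub>R lift_dir \<xi> 0 P"
      using as[OF zero_in] asym_dir_iff_lift_dir[OF xi_diff[OF Pc] c0[OF Pc] g0[OF Pc], of 0 "\<sigma>' 0"] P(2) \<sigma>(2) by auto
    then show ?thesis using rate0[OF Pc, of 0] S \<sigma>(2) by (simp add: k'_def)
  qed
  obtain d2 where d2: "d2 > 0" "\<And>t. t \<in> {0..b} \<Longrightarrow> t < d2 \<Longrightarrow> \<bar>k' t - k' 0\<bar> < \<bar>k' 0\<bar>"
  proof -
    have "0 \<in> {0..b}" "0 < \<bar>k' 0\<bar>" using b k'0 by auto
    then obtain d2 where "d2 > 0" "\<And>t. t \<in> {0..b} \<Longrightarrow> dist t 0 < d2 \<Longrightarrow> dist (k' t) (k' 0) < \<bar>k' 0\<bar>"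
      using ck' unfolding continuous_on_iff by metis
    then show thesis using that[of d2] by (auto simp: dist_real_def)
  qed
  define c where "c = min b (d2 / 2)"
  have c: "0 < c" "c \<le> b" "c < d2" using d2 b by (auto simp: c_def)
  have sub_c: "{0..c} \<subseteq> {0..b}" using c by auto
  have dk_at: "(k has_vector_derivative k' t) (at t)" if "t \<in> {0<..<c}" for t
  proof -
    have "t \<in> {0<..<b}" using that c by auto
    then show ?thesis using dk[of t] vector_derivative_within_open_interval[of t 0 b k] by auto
  qed
  have ck: "continuous_on {0..c} k"
    unfolding k_def by (rule continuous_on_compose2[OF K_cont_U continuous_on_subset[OF c\<sigma>]])
      (use inU sub_b sub_c in auto)
  have mono: "\<exists>z. 0 \<le> x \<and> x < z \<and> z < y \<and> k y - k x = (y - x) * k' z" if "0 \<le> x" "x < y" "y \<le> c" for x y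
  proof -
    have "\<exists>l z. x < z \<and> z < y \<and> (k has_real_derivative l) (at z) \<and> k y - k x = (y - x) * l"
    proof (rule MVT)
      show "continuous_on {x..y} k" using that by (intro continuous_on_subset[OF ck]) auto
      show "k differentiable (at z)" if "x < z" "z < y" for z
        using dk_at[of z] that \<open>0 \<le> x\<close> \<open>y \<le> c\<close> by (auto intro: differentiableI_vector)
    qed fact
    then obtain l z where z: "x < z" "z < y" "(k has_real_derivative l) (at z)" "k y - k x = (y - x) * l" by blast
    have "l = k' z" using z(3) dk_at[of z] that z(1,2)
      by (auto simp: has_real_derivative_iff_has_vector_derivative intro: vector_derivative_unique_at)
    then show ?thesis using z that by blast
  qed
  have k'_sign: "k' t * k' 0 > 0" if "t \<in> {0..c}" for t
  proof -
    have "\<bar>k' t - k' 0\<bar> < \<bar>k' 0\<bar>" by (rule d2(2)) (use that c in auto)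
    then show ?thesis by (cases "k' 0 > 0") (auto intro: mult_pos_pos mult_neg_neg)
  qed
  have k'neg0: "k' 0 < 0"
  proof (rule ccontr)
    assume "\<not> k' 0 < 0"
    obtain z where z: "0 < z" "z < c" "k c - k 0 = (c - 0) * k' z" using mono[of 0 c] c by auto
    have "k' z > 0" using k'_sign[of z] z \<open>\<not> k' 0 < 0\<close> by (auto simp: zero_less_mult_iff)
    then have "k c > 0" using z k0 c by simp
    then show False using Kle[of c] c b by (simp add: k_def)
  qed
  have k'neg: "k' t < 0" if "t \<in> {0..c}" for t
    using k'_sign[OF that] k'neg0 by (auto simp: zero_less_mult_iff)
  have kdec: "k y < k x" if xy: "0 \<le> x" "x < y" "y \<le> c" for x y
  proof -
    obtain z where z: "x < z" "z < y" "k y - k x = (y - x) * k' z" using mono[OF xy] by blast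
    have "k' z < 0" using k'neg[of z] z xy by auto
    then have "(y - x) * k' z < 0" using xy by (simp add: mult_pos_neg)
    then show ?thesis using z by simp
  qed
  have kneg: "k t < 0" if "0 < t" "t \<le> c" for t using kdec[of 0 t] k0 that by simp
  define l where "l t = lev (\<sigma> t)" for t
  have inN: "\<sigma> t \<in> N" if "t \<in> {0..c}" for t using inU[of t] Kle[of t] that sub_b sub_c by auto
  have l: "0 \<le> l t" "l t < S" "(l t)^2 = - k t" if "t \<in> {0..c}" for t
    using lev[OF inN[OF that]] by (auto simp: l_def k_def)
  have lpos: "0 < l t" if "0 < t" "t \<le> c" for t using kneg[OF that] by (simp add: l_def lev_def k_def)
  have l0: "l 0 = 0" using P \<sigma>(2) by (simp add: l_def lev_def)
  have cl: "continuous_on {0..c} l" unfolding l_def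
    by (rule continuous_on_compose2[OF lev_cont continuous_on_subset[OF c\<sigma>]]) (use inN sub_b sub_c in auto)
  have dl: "(l has_vector_derivative - k' t / (2 * l t)) (at t)" if t: "t \<in> {0<..<c}" for t
  proof -
    have "(k has_real_derivative k' t) (at t)" using dk_at[OF t] by (simp add: has_real_derivative_iff_has_vector_derivative)
    moreover have "k t < 0" using kneg[of t] t by simp
    ultimately have "((\<lambda>t. sqrt (- k t)) has_real_derivative - k' t / (2 * sqrt (- k t))) (at t)"
      by (auto intro!: derivative_eq_intros simp: divide_simps)
    then show ?thesis by (simp add: l_def[abs_def] lev_def k_def has_real_derivative_iff_has_vector_derivative)
  qed
  \<comment> \<open>the velocity follows one of the two lifted fields, with a sign that is locally constant\<close>
  define V where "V e t = (- k' t / 2) *\<^sub>R lift_vel \<xi> (e * l t) (\<sigma> t)" for e t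
  have c\<sigma>c: "continuous_on {0<..<c} \<sigma>" and c\<sigma>'c: "continuous_on {0<..<c} \<sigma>'"
    and clc: "continuous_on {0<..<c} l" and ck'c: "continuous_on {0<..<c} k'"
    using c\<sigma> c\<sigma>' cl ck' c b by (auto elim!: continuous_on_subset)
  have cV: "continuous_on {0<..<c} (V e)" if e: "\<bar>e\<bar> = 1" for e
  proof -
    have "continuous_on {0<..<c} (\<lambda>t. (e * l t, \<sigma> t))" by (intro continuous_intros clc c\<sigma>c)
    moreover have "(\<lambda>t. (e * l t, \<sigma> t)) ` {0<..<c} \<subseteq> I \<times> cball 0 r"
    proof (rule image_subsetI)
      fix t assume "t \<in> {0<..<c}"
      then have t: "t \<in> {0..c}" by auto
      have "\<bar>e * l t\<bar> \<le> S" using l[OF t] abs_sign_mult(1)[OF e, of "l t"] by simp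
      moreover have "\<sigma> t \<in> cball 0 r" using inN[OF t] U_sub by blast
      ultimately show "(e * l t, \<sigma> t) \<in> I \<times> cball 0 r" by (auto simp: abs_le_iff)
    qed
    ultimately have "continuous_on {0<..<c} (\<lambda>t. lift_vel \<xi> (e * l t) (\<sigma> t))"
      using continuous_on_compose2[OF lift_vel_cont] by fastforce
    then show ?thesis unfolding V_def[abs_def] by (intro continuous_intros ck'c) auto
  qed
  have alt: "\<sigma>' t = V 1 t \<or> \<sigma>' t = V (-1) t" "V 1 t \<noteq> V (-1) t" if t: "t \<in> {0<..<c}" for t
  proof -
    have t': "t \<in> {0..c}" "t \<in> {0..\<delta>}" using t c b by auto
    note p = U_sub(2)[of "\<sigma> t"]
    have pc: "\<sigma> t \<in> cball 0 r" using inN[OF t'(1)] U_sub by blast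
    have Kl: "K (\<sigma> t) = - ((l t)^2)" using l(3)[OF t'(1)] by (simp add: k_def)
    have lt: "0 < l t" "l t \<le> S" using lpos[of t] l(2)[OF t'(1)] t by auto
    have V_eq: "V e t = (k' t / (grad K (\<sigma> t) \<bullet> lift_dir \<xi> (e * l t) (\<sigma> t))) *\<^sub>R lift_dir \<xi> (e * l t) (\<sigma> t)" for e
      by (simp add: V_def lift_vel_def)
    have V_follow: "\<sigma>' t = V e t" if e: "\<bar>e\<bar> = 1" and v: "\<sigma>' t = v *\<^sub>R lift_dir \<xi> (e * l t) (\<sigma> t)" for e v
    proof -
      have "grad K (\<sigma> t) \<bullet> lift_dir \<xi> (e * l t) (\<sigma> t) \<noteq> 0"
        using rate0[OF pc, of "e * l t"] abs_sign_mult(1)[OF e, of "l t"] lt by simp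
      then show ?thesis unfolding V_eq using v by (simp add: k'_def)
    qed
    show "\<sigma>' t = V 1 t \<or> \<sigma>' t = V (-1) t"
      using as[OF t'(2)] asym_dir_iff_lift_dir[OF xi_diff[OF pc] c0[OF pc] g0[OF pc] Kl, of "\<sigma>' t"]
        V_follow[of 1] V_follow[of "-1"] by auto
    have "k' t \<noteq> 0" using k'neg[OF t'(1)] by simp
    moreover have "grad K (\<sigma> t) \<bullet> lift_dir \<xi> (1 * l t) (\<sigma> t) \<noteq> 0" using rate0[OF pc, of "l t"] lt by simp
    ultimately show "V 1 t \<noteq> V (-1) t"
      unfolding V_eq lift_dir_eq_iff[OF g0[OF pc]] using lt by simp
  qed
  obtain e where e: "\<bar>e\<bar> = 1" "\<And>t. t \<in> {0<..<c} \<Longrightarrow> \<sigma>' t = V e t"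
  proof -
    define A where "A e = {t \<in> {0<..<c}. \<sigma>' t - V e t = 0}" for e
    have cl: "closedin (top_of_set {0<..<c}) (A e)" if "\<bar>e\<bar> = 1" for e
      unfolding A_def
      by (rule continuous_closedin_preimage_constant) (intro continuous_intros c\<sigma>'c cV that)
    have "connected {0<..<c}" by simp
    then have "A 1 = {} \<or> A (-1) = {}"
    proof (rule contrapos_pp)
      assume ne: "\<not> (A 1 = {} \<or> A (-1) = {})"
      have "{0<..<c} \<subseteq> A 1 \<union> A (-1)"
      proof
        fix t assume t: "t \<in> {0<..<c}"
        then show "t \<in> A 1 \<union> A (-1)" using alt(1)[OF t] by (auto simp: A_def)
      qed
      moreover have "A 1 \<inter> A (-1) = {}"
      proof -
        have False if "t \<in> A 1" "t \<in> A (-1)" for t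
          using that alt(2)[of t] by (auto simp: A_def)
        then show ?thesis by blast
      qed
      ultimately show "\<not> connected {0<..<c}"
        unfolding connected_closedin not_not
        by - (rule exI[of _ "A 1"], rule exI[of _ "A (-1)"], use cl[of 1] cl[of "-1"] ne in auto)
    qed
    then show thesis using that[of 1] that[of "-1"] alt(1) by (auto simp: A_def)
  qed
  let ?y = "sol 0 P"
  note st = U_stays[OF P(1)]
  have el: "e * l t \<in> I" "\<bar>e * l t\<bar> < S" if "t \<in> {0..c}" for t
  proof -
    show "\<bar>e * l t\<bar> < S" using l[OF that] abs_sign_mult(1)[OF e(1), of "l t"] by simp
    then show "e * l t \<in> I" by auto
  qed
  define w where "w t = \<sigma> t - ?y (e * l t)" for t
  have cw: "continuous_on {0..c} w"
    unfolding w_def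
    by (intro continuous_intros continuous_on_subset[OF c\<sigma>] continuous_on_compose2[OF sol_cont[OF zero_I]] cl)
      (use sub_b sub_c el in auto)
  have dw: "(w has_vector_derivative (e * (- k' t / (2 * l t))) *\<^sub>R (field (e * l t) (\<sigma> t) - field (e * l t) (?y (e * l t)))) (at t)"
    if t: "t \<in> {0<..<c}" for t
  proof -
    have t': "t \<in> {0..c}" "t \<in> {0<..<\<delta>}" using t c b by auto
    have lt: "0 < l t" using lpos[of t] t by simp
    have "\<sigma>' t = (e * (- k' t / (2 * l t))) *\<^sub>R field (e * l t) (\<sigma> t)"
      using e(2)[OF t] lt abs_sign_mult(4)[OF e(1)] by (simp add: V_def field_def)
    then have h1: "(\<sigma> has_vector_derivative (e * (- k' t / (2 * l t))) *\<^sub>R field (e * l t) (\<sigma> t)) (at t)"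
      using d\<sigma>[of t] t'(2) vector_derivative_within_open_interval[OF t'(2), of \<sigma>] by auto
    have "((\<lambda>t. e * l t) has_vector_derivative e * (- k' t / (2 * l t))) (at t)"
      using dl[OF t] by (auto intro!: derivative_eq_intros)
    from vector_diff_chain_at[OF this sol_der[OF st el(2)[OF t'(1)]]]
    have h2: "((\<lambda>t. ?y (e * l t)) has_vector_derivative
        (e * (- k' t / (2 * l t))) *\<^sub>R field (e * l t) (?y (e * l t))) (at t)" by (simp only: o_def)
    show ?thesis
      using has_vector_derivative_diff[OF h1 h2] unfolding w_def[abs_def] scaleR_diff_right .
  qed
  \<comment> \<open>the derivative of \<open>l\<close> is unbounded near \<open>0\<close> but integrable, so \<open>\<Lambda> * norm (w m) * l\<close> serves as majorant\<close>
  have "continuous_on {0..c} (\<lambda>t. norm (w t))" using cw by (rule continuous_on_norm)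
  then obtain m where m: "m \<in> {0..c}" "\<And>t. t \<in> {0..c} \<Longrightarrow> norm (w t) \<le> norm (w m)"
    using continuous_attains_sup[of "{0..c}" "\<lambda>t. norm (w t)"] c by auto
  have w0: "w 0 = 0" using l0 \<sigma>(2) by (simp add: w_def)
  have "norm (w m) \<le> \<Lambda> * norm (w m) * S"
  proof (cases "m = 0")
    case False
    have "norm (w m - w 0) \<le> \<Lambda> * norm (w m) * l m - \<Lambda> * norm (w m) * l 0"
    proof (rule differentiable_bound_general)
      show "0 < m" using m(1) False by simp
      show "continuous_on {0..m} w" using m(1) by (intro continuous_on_subset[OF cw]) auto
      show "continuous_on {0..m} (\<lambda>t. \<Lambda> * norm (w m) * l t)"
        using m(1) by (intro continuous_intros continuous_on_subset[OF cl]) auto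
      fix t assume t: "0 < t" "t < m"
      then have tc: "t \<in> {0<..<c}" "t \<in> {0..c}" using m(1) by auto
      show "(w has_vector_derivative (e * (- k' t / (2 * l t))) *\<^sub>R (field (e * l t) (\<sigma> t) - field (e * l t) (?y (e * l t)))) (at t)"
        by (rule dw[OF tc(1)])
      show "((\<lambda>t. \<Lambda> * norm (w m) * l t) has_vector_derivative \<Lambda> * norm (w m) * (- k' t / (2 * l t))) (at t)"
        using dl[OF tc(1)] by (auto intro!: derivative_eq_intros)
      have lt: "0 < l t" using lpos[of t] tc by simp
      have p: "\<sigma> t \<in> cball 0 r" "?y (e * l t) \<in> cball 0 r"
        using inN[OF tc(2)] U_sub staysD(2)[OF st el(1)[OF tc(2)]] by auto
      have q: "0 \<le> - k' t / (2 * l t)" using k'neg[OF tc(2)] lt by (intro divide_nonneg_pos) auto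
      have "norm ((e * (- k' t / (2 * l t))) *\<^sub>R (field (e * l t) (\<sigma> t) - field (e * l t) (?y (e * l t))))
        = (- k' t / (2 * l t)) * norm (field (e * l t) (cl (\<sigma> t)) - field (e * l t) (cl (?y (e * l t))))"
        unfolding norm_scaleR abs_sign_mult(1)[OF e(1)] abs_of_nonneg[OF q] cl_id[OF p(1)] cl_id[OF p(2)] ..
      also have "\<dots> \<le> (- k' t / (2 * l t)) * (\<Lambda> * norm (w m))"
        using order_trans[OF field_cl_lip[OF el(1)[OF tc(2)], of "\<sigma> t" "?y (e * l t)"]]
          m(2)[OF tc(2)] LBC(1) q by (intro mult_left_mono) (auto simp: w_def mult_left_mono)
      finally show "norm ((e * (- k' t / (2 * l t))) *\<^sub>R (field (e * l t) (\<sigma> t) - field (e * l t) (?y (e * l t))))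
        \<le> \<Lambda> * norm (w m) * (- k' t / (2 * l t))" by (simp only: mult.commute)
    qed
    then have "norm (w m) \<le> \<Lambda> * norm (w m) * l m" using w0 l0 by simp
    also have "\<dots> \<le> \<Lambda> * norm (w m) * S" using l(2)[OF m(1)] LBC by (intro mult_left_mono) auto
    finally show ?thesis .
  qed (use w0 in simp)
  also have "\<dots> = (\<Lambda> * S) * norm (w m)" by simp
  also have "\<dots> \<le> (1/4) * norm (w m)" using S by (intro mult_right_mono) auto
  finally have "norm (w m) = 0" by simp
  then have \<sigma>_eq: "\<sigma> t = ?y (e * l t)" if "t \<in> {0..c}" for t using m(2)[OF that] by (simp add: w_def)
  have "same_germ P \<Gamma> (half P e S)"
  proof (rule same_germI)
    let ?V = "{q \<in> U. k c < K q} \<inter> - (\<sigma> ` {c..\<delta>})"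
    have "compact (\<sigma> ` {c..\<delta>})"
      using c by (intro compact_continuous_image continuous_on_subset[OF c\<sigma>]) auto
    then have "open (- (\<sigma> ` {c..\<delta>}))" by (simp add: compact_imp_closed open_Compl)
    then show "open ?V" by (intro open_Int open_level)
    have "P \<notin> \<sigma> ` {c..\<delta>}"
    proof
      assume "P \<in> \<sigma> ` {c..\<delta>}"
      then obtain t where t: "t \<in> {c..\<delta>}" "\<sigma> t = \<sigma> 0" using \<sigma>(2) by auto
      then show False using inj_onD[OF \<sigma>(4) t(2)] zero_in c by auto
    qed
    then show "P \<in> ?V" using P kneg[of c] c by simp
    fix q assume q: "q \<in> ?V"
    show "q \<in> \<Gamma> \<longleftrightarrow> q \<in> half P e S"
    proof
      assume "q \<in> \<Gamma>"
      then obtain t where t: "t \<in> {0..\<delta>}" "q = \<sigma> t" using \<sigma>(3) by auto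
      then have tc: "t \<in> {0..c}" using q by force
      then show "q \<in> half P e S"
        unfolding half_def using \<sigma>_eq[OF tc] l[OF tc] t(2) by (intro image_eqI[of _ _ "l t"]) auto
    next
      assume "q \<in> half P e S"
      then obtain s where s: "0 \<le> s" "s < S" "q = ?y (e * s)" unfolding half_def by auto
      have "s^2 < (l c)^2"
        using q s K_sol[OF P, of "e * s"] abs_sign_mult(1-3)[OF e(1), of s] l(3)[of c] c by auto
      then have "s < l c" using power2_less_imp_less[of s "l c"] l(1)[of c] c by simp
      then obtain t where t: "0 \<le> t" "t \<le> c" "l t = s"
        using IVT'[of l 0 s c] l0 s cl c by auto
      then have "q = \<sigma> t" using \<sigma>_eq[of t] s(3) by simp
      then show "q \<in> \<Gamma>" using \<sigma>(3) t c b by auto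
    qed
  qed
  then show ?thesis using e(1) by blast
qed

end

section \<open>Expansions at a parabolic point\<close>

lemma bigo_power_at_0:
  fixes f :: "real \<Rightarrow> real"
  assumes "0 < \<epsilon>" "\<And>t. \<bar>t\<bar> < \<epsilon> \<Longrightarrow> \<bar>f t\<bar> \<le> C * \<bar>t\<bar>^n"
  shows "f \<in> O[at 0](\<lambda>t. t^n)"
proof (rule bigoI)
  show "\<forall>\<^sub>F t in at 0. norm (f t) \<le> C * norm (t^n)"
    unfolding eventually_at using assms by (intro exI[of _ \<epsilon>]) (auto simp: dist_real_def power_abs)
qed

text \<open>The rows of the matrix are the orthonormal frame \<open>A / |A|\<close>, \<open>\<nu> \<times> A / |A|\<close>, \<open>\<nu>\<close>.\<close>

lemma orthonormal_frame_transformation: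
  fixes \<nu> A :: "real^3"
  assumes "norm \<nu> = 1" "\<nu> \<bullet> A = 0" "A \<noteq> 0"
  obtains Q :: "real^3 \<Rightarrow> real^3" where "orthogonal_transformation Q" "Q \<nu> = axis 3 1" "Q A = norm A *\<^sub>R axis 1 1"
    "\<And>v. norm A * Q v $ 1 = v \<bullet> A" "\<And>v. norm A * Q v $ 2 = v \<bullet> cross3 \<nu> A" "\<And>v. Q v $ 3 = v \<bullet> \<nu>"
proof -
  define a where "a = (1 / norm A) *\<^sub>R A"
  have na: "norm a = 1" "a \<bullet> \<nu> = 0" using assms by (simp_all add: a_def inner_commute)
  have "(norm (cross3 \<nu> a))^2 = 1^2"
    using norm_cross_dot[of \<nu> a] na assms(1) by (simp add: inner_commute)
  then have nb: "norm (cross3 \<nu> a) = 1" by (rule power2_eq_imp_eq) auto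
  define T where "T = (vector [a, cross3 \<nu> a, \<nu>] :: real^3^3)"
  have rows: "row 1 T = a" "row 2 T = cross3 \<nu> a" "row 3 T = \<nu>"
    by (simp_all add: T_def row_def vec_eq_iff)
  have "orthogonal_matrix T"
    unfolding orthogonal_matrix_orthonormal_rows forall_3 rows
    using na nb assms(1) by (simp add: orthogonal_def dot_cross_self inner_commute)
  then have "orthogonal_transformation ((*v) T)"
    unfolding orthogonal_transformation_matrix by (simp add: matrix_vector_mul_linear)
  moreover have nth: "(T *v v) $ i = v \<bullet> row i T" for v i
    by (simp add: matrix_vector_mult_def row_def inner_vec_def mult.commute)
  have "T *v \<nu> = axis 3 1"
    using na assms by (simp add: vec_eq_iff forall_3 nth rows axis_def dot_cross_self inner_commute norm_eq_1)
  moreover have "T *v A = norm A *\<^sub>R axis 1 1"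
  proof -
    have A: "A = norm A *\<^sub>R a" using assms(3) by (simp add: a_def)
    have "T *v a = axis 1 1"
      using na assms by (simp add: vec_eq_iff forall_3 nth rows axis_def dot_cross_self inner_commute norm_eq_1)
    then show ?thesis by (subst A) (simp add: matrix_vector_mult_scaleR)
  qed
  moreover have "norm A * (T *v v) $ 1 = v \<bullet> A" "norm A * (T *v v) $ 2 = v \<bullet> cross3 \<nu> A" "(T *v v) $ 3 = v \<bullet> \<nu>" for v
    using assms(3) by (simp_all add: nth rows a_def cross_mult_right)
  ultimately show thesis using that by blast
qed

context cusp_box begin

text \<open>The vectors \<open>A\<close>, \<open>E\<close> with \<open>\<gamma>(s) = P + s\<^sup>2 A + s\<^sup>3 E + O(s\<^sup>4)\<close>, obtained by expanding
  \<open>- 2 (dir0 + s dir1) / (d\<^sub>0 + s d\<^sub>1)\<close> to first order in \<open>s\<close>, where \<open>d\<^sub>0\<close> and \<open>d\<^sub>1\<close> are the derivatives of \<open>\<K>\<close> along \<open>dir0\<close> and \<open>dir1\<close>.\<close>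

definition cuspA :: "real^3 \<Rightarrow> real^3" where
  "cuspA P = (- 1 / (grad K P \<bullet> dir0 \<xi> P)) *\<^sub>R dir0 \<xi> P"

definition cuspE :: "real^3 \<Rightarrow> real^3" where
  "cuspE P = (- 2 / (3 * (grad K P \<bullet> dir0 \<xi> P))) *\<^sub>R dir1 \<xi> P
    + (2 * (grad K P \<bullet> dir1 \<xi> P) / (3 * (grad K P \<bullet> dir0 \<xi> P)^2)) *\<^sub>R dir0 \<xi> P"

lemma rate_dir0: "P \<in> U \<Longrightarrow> grad K P \<bullet> dir0 \<xi> P \<noteq> 0"
  using rate0[OF U_sub(2), of P 0] S by (simp add: lift_dir_def)

lemma sol_der_U: "P \<in> U \<Longrightarrow> \<bar>s\<bar> < S \<Longrightarrow> (sol 0 P has_vector_derivative field s (sol 0 P s)) (at s)"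
  by (rule sol_der[OF U_stays])

lemma sol_quadratic_bound:
  assumes P: "P \<in> U" and s: "\<bar>s\<bar> < S"
  shows "norm (sol 0 P s - P) \<le> \<beta> * s^2"
proof -
  have "norm (sol 0 P s - P) \<le> \<beta> * \<bar>s\<bar>^Suc 1"
  proof (rule power_bound_from_derivative[where f = "\<lambda>s. sol 0 P s - P" and f' = "\<lambda>s. field s (sol 0 P s)" and \<epsilon> = S])
    fix t assume t: "\<bar>t\<bar> < S"
    show "((\<lambda>s. sol 0 P s - P) has_vector_derivative field t (sol 0 P t)) (at t)"
      using sol_der_U[OF P t] by (auto intro!: derivative_eq_intros)
    have "t \<in> I" using t by auto
    then show "norm (field t (sol 0 P t)) \<le> \<beta> * \<bar>t\<bar>^1"
      using field_bd[OF staysD(2)[OF U_stays[OF P]]] by simp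
  qed (use s in auto)
  then show ?thesis by (simp add: numeral_2_eq_2[symmetric])
qed

text \<open>The distance of \<open>\<gamma>(s)\<close> from \<open>P\<close> is \<open>O(s\<^sup>2)\<close>, so freezing the point at \<open>P\<close> in the lifted velocity costs only
  \<open>O(s\<^sup>2)\<close>. With the point frozen the velocity is a rational function of \<open>s\<close>.\<close>

lemma cusp_velocity_expansion:
  assumes P: "P \<in> U"
  obtains C where "0 \<le> C"
    "\<And>s. \<bar>s\<bar> < S \<Longrightarrow> norm (field s (sol 0 P s) - (2 * s) *\<^sub>R cuspA P - (3 * s^2) *\<^sub>R cuspE P) \<le> C * \<bar>s\<bar>^3"
proof -
  define d0 d1 where "d0 = grad K P \<bullet> dir0 \<xi> P" and "d1 = grad K P \<bullet> dir1 \<xi> P"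
  define \<tau> where "\<tau> = 2 * d1 / d0^2"
  define c where "c = (d1^2 / d0^2) * \<beta>"
  define C where "C = \<Lambda> * \<beta> + c * norm (dir0 \<xi> P) + (c + \<bar>\<tau>\<bar>) * norm (dir1 \<xi> P)"
  have d0: "d0 \<noteq> 0" using rate_dir0[OF P] by (simp add: d0_def)
  have c: "0 \<le> c" using LBC by (simp add: c_def)
  have "norm (field s (sol 0 P s) - (2 * s) *\<^sub>R cuspA P - (3 * s^2) *\<^sub>R cuspE P) \<le> C * \<bar>s\<bar>^3" if s: "\<bar>s\<bar> < S" for s
  proof -
    note Pc = U_sub(2)[OF P]
    have sI: "s \<in> I" "\<bar>s\<bar> \<le> S" "\<bar>s\<bar> \<le> 1" using s S by auto
    define d where "d = d0 + s * d1"
    have d_eq: "grad K P \<bullet> lift_dir \<xi> s P = d" by (simp add: lift_dir_def d_def d0_def d1_def inner_add_right)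
    have d: "d \<noteq> 0" using rate0[OF Pc sI(2)] d_eq by simp
    have "\<bar>lift_dir \<xi> s P $ 1\<bar> \<le> norm (lift_dir \<xi> s P)" by (rule component_le_norm_cart)
    then have "1 \<le> norm (lift_dir \<xi> s P)" by (simp add: lift_dir_nth)
    then have "(2 / \<bar>d\<bar>) * 1 \<le> (2 / \<bar>d\<bar>) * norm (lift_dir \<xi> s P)" by (intro mult_left_mono) auto
    also have "\<dots> = norm (lift_vel \<xi> s P)" by (simp add: lift_vel_def d_eq)
    also have "\<dots> \<le> \<beta>" by (rule vel_bd[OF Pc sI(2)])
    finally have inv_d: "2 / \<bar>d\<bar> \<le> \<beta>" by simp
    \<comment> \<open>the remainder of \<open>- 2 / d\<close> after its first order Taylor polynomial \<open>- 2 / d0 + \<tau> s\<close>\<close>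
    define \<kappa>' where "\<kappa>' = - 2 / d + 2 / d0 - \<tau> * s"
    have "\<kappa>' = - (2 / d) * (d1^2 / d0^2) * s^2"
      using d d0 unfolding \<kappa>'_def \<tau>_def by (simp add: field_simps power2_eq_square) (simp add: d_def algebra_simps)
    then have "\<bar>\<kappa>'\<bar> = (2 / \<bar>d\<bar>) * ((d1^2 / d0^2) * s^2)" by (simp add: abs_mult)
    also have "\<dots> \<le> \<beta> * ((d1^2 / d0^2) * s^2)" by (intro mult_right_mono inv_d) simp
    finally have \<kappa>': "\<bar>\<kappa>'\<bar> \<le> c * s^2" by (simp add: c_def mult_ac)
    have ss: "\<bar>s\<bar> * s^2 \<le> s^2" using sI(3) mult_right_mono[of "\<bar>s\<bar>" 1 "s^2"] by simp
    have "lift_vel \<xi> s P - 2 *\<^sub>R cuspA P - (3 * s) *\<^sub>R cuspE P = \<kappa>' *\<^sub>R dir0 \<xi> P + (s * (\<kappa>' + \<tau> * s)) *\<^sub>R dir1 \<xi> P"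
    proof -
      have A: "2 *\<^sub>R cuspA P = (- 2 / d0) *\<^sub>R dir0 \<xi> P" by (simp add: cuspA_def d0_def)
      have E: "(3 * s) *\<^sub>R cuspE P = (s * (- 2 / d0)) *\<^sub>R dir1 \<xi> P + (s * \<tau>) *\<^sub>R dir0 \<xi> P"
      proof -
        have "3 * s * (- 2 / (3 * d0)) = s * (- 2 / d0)" "3 * s * (2 * d1 / (3 * d0^2)) = s * \<tau>"
          by (simp_all add: \<tau>_def)
        then show ?thesis
          unfolding cuspE_def d0_def[symmetric] d1_def[symmetric] scaleR_add_right scaleR_scaleR by simp
      qed
      have v: "lift_vel \<xi> s P = (- 2 / d) *\<^sub>R dir0 \<xi> P + (s * (- 2 / d)) *\<^sub>R dir1 \<xi> P"
        unfolding lift_vel_def d_eq by (simp add: lift_dir_def scaleR_add_right mult.commute)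
      show ?thesis unfolding A E v \<kappa>'_def by (simp add: algebra_simps)
    qed
    also have "norm \<dots> \<le> \<bar>\<kappa>'\<bar> * norm (dir0 \<xi> P) + \<bar>s * (\<kappa>' + \<tau> * s)\<bar> * norm (dir1 \<xi> P)"
      by (rule norm_triangle_le) simp
    also have "\<dots> \<le> (c * s^2) * norm (dir0 \<xi> P) + ((c + \<bar>\<tau>\<bar>) * s^2) * norm (dir1 \<xi> P)"
    proof (intro add_mono mult_right_mono \<kappa>')
      have "\<bar>s * (\<kappa>' + \<tau> * s)\<bar> \<le> \<bar>s\<bar> * (c * s^2 + \<bar>\<tau>\<bar> * \<bar>s\<bar>)"
        unfolding abs_mult using \<kappa>' abs_triangle_ineq[of \<kappa>' "\<tau> * s"]
        by (intro mult_left_mono) (auto simp: abs_mult)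
      also have "\<dots> = c * (\<bar>s\<bar> * s^2) + \<bar>\<tau>\<bar> * s^2" by (simp add: algebra_simps power2_eq_square)
      also have "\<dots> \<le> c * s^2 + \<bar>\<tau>\<bar> * s^2" using ss c by (simp add: mult_left_mono)
      finally show "\<bar>s * (\<kappa>' + \<tau> * s)\<bar> \<le> (c + \<bar>\<tau>\<bar>) * s^2" by (simp add: algebra_simps)
    qed auto
    finally have 1: "norm (lift_vel \<xi> s P - 2 *\<^sub>R cuspA P - (3 * s) *\<^sub>R cuspE P)
      \<le> (c * norm (dir0 \<xi> P) + (c + \<bar>\<tau>\<bar>) * norm (dir1 \<xi> P)) * s^2" by (simp add: algebra_simps)
    have "norm (lift_vel \<xi> s (sol 0 P s) - lift_vel \<xi> s P) \<le> \<Lambda> * dist (s, sol 0 P s) (s, P)"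
      using staysD(2)[OF U_stays[OF P] sI(1)] Pc sI by (intro vel_lip) auto
    also have "\<dots> = \<Lambda> * norm (sol 0 P s - P)" by (simp add: dist_Pair_Pair dist_norm)
    also have "\<dots> \<le> \<Lambda> * (\<beta> * s^2)" using sol_quadratic_bound[OF P s] LBC by (intro mult_left_mono) auto
    finally have 2: "norm (lift_vel \<xi> s (sol 0 P s) - lift_vel \<xi> s P) \<le> \<Lambda> * \<beta> * s^2" by simp
    have "norm (lift_vel \<xi> s (sol 0 P s) - 2 *\<^sub>R cuspA P - (3 * s) *\<^sub>R cuspE P) \<le> C * s^2"
      using norm_triangle_ineq[of "lift_vel \<xi> s (sol 0 P s) - lift_vel \<xi> s P" "lift_vel \<xi> s P - 2 *\<^sub>R cuspA P - (3 * s) *\<^sub>R cuspE P"] 1 2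
      by (simp add: C_def algebra_simps)
    then have "\<bar>s\<bar> * norm (lift_vel \<xi> s (sol 0 P s) - 2 *\<^sub>R cuspA P - (3 * s) *\<^sub>R cuspE P) \<le> \<bar>s\<bar> * (C * s^2)"
      by (rule mult_left_mono) simp
    moreover have "field s (sol 0 P s) - (2 * s) *\<^sub>R cuspA P - (3 * s^2) *\<^sub>R cuspE P
      = s *\<^sub>R (lift_vel \<xi> s (sol 0 P s) - 2 *\<^sub>R cuspA P - (3 * s) *\<^sub>R cuspE P)"
      by (simp add: field_def algebra_simps power2_eq_square)
    moreover have "\<bar>s\<bar> * (C * s^2) = C * \<bar>s\<bar>^3" by (simp add: power3_eq_cube power2_eq_square)
    ultimately show ?thesis by simp
  qed
  moreover have "0 \<le> C" using LBC c by (simp add: C_def)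
  ultimately show thesis using that by blast
qed

lemma cusp_expansion:
  assumes P: "P \<in> U"
  obtains C where "0 \<le> C"
    "\<And>s. \<bar>s\<bar> < S \<Longrightarrow> norm (field s (sol 0 P s) - (2 * s) *\<^sub>R cuspA P - (3 * s^2) *\<^sub>R cuspE P) \<le> C * \<bar>s\<bar>^3"
    "\<And>s. \<bar>s\<bar> < S \<Longrightarrow> norm (sol 0 P s - P - s^2 *\<^sub>R cuspA P - s^3 *\<^sub>R cuspE P) \<le> C * s^4"
proof -
  obtain C where C: "0 \<le> C"
    "\<And>s. \<bar>s\<bar> < S \<Longrightarrow> norm (field s (sol 0 P s) - (2 * s) *\<^sub>R cuspA P - (3 * s^2) *\<^sub>R cuspE P) \<le> C * \<bar>s\<bar>^3"
    using cusp_velocity_expansion[OF P] by metis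
  have "norm (sol 0 P s - P - s^2 *\<^sub>R cuspA P - s^3 *\<^sub>R cuspE P) \<le> C * \<bar>s\<bar>^Suc 3" if "\<bar>s\<bar> < S" for s
  proof (rule power_bound_from_derivative[where f = "\<lambda>s. sol 0 P s - P - s^2 *\<^sub>R cuspA P - s^3 *\<^sub>R cuspE P" and
      f' = "\<lambda>s. field s (sol 0 P s) - (2 * s) *\<^sub>R cuspA P - (3 * s^2) *\<^sub>R cuspE P" and \<epsilon> = S])
    fix t assume t: "\<bar>t\<bar> < S"
    show "((\<lambda>s. sol 0 P s - P - s^2 *\<^sub>R cuspA P - s^3 *\<^sub>R cuspE P) has_vector_derivative
      field t (sol 0 P t) - (2 * t) *\<^sub>R cuspA P - (3 * t^2) *\<^sub>R cuspE P) (at t)"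
      using sol_der_U[OF P t] by (auto intro!: derivative_eq_intros)
  qed (use C that in auto)
  then show thesis using that[OF C] by simp
qed

lemma inner_frame:
  assumes P: "P \<in> U"
  shows "\<xi> P \<bullet> cuspA P = 0" "\<xi> P \<bullet> cuspE P = 0" "cuspA P \<noteq> 0" "cross3 (cuspA P) (cuspE P) \<noteq> 0"
    "cross3 (cuspA P) (cuspE P) = (\<xi> P \<bullet> cross3 (cuspA P) (cuspE P)) *\<^sub>R \<xi> P"
    "\<xi> P \<bullet> cross3 (cuspA P) (cuspE P) \<noteq> 0"
proof -
  note Pc = U_sub(2)[OF P]
  note d0 = rate_dir0[OF P]
  show A0: "\<xi> P \<bullet> cuspA P = 0" and E0: "\<xi> P \<bullet> cuspE P = 0"
    using xi_inner_dirs[of \<xi> P] c0[OF Pc] by (simp_all add: cuspA_def cuspE_def inner_add_right inner_diff_right)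
  have "dir0 \<xi> P $ 1 = 1" by (simp add: dir0_def)
  then have "dir0 \<xi> P \<noteq> 0" by (metis zero_index zero_neq_one)
  then show "cuspA P \<noteq> 0" using d0 by (simp add: cuspA_def)
  let ?N = "cross3 (cuspA P) (cuspE P)"
  have cr: "cross3 (x *\<^sub>R a) (y *\<^sub>R b + z *\<^sub>R a) = (x * y) *\<^sub>R cross3 a b" for x y z and a b :: "real^3"
    by (simp add: cross_mult_left cross_mult_right cross_add_right)
  have "?N = (- 1 / (grad K P \<bullet> dir0 \<xi> P) * (- 2 / (3 * (grad K P \<bullet> dir0 \<xi> P)))) *\<^sub>R cross3 (dir0 \<xi> P) (dir1 \<xi> P)"
    unfolding cuspA_def cuspE_def by (rule cr)
  moreover have "cross3 (dir0 \<xi> P) (dir1 \<xi> P) $ 3 \<noteq> 0"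
    using g0[OF Pc] by (simp add: cross3_def dir0_def dir1_def)
  then have "cross3 (dir0 \<xi> P) (dir1 \<xi> P) \<noteq> 0" by (metis zero_index)
  ultimately show N: "?N \<noteq> 0" using d0 by simp
  have lagrange: "cross3 a (cross3 b c) = (a \<bullet> c) *\<^sub>R b - (a \<bullet> b) *\<^sub>R c" for a b c :: "real^3"
    by (simp add: cross3_simps forall_3)
  have "cross3 (\<xi> P) ?N = 0" unfolding lagrange using A0 E0 by simp
  then have "cross3 (\<xi> P) (cross3 (\<xi> P) ?N) = 0" by simp
  then have "(\<xi> P \<bullet> ?N) *\<^sub>R \<xi> P = (\<xi> P \<bullet> \<xi> P) *\<^sub>R ?N" unfolding lagrange[of "\<xi> P" "\<xi> P"] by simp
  then show eq: "?N = (\<xi> P \<bullet> ?N) *\<^sub>R \<xi> P" using norm1[OF Pc] by (simp add: norm_eq_1)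
  then show "\<xi> P \<bullet> ?N \<noteq> 0" using N by (metis scale_zero_left)
qed

text \<open>This mixed term of \<open>d\<xi>\<close> determines the leading coefficient, \<open>- twist / 5\<close>, of the component along \<open>\<xi>(P)\<close>.\<close>

definition twist :: "real^3 \<Rightarrow> real" where
  "twist P = frechet_derivative \<xi> (at P) (cuspA P) \<bullet> cuspE P"

text \<open>On \<open>dir0 + x dir1\<close> the second fundamental form is \<open>x\<^sup>2 / g\<close>, by the factorisation of the binary form at a
  point with \<open>\<K> = 0\<close>. So its constant and its linear term in \<open>x\<close> vanish.\<close>

lemma second_form_null:
  assumes P: "P \<in> U" "K P = 0"
  defines "T \<equiv> frechet_derivative \<xi> (at P)"
  shows "linear T" "T (cuspA P) \<bullet> cuspA P = 0" "T (cuspA P) \<bullet> cuspE P + T (cuspE P) \<bullet> cuspA P = 0"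
proof -
  note Pc = U_sub(2)[OF P(1)]
  show lin: "linear T" unfolding T_def using xi_diff[OF Pc] by (rule linear_frechet_derivative)
  interpret linear T by fact
  let ?a = "dir0 \<xi> P" and ?b = "dir1 \<xi> P"
  have q: "T (lift_dir \<xi> x P) \<bullet> lift_dir \<xi> x P = x^2 / g_coeff \<xi> P" for x
  proof -
    have "T (lift_dir \<xi> x P) \<bullet> lift_dir \<xi> x P = e_coeff \<xi> P + 2 * f_coeff \<xi> P * ((x - f_coeff \<xi> P) / g_coeff \<xi> P)
       + g_coeff \<xi> P * ((x - f_coeff \<xi> P) / g_coeff \<xi> P)^2"
      unfolding T_def frechet_derivative_quadratic_form[OF xi_diff[OF Pc] c0[OF Pc] xi_inner_dirs(3)[of \<xi> P x, OF c0[OF Pc]]]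
      by (simp add: lift_dir_nth)
    also have "\<dots> = (e_coeff \<xi> P * g_coeff \<xi> P - (f_coeff \<xi> P)^2 + x^2) / g_coeff \<xi> P"
      using g0[OF Pc] by (simp add: field_simps power2_eq_square)
    finally show ?thesis using P(2) by (simp add: KK_def)
  qed
  have ex: "T (lift_dir \<xi> x P) \<bullet> lift_dir \<xi> x P = T ?a \<bullet> ?a + x * (T ?a \<bullet> ?b + T ?b \<bullet> ?a) + x^2 * (T ?b \<bullet> ?b)" for x
    by (simp add: lift_dir_def add scale inner_add_left inner_add_right algebra_simps power2_eq_square)
  have aa: "T ?a \<bullet> ?a = 0" using q[of 0] ex[of 0] by simp
  have ab: "T ?a \<bullet> ?b + T ?b \<bullet> ?a = 0" using q[of 1] ex[of 1] q[of "-1"] ex[of "-1"] by simp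
  show "T (cuspA P) \<bullet> cuspA P = 0" by (simp add: cuspA_def scale neg aa)
  define x y z where "x = - 1 / (grad K P \<bullet> ?a)" and "y = - 2 / (3 * (grad K P \<bullet> ?a))"
    and "z = 2 * (grad K P \<bullet> ?b) / (3 * (grad K P \<bullet> ?a)^2)"
  have "T (cuspA P) \<bullet> cuspE P + T (cuspE P) \<bullet> cuspA P = x * y * (T ?a \<bullet> ?b + T ?b \<bullet> ?a) + 2 * x * z * (T ?a \<bullet> ?a)"
    unfolding cuspA_def cuspE_def x_def[symmetric] y_def[symmetric] z_def[symmetric]
    by (simp add: add scale inner_add_left inner_add_right algebra_simps)
  then show "T (cuspA P) \<bullet> cuspE P + T (cuspE P) \<bullet> cuspA P = 0" by (simp add: aa ab)
qed

text \<open>The symmetric part of the mixed term vanishes, so it is half the skew part, which is given by the curl.\<close>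

lemma twist_curl:
  assumes P: "P \<in> U" "K P = 0"
  shows "2 * twist P = (\<xi> P \<bullet> cross3 (cuspA P) (cuspE P)) * (curl \<xi> P \<bullet> \<xi> P)"
proof -
  have "curl \<xi> P \<bullet> cross3 (cuspA P) (cuspE P) = 2 * twist P"
    using frechet_derivative_inner_curl[OF xi_diff[OF U_sub(2)[OF P(1)]], of "cuspA P" "cuspE P"] second_form_null(3)[OF P]
    by (simp add: twist_def)
  then show ?thesis
    by (subst (asm) inner_frame(5)[OF P(1)]) simp
qed

text \<open>With \<open>v = \<gamma>'\<close> and \<open>\<delta> = \<gamma> - P\<close>, orthogonality of \<open>v\<close> to \<open>\<xi>(\<gamma>)\<close> turns \<open>v \<bullet> \<xi>(P)\<close> into \<open>- v \<bullet> d\<xi>(\<delta>)\<close> up to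
  \<open>O(s\<^sup>5)\<close>. In the product of the expansions of \<open>v\<close> and \<open>\<delta>\<close> the term in \<open>s\<^sup>3\<close> is zero since \<open>A\<close> is asymptotic, and the
  terms in \<open>s\<^sup>4\<close> combine to \<open>3 twist - 2 twist\<close>.\<close>

lemma normal_coordinate_expansion:
  assumes P: "P \<in> U" "K P = 0"
  obtains C where "\<And>s. \<bar>s\<bar> < S \<Longrightarrow> \<bar>(sol 0 P s - P) \<bullet> \<xi> P + (twist P / 5) * s^5\<bar> \<le> C * s^6"
proof -
  note Pc = U_sub(2)[OF P(1)]
  let ?A = "cuspA P" and ?E = "cuspE P"
  define T where "T = frechet_derivative \<xi> (at P)"
  note T = second_form_null[OF P, folded T_def]
  interpret linear T by (rule T(1))
  obtain C where C: "0 \<le> C"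
    "\<And>s. \<bar>s\<bar> < S \<Longrightarrow> norm (field s (sol 0 P s) - (2 * s) *\<^sub>R ?A - (3 * s^2) *\<^sub>R ?E) \<le> C * \<bar>s\<bar>^3"
    "\<And>s. \<bar>s\<bar> < S \<Longrightarrow> norm (sol 0 P s - P - s^2 *\<^sub>R ?A - s^3 *\<^sub>R ?E) \<le> C * s^4"
    using cusp_expansion[OF P(1)] by metis
  obtain k where k: "0 \<le> k" "\<And>v. norm (T v) \<le> norm v * k"
    using bounded_linear.nonneg_bounded[OF linear_conv_bounded_linear[THEN iffD1, OF T(1)]] by blast
  define C' where "C' = \<beta> * (\<kappa> * \<beta>^2) + C * (\<beta> * k) + (2 * norm ?A + 3 * norm ?E) * (C * k) + 3 * \<bar>T ?E \<bullet> ?E\<bar>"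
  have bound: "\<bar>field s (sol 0 P s) \<bullet> \<xi> P + twist P * s^4\<bar> \<le> C' * \<bar>s\<bar>^5" if s: "\<bar>s\<bar> < S" for s
  proof -
    have sI: "s \<in> I" "\<bar>s\<bar> \<le> 1" using s S by auto
    define q v where "q = sol 0 P s" and "v = field s (sol 0 P s)"
    have q: "q \<in> cball 0 r" unfolding q_def by (rule staysD(2)[OF U_stays[OF P(1)] sI(1)])
    define \<delta> where "\<delta> = q - P"
    have n\<delta>: "norm \<delta> \<le> \<beta> * s^2" using sol_quadratic_bound[OF P(1) s] by (simp add: \<delta>_def q_def)
    have nv: "norm v \<le> \<beta> * \<bar>s\<bar>" using field_bd[OF q sI(1)] by (simp add: v_def q_def)
    have "v \<bullet> \<xi> q = 0"
      using xi_inner_dirs(3)[of \<xi> q s, OF c0[OF q]] by (simp add: v_def q_def field_def lift_vel_def inner_commute)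
    define \<rho> where "\<rho> = \<xi> q - \<xi> P - T \<delta>"
    have n\<rho>: "norm \<rho> \<le> \<kappa> * (\<beta> * s^2)^2"
    proof -
      have "norm \<rho> \<le> \<kappa> * norm \<delta>^2" using xi_taylor[OF Pc q] by (simp add: \<rho>_def T_def \<delta>_def)
      also have "\<dots> \<le> \<kappa> * (\<beta> * s^2)^2" using n\<delta> LBC by (intro mult_left_mono power_mono) auto
      finally show ?thesis .
    qed
    define r1 where "r1 = v - (2 * s) *\<^sub>R ?A - (3 * s^2) *\<^sub>R ?E"
    define r2 where "r2 = \<delta> - s^2 *\<^sub>R ?A - s^3 *\<^sub>R ?E"
    have r: "norm r1 \<le> C * \<bar>s\<bar>^3" "norm r2 \<le> C * s^4"
      using C(2)[OF s] C(3)[OF s] by (simp_all add: r1_def r2_def v_def \<delta>_def q_def)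
    have v_eq: "v = r1 + ((2 * s) *\<^sub>R ?A + (3 * s^2) *\<^sub>R ?E)" by (simp add: r1_def)
    have \<delta>_eq: "\<delta> = r2 + (s^2 *\<^sub>R ?A + s^3 *\<^sub>R ?E)" by (simp add: r2_def)
    let ?w = "(2 * s) *\<^sub>R ?A + (3 * s^2) *\<^sub>R ?E"
    have main: "?w \<bullet> T (s^2 *\<^sub>R ?A + s^3 *\<^sub>R ?E) = twist P * s^4 + 3 * s^5 * (T ?E \<bullet> ?E)"
    proof -
      have "?A \<bullet> T ?E = - twist P" using T(3) by (simp add: twist_def T_def[symmetric] inner_commute)
      moreover have "?E \<bullet> T ?A = twist P" by (simp add: twist_def T_def[symmetric] inner_commute)
      moreover have "?A \<bullet> T ?A = 0" using T(2) by (simp add: inner_commute)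
      ultimately show ?thesis
        by (simp add: add scale inner_add_left inner_add_right inner_commute[of ?E "T ?E"] algebra_simps eval_nat_numeral)
    qed
    have "v \<bullet> \<xi> P = - (v \<bullet> \<rho>) - v \<bullet> T \<delta>"
      using \<open>v \<bullet> \<xi> q = 0\<close> by (simp add: \<rho>_def inner_diff_right)
    also have "v \<bullet> T \<delta> = r1 \<bullet> T \<delta> + ?w \<bullet> T \<delta>" by (subst v_eq) (rule inner_add_left)
    also have "?w \<bullet> T \<delta> = ?w \<bullet> T r2 + ?w \<bullet> T (s^2 *\<^sub>R ?A + s^3 *\<^sub>R ?E)"
      by (subst \<delta>_eq) (simp only: add inner_add_right)
    finally have eq: "v \<bullet> \<xi> P + twist P * s^4 = - (v \<bullet> \<rho>) - r1 \<bullet> T \<delta> - ?w \<bullet> T r2 - 3 * s^5 * (T ?E \<bullet> ?E)"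
      unfolding main by simp
    have b1: "\<bar>v \<bullet> \<rho>\<bar> \<le> (\<beta> * \<bar>s\<bar>) * (\<kappa> * (\<beta> * s^2)^2)"
      using nv n\<rho> by (intro order_trans[OF Cauchy_Schwarz_ineq2] mult_mono) (auto simp: LBC)
    have b2: "\<bar>r1 \<bullet> T \<delta>\<bar> \<le> (C * \<bar>s\<bar>^3) * ((\<beta> * s^2) * k)"
      using r(1) order_trans[OF k(2)[of \<delta>] mult_right_mono[OF n\<delta> k(1)]] C(1)
      by (intro order_trans[OF Cauchy_Schwarz_ineq2] mult_mono) auto
    have nw: "norm ?w \<le> (2 * norm ?A + 3 * norm ?E) * \<bar>s\<bar>"
    proof -
      have "norm ?w \<le> 2 * \<bar>s\<bar> * norm ?A + 3 * (\<bar>s\<bar> * \<bar>s\<bar>) * norm ?E"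
        by (rule norm_triangle_le) (simp add: power2_eq_square abs_mult)
      also have "\<dots> \<le> 2 * \<bar>s\<bar> * norm ?A + 3 * (\<bar>s\<bar> * 1) * norm ?E"
        using sI(2) by (intro add_mono mult_right_mono mult_left_mono) auto
      finally show ?thesis by (simp add: algebra_simps)
    qed
    have b3: "\<bar>?w \<bullet> T r2\<bar> \<le> ((2 * norm ?A + 3 * norm ?E) * \<bar>s\<bar>) * ((C * s^4) * k)"
      using nw order_trans[OF k(2)[of r2] mult_right_mono[OF r(2) k(1)]]
      by (intro order_trans[OF Cauchy_Schwarz_ineq2] mult_mono) auto
    have b4: "\<bar>3 * s^5 * (T ?E \<bullet> ?E)\<bar> = 3 * \<bar>T ?E \<bullet> ?E\<bar> * \<bar>s\<bar>^5" by (simp add: abs_mult power_abs)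
    define a where "a = \<bar>s\<bar>"
    have pw: "s^2 = a^2" "s^4 = a^4" by (simp_all add: a_def)
    have "\<bar>v \<bullet> \<xi> P + twist P * s^4\<bar> \<le> \<bar>v \<bullet> \<rho>\<bar> + \<bar>r1 \<bullet> T \<delta>\<bar> + \<bar>?w \<bullet> T r2\<bar> + \<bar>3 * s^5 * (T ?E \<bullet> ?E)\<bar>"
      unfolding eq by linarith
    also have "\<dots> \<le> (\<beta> * \<bar>s\<bar>) * (\<kappa> * (\<beta> * s^2)^2) + (C * \<bar>s\<bar>^3) * ((\<beta> * s^2) * k)
       + ((2 * norm ?A + 3 * norm ?E) * \<bar>s\<bar>) * ((C * s^4) * k) + 3 * \<bar>T ?E \<bullet> ?E\<bar> * \<bar>s\<bar>^5"
      using b1 b2 b3 b4 by linarith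
    also have "\<dots> = C' * \<bar>s\<bar>^5"
      unfolding pw a_def[symmetric] C'_def by (simp add: algebra_simps eval_nat_numeral)
    finally show ?thesis by (simp add: v_def)
  qed
  have "\<bar>(sol 0 P s - P) \<bullet> \<xi> P + (twist P / 5) * s^5\<bar> \<le> C' * s^6" if s: "\<bar>s\<bar> < S" for s
  proof -
    have "norm ((sol 0 P s - P) \<bullet> \<xi> P + (twist P / 5) * s^5) \<le> C' * \<bar>s\<bar>^Suc 5"
    proof (rule power_bound_from_derivative[where f = "\<lambda>s. (sol 0 P s - P) \<bullet> \<xi> P + (twist P / 5) * s^5" and
        f' = "\<lambda>s. field s (sol 0 P s) \<bullet> \<xi> P + twist P * s^4" and \<epsilon> = S])
      fix t assume t: "\<bar>t\<bar> < S"
      have "((\<lambda>s. (sol 0 P s - P) \<bullet> \<xi> P) has_vector_derivative field t (sol 0 P t) \<bullet> \<xi> P) (at t)"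
        using sol_der_U[OF P(1) t]
        by (intro bounded_linear.has_vector_derivative[OF bounded_linear_inner_left])
          (auto intro!: derivative_eq_intros)
      moreover have "((\<lambda>s. (twist P / 5) * s^5) has_vector_derivative twist P * t^4) (at t)"
        unfolding has_real_derivative_iff_has_vector_derivative[symmetric]
        by (auto intro!: derivative_eq_intros)
      ultimately show "((\<lambda>s. (sol 0 P s - P) \<bullet> \<xi> P + (twist P / 5) * s^5) has_vector_derivative
          field t (sol 0 P t) \<bullet> \<xi> P + twist P * t^4) (at t)"
        by (rule has_vector_derivative_add)
    qed (use bound s in auto)
    then show ?thesis by simp
  qed
  then show thesis using that by blast
qed

end

section \<open>The cusp formed by the two lines\<close>

lemma vec_angle_not_right:
  assumes "v \<bullet> w \<noteq> 0"
  shows "vec_angle v w \<noteq> pi / 2"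
proof
  assume a: "vec_angle v w = pi / 2"
  have vw: "v \<noteq> 0" "w \<noteq> 0" using assms by auto
  then have nz: "norm v * norm w > 0" by simp
  have "\<bar>v \<bullet> w\<bar> \<le> norm v * norm w" by (rule Cauchy_Schwarz_ineq2)
  then have b: "\<bar>v \<bullet> w / (norm v * norm w)\<bar> \<le> 1" using nz by (simp add: abs_divide divide_le_eq)
  have "v \<bullet> w / (norm v * norm w) = cos (vec_angle v w)"
    unfolding vec_angle_def by (rule cos_arccos_abs[OF b, symmetric])
  also have "\<dots> = 0" by (simp only: a cos_pi_half)
  finally show False using assms vw by simp
qed

context cusp_box begin

text \<open>Equal values of \<open>\<K>\<close> leave only the pair \<open>s\<close>, \<open>- s\<close>, and these two points differ by \<open>2 s\<^sup>3 E + O(s\<^sup>4)\<close>.\<close>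

lemma injective_near:
  assumes P: "P \<in> U" "K P = 0"
  obtains \<rho> where "0 < \<rho>" "\<rho> \<le> S" "inj_on (sol 0 P) {-\<rho><..<\<rho>}"
proof -
  obtain C where C: "0 \<le> C"
    "\<And>s. \<bar>s\<bar> < S \<Longrightarrow> norm (sol 0 P s - P - s^2 *\<^sub>R cuspA P - s^3 *\<^sub>R cuspE P) \<le> C * s^4"
    using cusp_expansion[OF P(1)] by metis
  let ?E = "cuspE P"
  have E: "0 < norm ?E" using inner_frame(4)[OF P(1)] by auto
  define \<rho> where "\<rho> = min S (norm ?E / (C + 1))"
  have \<rho>: "0 < \<rho>" "\<rho> \<le> S" using S E C by (auto simp: \<rho>_def)
  have "inj_on (sol 0 P) {-\<rho><..<\<rho>}"
  proof (rule inj_onI, rule ccontr)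
    fix s s' assume s: "s \<in> {-\<rho><..<\<rho>}" "s' \<in> {-\<rho><..<\<rho>}" and eq: "sol 0 P s = sol 0 P s'" and ne: "s \<noteq> s'"
    have "s^2 = s'^2" using K_sol[OF P, of s] K_sol[OF P, of s'] eq s \<rho> by auto
    then have s': "s' = - s" using ne by (auto simp: power2_eq_iff)
    have lt: "\<bar>s\<bar> < S" "\<bar>- s\<bar> < S" using s \<rho> by auto
    define R where "R t = sol 0 P t - P - t^2 *\<^sub>R cuspA P - t^3 *\<^sub>R ?E" for t
    have "(2 * s^3) *\<^sub>R ?E = R (- s) - R s"
      using eq unfolding s' R_def mult_2 scaleR_add_left by simp
    then have "norm ((2 * s^3) *\<^sub>R ?E) \<le> norm (R (- s)) + norm (R s)" using norm_triangle_ineq4 by metis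
    also have "\<dots> \<le> C * s^4 + C * s^4" using C(2)[OF lt(1)] C(2)[OF lt(2)] by (simp add: R_def)
    finally have "\<bar>s\<bar>^3 * norm ?E \<le> \<bar>s\<bar>^3 * (C * \<bar>s\<bar>)"
      by (simp add: abs_mult power_abs) (simp add: eval_nat_numeral abs_if mult_ac split: if_splits)
    moreover have "0 < \<bar>s\<bar>^3" using ne s' by auto
    ultimately have "norm ?E \<le> C * \<bar>s\<bar>" by simp
    also have "\<dots> \<le> (C + 1) * \<bar>s\<bar>" by (simp add: algebra_simps)
    also have "\<bar>s\<bar> < norm ?E / (C + 1)" using s by (auto simp: \<rho>_def)
    then have "(C + 1) * \<bar>s\<bar> < norm ?E" using C(1) by (simp add: pos_less_divide_eq mult.commute)
    finally show False by simp
  qed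
  then show thesis using that \<rho> by blast
qed

lemma half_distinct:
  assumes P: "P \<in> U" "K P = 0"
  shows "\<not> same_germ P (half P 1 S) (half P (-1) S)"
proof
  assume "same_germ P (half P 1 S) (half P (-1) S)"
  then obtain V where V: "open V" "P \<in> V" "half P 1 S \<inter> V = half P (-1) S \<inter> V" unfolding same_germ_def by blast
  obtain \<rho> where \<rho>: "0 < \<rho>" "\<rho> \<le> S" "inj_on (sol 0 P) {-\<rho><..<\<rho>}" using injective_near[OF P] .
  have "continuous_on {-S<..<S} (sol 0 P)" using sol_cont[OF zero_I] by (rule continuous_on_subset) auto
  from continuous_open_preimage[OF this open_greaterThanLessThan V(1)]
  have "open ({-S<..<S} \<inter> sol 0 P -` V)" .
  moreover have "0 \<in> {-S<..<S} \<inter> sol 0 P -` V" using V S by simp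
  ultimately obtain \<epsilon> where \<epsilon>: "\<epsilon> > 0" "ball 0 \<epsilon> \<subseteq> {-S<..<S} \<inter> sol 0 P -` V"
    using open_contains_ball by blast
  define s where "s = min \<epsilon> \<rho> / 2"
  have s: "0 < s" "s < \<epsilon>" "s < \<rho>" using \<epsilon> \<rho> by (auto simp: s_def)
  have "s \<in> ball 0 \<epsilon>" using s by (simp add: dist_real_def)
  then have "sol 0 P s \<in> V" using \<epsilon>(2) by blast
  moreover have "sol 0 P s \<in> half P 1 S"
    unfolding half_def by (rule image_eqI[of _ _ s]) (use s \<rho> in auto)
  ultimately have "sol 0 P s \<in> half P (-1) S" using V(3) by blast
  then obtain s' where s': "0 \<le> s'" "s' < S" "sol 0 P s = sol 0 P (- s')" unfolding half_def by auto
  have "s^2 = s'^2" using K_sol[OF P, of s] K_sol[OF P, of "- s'"] s' s \<rho> by auto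
  then have "s' = s" using s s' by (simp add: power2_eq_iff_nonneg)
  then have "sol 0 P s = sol 0 P (- s)" using s' by simp
  from inj_onD[OF \<rho>(3) this] show False using s by auto
qed

lemma arc_half_germ:
  assumes P: "P \<in> U" "K P = 0" and e: "\<bar>e\<bar> = 1" and \<eta>: "0 < \<eta>" "\<eta> < S"
  shows "same_germ P ((\<lambda>s. sol 0 P (e * s)) ` {0..\<eta>}) (half P e S)"
proof (rule same_germI)
  show "open {q \<in> U. - (\<eta>^2) < K q}" by (rule open_level)
  show "P \<in> {q \<in> U. - (\<eta>^2) < K q}" using P \<eta> by simp
  fix q assume q: "q \<in> {q \<in> U. - (\<eta>^2) < K q}"
  have "s < \<eta>" if "q = sol 0 P (e * s)" "0 \<le> s" "s \<le> S" for s
  proof -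
    have "s^2 < \<eta>^2" using q K_sol[OF P, of "e * s"] that abs_sign_mult(1-3)[OF e, of s] by auto
    then show ?thesis using \<eta> power2_less_imp_less[of s \<eta>] by simp
  qed
  then show "q \<in> (\<lambda>s. sol 0 P (e * s)) ` {0..\<eta>} \<longleftrightarrow> q \<in> half P e S"
    unfolding half_def using \<eta> by fastforce
qed

lemma half_reparam:
  assumes "\<mu> \<noteq> 0"
  shows "(\<lambda>t. sol 0 P (\<mu> * t)) ` {0..<\<epsilon>} = half P (sgn \<mu>) (\<bar>\<mu>\<bar> * \<epsilon>)"
    and "(\<lambda>t. sol 0 P (\<mu> * t)) ` {-\<epsilon><..0} = half P (- sgn \<mu>) (\<bar>\<mu>\<bar> * \<epsilon>)"
proof -
  have l: "0 < \<bar>\<mu>\<bar>" using assms by simp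
  have 1: "(\<lambda>t. \<bar>\<mu>\<bar> * t) ` {0..<\<epsilon>} = {0..<\<bar>\<mu>\<bar> * \<epsilon>}"
  proof (intro equalityI subsetI)
    fix x assume "x \<in> {0..<\<bar>\<mu>\<bar> * \<epsilon>}"
    then show "x \<in> (\<lambda>t. \<bar>\<mu>\<bar> * t) ` {0..<\<epsilon>}"
      using l by (intro image_eqI[of _ _ "x / \<bar>\<mu>\<bar>"]) (auto simp: pos_divide_less_eq mult.commute)
  qed (use l in \<open>auto intro: mult_strict_left_mono\<close>)
  have 2: "(\<lambda>t. \<bar>\<mu>\<bar> * - t) ` {-\<epsilon><..0} = {0..<\<bar>\<mu>\<bar> * \<epsilon>}"
  proof -
    have "(\<lambda>t. \<bar>\<mu>\<bar> * - t) ` {-\<epsilon><..0} = (\<lambda>t. \<bar>\<mu>\<bar> * t) ` (uminus ` {-\<epsilon><..0})" by (simp only: image_image)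
    also have "uminus ` {-\<epsilon><..0} = {0..<\<epsilon>}" by simp
    finally show ?thesis using 1 by simp
  qed
  have 3: "sgn \<mu> * (\<bar>\<mu>\<bar> * t) = \<mu> * t" "- sgn \<mu> * (\<bar>\<mu>\<bar> * - t) = \<mu> * t" for t
    by (simp_all add: sgn_mult_abs flip: mult.assoc)
  show "(\<lambda>t. sol 0 P (\<mu> * t)) ` {0..<\<epsilon>} = half P (sgn \<mu>) (\<bar>\<mu>\<bar> * \<epsilon>)"
    unfolding half_def 1[symmetric] image_image 3 ..
  show "(\<lambda>t. sol 0 P (\<mu> * t)) ` {-\<epsilon><..0} = half P (- sgn \<mu>) (\<bar>\<mu>\<bar> * \<epsilon>)"
    unfolding half_def 2[symmetric] image_image 3 ..
qed

lemma curve_derivative: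
  assumes P: "P \<in> U" and t: "\<bar>\<mu> * t\<bar> < S"
  shows "((\<lambda>t. sol 0 P (\<mu> * t)) has_vector_derivative \<mu> *\<^sub>R field (\<mu> * t) (sol 0 P (\<mu> * t))) (at t)"
proof -
  have "((\<lambda>t. \<mu> * t) has_vector_derivative \<mu>) (at t)" by (auto intro!: derivative_eq_intros)
  from vector_diff_chain_at[OF this sol_der_U[OF P t]] show ?thesis by (simp only: o_def)
qed

lemma curve_velocity_cont:
  assumes P: "P \<in> U" and T: "\<And>t. t \<in> T \<Longrightarrow> \<bar>\<mu> * t\<bar> \<le> S"
  shows "continuous_on T (\<lambda>t. \<mu> *\<^sub>R field (\<mu> * t) (sol 0 P (\<mu> * t)))"
proof -
  have TI: "\<mu> * t \<in> I" if "t \<in> T" for t using T[OF that] by auto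
  have "continuous_on T (\<lambda>t. sol 0 P (\<mu> * t))"
    by (rule continuous_on_compose2[OF sol_cont[OF zero_I]]) (use TI in \<open>auto intro!: continuous_intros\<close>)
  then have "continuous_on T (\<lambda>t. (\<mu> * t, sol 0 P (\<mu> * t)))" by (intro continuous_intros)
  moreover have "(\<lambda>t. (\<mu> * t, sol 0 P (\<mu> * t))) ` T \<subseteq> I \<times> cball 0 r"
  proof (rule image_subsetI)
    fix t assume "t \<in> T"
    then show "(\<mu> * t, sol 0 P (\<mu> * t)) \<in> I \<times> cball 0 r" using TI staysD(2)[OF U_stays[OF P]] by blast
  qed
  ultimately have "continuous_on T (\<lambda>t. lift_vel \<xi> (\<mu> * t) (sol 0 P (\<mu> * t)))"
    using continuous_on_compose2[OF lift_vel_cont] by fastforce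
  then show ?thesis unfolding field_def by (intro continuous_intros)
qed

lemma asym_param_curve:
  assumes P: "P \<in> U" "K P = 0" and l: "\<mu> \<noteq> 0"
  obtains \<epsilon> where "0 < \<epsilon>" "\<bar>\<mu>\<bar> * \<epsilon> \<le> S" "asym_param \<xi> W P \<epsilon> (\<lambda>t. sol 0 P (\<mu> * t))"
proof -
  obtain \<rho> where \<rho>: "0 < \<rho>" "\<rho> \<le> S" "inj_on (sol 0 P) {-\<rho><..<\<rho>}" using injective_near[OF P] .
  define \<epsilon> where "\<epsilon> = \<rho> / \<bar>\<mu>\<bar>"
  have \<epsilon>: "0 < \<epsilon>" "\<bar>\<mu>\<bar> * \<epsilon> = \<rho>" using \<rho> l by (simp_all add: \<epsilon>_def)
  have lt: "\<bar>\<mu> * t\<bar> < \<rho>" if "t \<in> {-\<epsilon><..<\<epsilon>}" for t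
  proof -
    have "\<bar>\<mu>\<bar> * \<bar>t\<bar> < \<bar>\<mu>\<bar> * \<epsilon>" using that l by (intro mult_strict_left_mono) auto
    then show ?thesis by (simp add: abs_mult \<epsilon>)
  qed
  have ltS: "\<bar>\<mu> * t\<bar> < S" if "t \<in> {-\<epsilon><..<\<epsilon>}" for t using lt[OF that] \<rho> by simp
  note der = curve_derivative[OF P(1) ltS]
  have "asym_param \<xi> W P \<epsilon> (\<lambda>t. sol 0 P (\<mu> * t))"
    unfolding asym_param_def
  proof (intro conjI ballI impI)
    show "(\<lambda>t. sol 0 P (\<mu> * t)) C1_differentiable_on {-\<epsilon><..<\<epsilon>}"
      unfolding C1_differentiable_on_def
      by (rule exI[of _ "\<lambda>t. \<mu> *\<^sub>R field (\<mu> * t) (sol 0 P (\<mu> * t))"], intro conjI ballI der)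
        (auto intro!: curve_velocity_cont[OF P(1)] less_imp_le[OF ltS])
    show "inj_on (\<lambda>t. sol 0 P (\<mu> * t)) {-\<epsilon><..<\<epsilon>}"
    proof (rule inj_onI)
      fix t t' assume t: "t \<in> {-\<epsilon><..<\<epsilon>}" "t' \<in> {-\<epsilon><..<\<epsilon>}" and eq: "sol 0 P (\<mu> * t) = sol 0 P (\<mu> * t')"
      have "\<mu> * t = \<mu> * t'" by (rule inj_onD[OF \<rho>(3) eq]) (use lt[OF t(1)] lt[OF t(2)] in \<open>auto simp: abs_less_iff\<close>)
      then show "t = t'" using l by simp
    qed
    show "sol 0 P (\<mu> * 0) = P" by simp
    fix t assume t: "t \<in> {-\<epsilon><..<\<epsilon>}" "t \<noteq> 0"
    have tI: "\<mu> * t \<in> I" "\<bar>\<mu> * t\<bar> \<le> S" using ltS[OF t(1)] by auto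
    note c = staysD(2)[OF U_stays[OF P(1)] tI(1)]
    have Kt: "K (sol 0 P (\<mu> * t)) = - ((\<mu> * t)^2)" by (rule K_sol[OF P tI(2)])
    have nz: "\<mu> * t \<noteq> 0" using l t by simp
    then have "0 < (\<mu> * t)^2" by (rule zero_less_power2[THEN iffD2])
    then show "sol 0 P (\<mu> * t) \<in> hyperbolic_set \<xi> W" using mem_hyperbolic[OF c] Kt by simp
    have "vector_derivative (\<lambda>t. sol 0 P (\<mu> * t)) (at t) = (\<mu> * (\<mu> * t)) *\<^sub>R lift_vel \<xi> (\<mu> * t) (sol 0 P (\<mu> * t))"
      using vector_derivative_at[OF der[OF t(1)]] by (simp add: field_def)
    then show "asym_dir \<xi> (sol 0 P (\<mu> * t)) (vector_derivative (\<lambda>t. sol 0 P (\<mu> * t)) (at t))"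
      using asym_dir_lift_vel[OF c tI(2) Kt, of "\<mu> * (\<mu> * t)"] nz l by simp
  qed
  then show thesis using that \<epsilon> \<rho> by simp
qed

lemma cusp_230_curve:
  assumes P: "P \<in> U" and l: "\<mu> \<noteq> 0"
  shows "cusp_230 P (\<lambda>t. sol 0 P (\<mu> * t))"
proof -
  obtain C where C: "0 \<le> C"
    "\<And>s. \<bar>s\<bar> < S \<Longrightarrow> norm (field s (sol 0 P s) - (2 * s) *\<^sub>R cuspA P - (3 * s^2) *\<^sub>R cuspE P) \<le> C * \<bar>s\<bar>^3"
    using cusp_velocity_expansion[OF P] by metis
  have lt: "\<bar>\<mu> * t\<bar> < S" if "\<bar>t\<bar> < S / \<bar>\<mu>\<bar>" for t
    using that l by (simp add: abs_mult pos_less_divide_eq mult.commute)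
  show ?thesis
  proof (rule cusp_230_if_expansion[where \<epsilon> = "S / \<bar>\<mu>\<bar>" and \<gamma>' = "\<lambda>t. \<mu> *\<^sub>R field (\<mu> * t) (sol 0 P (\<mu> * t))" and
      A = "\<mu>^2 *\<^sub>R cuspA P" and E = "\<mu>^3 *\<^sub>R cuspE P" and C = "\<bar>\<mu>\<bar>^4 * C"])
    show "0 < S / \<bar>\<mu>\<bar>" using S l by simp
    show "continuous_on {-(S / \<bar>\<mu>\<bar>)<..<S / \<bar>\<mu>\<bar>} (\<lambda>t. \<mu> *\<^sub>R field (\<mu> * t) (sol 0 P (\<mu> * t)))"
      by (rule curve_velocity_cont[OF P], rule less_imp_le, rule lt) auto
    show "sol 0 P (\<mu> * 0) = P" by simp
    show "cross3 (\<mu>^2 *\<^sub>R cuspA P) (\<mu>^3 *\<^sub>R cuspE P) \<noteq> 0"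
      using inner_frame(4)[OF P] l by (simp add: cross_mult_left cross_mult_right)
    fix t assume t: "\<bar>t\<bar> < S / \<bar>\<mu>\<bar>"
    show "((\<lambda>t. sol 0 P (\<mu> * t)) has_vector_derivative \<mu> *\<^sub>R field (\<mu> * t) (sol 0 P (\<mu> * t))) (at t)"
      by (rule curve_derivative[OF P lt[OF t]])
    let ?s = "\<mu> * t"
    have "\<mu> *\<^sub>R field ?s (sol 0 P ?s) - (2 * t) *\<^sub>R \<mu>^2 *\<^sub>R cuspA P - (3 * t^2) *\<^sub>R \<mu>^3 *\<^sub>R cuspE P
      = \<mu> *\<^sub>R (field ?s (sol 0 P ?s) - (2 * ?s) *\<^sub>R cuspA P - (3 * ?s^2) *\<^sub>R cuspE P)"
      by (simp add: scaleR_diff_right power2_eq_square power3_eq_cube mult_ac)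
    also have "norm \<dots> \<le> \<bar>\<mu>\<bar> * (C * \<bar>?s\<bar>^3)"
      unfolding norm_scaleR by (intro mult_left_mono C(2) lt t) simp
    also have "\<dots> = \<bar>\<mu>\<bar>^4 * C * \<bar>t\<bar>^3"
    proof -
      have "\<bar>\<mu>\<bar>^4 = \<bar>\<mu>\<bar> * \<bar>\<mu>\<bar>^3" by (simp only: numeral_eq_Suc power_Suc pred_numeral_simps BitM.simps)
      then show ?thesis unfolding abs_mult power_mult_distrib by (simp only: mult_ac)
    qed
    finally show "norm (\<mu> *\<^sub>R field ?s (sol 0 P ?s) - (2 * t) *\<^sub>R \<mu>^2 *\<^sub>R cuspA P - (3 * t^2) *\<^sub>R \<mu>^3 *\<^sub>R cuspE P)
      \<le> \<bar>\<mu>\<bar>^4 * C * \<bar>t\<bar>^3" .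
  qed
qed

text \<open>A rescaling by \<open>\<mu>\<close> of the parameter is allowed for the sake of the normal form; a negative \<open>\<mu>\<close> exchanges the two arcs.\<close>

lemma asym_arcs_at:
  assumes P: "P \<in> U" "K P = 0" and l: "\<mu> \<noteq> 0"
  obtains \<Gamma>1 \<Gamma>2 \<epsilon> where "asym_arc_from \<xi> W P \<Gamma>1" "asym_arc_from \<xi> W P \<Gamma>2" "\<not> same_germ P \<Gamma>1 \<Gamma>2"
    "\<And>\<Gamma>. asym_arc_from \<xi> W P \<Gamma> \<Longrightarrow> same_germ P \<Gamma> \<Gamma>1 \<or> same_germ P \<Gamma> \<Gamma>2"
    "0 < \<epsilon>" "asym_param \<xi> W P \<epsilon> (\<lambda>t. sol 0 P (\<mu> * t))"
    "same_germ P \<Gamma>1 ((\<lambda>t. sol 0 P (\<mu> * t)) ` {0..<\<epsilon>})" "same_germ P \<Gamma>2 ((\<lambda>t. sol 0 P (\<mu> * t)) ` {-\<epsilon><..0})"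
proof -
  obtain \<epsilon> where \<epsilon>: "0 < \<epsilon>" "\<bar>\<mu>\<bar> * \<epsilon> \<le> S" "asym_param \<xi> W P \<epsilon> (\<lambda>t. sol 0 P (\<mu> * t))"
    using asym_param_curve[OF P l] .
  define G where "G e = (\<lambda>s. sol 0 P (e * s)) ` {0..S/2}" for e
  have s1: "\<bar>sgn \<mu>\<bar> = 1" "\<bar>- sgn \<mu>\<bar> = 1" using l by (simp_all add: abs_sgn_eq)
  have e0: "0 < \<bar>\<mu>\<bar> * \<epsilon>" using l \<epsilon> by simp
  have arc: "asym_arc_from \<xi> W P (G e)" and germ: "same_germ P (G e) (half P e S)" if "\<bar>e\<bar> = 1" for e
    unfolding G_def using arc_half[OF P that] arc_half_germ[OF P that] S by simp_all
  have dist: "\<not> same_germ P (half P (sgn \<mu>) S) (half P (- sgn \<mu>) S)"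
    using half_distinct[OF P] same_germ_sym l by (cases "\<mu> > 0") (auto simp: sgn_if)
  have "same_germ P \<Gamma> (G (sgn \<mu>)) \<or> same_germ P \<Gamma> (G (- sgn \<mu>))" if \<Gamma>: "asym_arc_from \<xi> W P \<Gamma>" for \<Gamma>
  proof -
    obtain e where e: "\<bar>e\<bar> = 1" "same_germ P \<Gamma> (half P e S)" using arc_germ[OF P \<Gamma>] by blast
    then have "same_germ P \<Gamma> (G e)" using same_germ_trans same_germ_sym[OF germ[OF e(1)]] by blast
    moreover have "e = sgn \<mu> \<or> e = - sgn \<mu>" using e(1) s1 by (auto simp: abs_if split: if_splits)
    ultimately show ?thesis by blast
  qed
  moreover have "\<not> same_germ P (G (sgn \<mu>)) (G (- sgn \<mu>))"
    using dist same_germ_trans same_germ_sym germ s1 by metis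
  moreover have "same_germ P (G (sgn \<mu>)) ((\<lambda>t. sol 0 P (\<mu> * t)) ` {0..<\<epsilon>})"
    unfolding half_reparam[OF l]
    using same_germ_trans[OF germ half_germ[OF P]] s1 e0 \<epsilon>(2) S by auto
  moreover have "same_germ P (G (- sgn \<mu>)) ((\<lambda>t. sol 0 P (\<mu> * t)) ` {-\<epsilon><..0})"
    unfolding half_reparam[OF l]
    using same_germ_trans[OF germ half_germ[OF P]] s1 e0 \<epsilon>(2) S by auto
  ultimately show thesis using that[OF arc[OF s1(1)] arc[OF s1(2)]] \<epsilon> by blast
qed

text \<open>In the frame \<open>A / |A|\<close>, \<open>\<xi> \<times> A / |A|\<close>, \<open>\<xi>\<close> the leading terms are \<open>|A| s\<^sup>2\<close>, a nonzero multiple of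
  \<open>s\<^sup>3\<close> coming from \<open>E\<close>, and \<open>- twist s\<^sup>5 / 5\<close>.\<close>

lemma type_235_at_curve:
  assumes P: "P \<in> U" "K P = 0" and tw: "curl \<xi> P \<bullet> \<xi> P \<noteq> 0"
  shows "type_235_at \<xi> P (sol 0 P)"
proof -
  note Pc = U_sub(2)[OF P(1)]
  let ?A = "cuspA P" and ?E = "cuspE P"
  note fr = inner_frame[OF P(1)]
  obtain Q :: "real^3 \<Rightarrow> real^3" where Q: "orthogonal_transformation Q" "Q (\<xi> P) = axis 3 1"
    "Q ?A = norm ?A *\<^sub>R axis 1 1" "\<And>v. norm ?A * Q v $ 1 = v \<bullet> ?A"
    "\<And>v. norm ?A * Q v $ 2 = v \<bullet> cross3 (\<xi> P) ?A" "\<And>v. Q v $ 3 = v \<bullet> \<xi> P"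
    using orthonormal_frame_transformation[OF norm1[OF Pc] fr(1,3)] by metis
  define b where "b = ?E \<bullet> cross3 (\<xi> P) ?A"
  have "b = \<xi> P \<bullet> cross3 ?A ?E" unfolding b_def by (simp add: cross3_simps)
  then have b: "b \<noteq> 0" using fr(6) by simp
  have tw0: "twist P \<noteq> 0" using twist_curl[OF P] fr(6) tw by auto
  have nA: "0 < norm ?A" using fr(3) by simp
  obtain C where C: "0 \<le> C"
    "\<And>s. \<bar>s\<bar> < S \<Longrightarrow> norm (sol 0 P s - P - s^2 *\<^sub>R ?A - s^3 *\<^sub>R ?E) \<le> C * s^4"
    using cusp_expansion[OF P(1)] by metis
  obtain C3 where C3: "\<And>s. \<bar>s\<bar> < S \<Longrightarrow> \<bar>(sol 0 P s - P) \<bullet> \<xi> P + (twist P / 5) * s^5\<bar> \<le> C3 * s^6"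
    using normal_coordinate_expansion[OF P] by metis
  have lin: "linear Q" using Q(1) by (rule orthogonal_transformation_linear)
  define R where "R s = sol 0 P s - P - s^2 *\<^sub>R ?A - s^3 *\<^sub>R ?E" for s
  have y: "sol 0 P s - P = R s + s^2 *\<^sub>R ?A + s^3 *\<^sub>R ?E" for s by (simp add: R_def)
  have bR: "\<bar>R s \<bullet> v\<bar> \<le> (C * norm v) * s^4" if "\<bar>s\<bar> < S" for s v
    using order_trans[OF Cauchy_Schwarz_ineq2 mult_right_mono[OF C(2)[OF that] norm_ge_zero[of v]]]
    by (simp add: R_def mult_ac)
  have t4: "s^4 \<le> \<bar>s\<bar>^3" if "\<bar>s\<bar> < S" for s
  proof -
    have "\<bar>s\<bar>^3 * \<bar>s\<bar> \<le> \<bar>s\<bar>^3 * 1" using that S by (intro mult_left_mono) auto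
    moreover have "\<bar>s\<bar>^3 * \<bar>s\<bar> = s^4" by (simp add: eval_nat_numeral abs_if)
    ultimately show ?thesis by simp
  qed
  have "type_235 (\<lambda>s. Q (sol 0 P s - P))"
    unfolding type_235_def
  proof (intro exI conjI)
    show "1 / norm ?A \<noteq> 0" "norm ?A / b \<noteq> 0" "- 5 / twist P \<noteq> 0" using nA b tw0 by auto
    have "(1 / norm ?A) * Q (sol 0 P s - P) $ 1 - s^2 = (1 / norm ?A)^2 * (R s \<bullet> ?A + s^3 * (?E \<bullet> ?A))" for s
    proof -
      have "norm ?A * Q (sol 0 P s - P) $ 1 = R s \<bullet> ?A + s^2 * (norm ?A)^2 + s^3 * (?E \<bullet> ?A)"
        unfolding Q(4) y by (simp add: inner_add_left power2_norm_eq_inner)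
      then have "Q (sol 0 P s - P) $ 1 = (R s \<bullet> ?A + s^2 * (norm ?A)^2 + s^3 * (?E \<bullet> ?A)) / norm ?A"
        using nA by (simp add: field_simps)
      then show ?thesis using nA by (simp add: field_simps power2_eq_square)
    qed
    moreover have "(\<lambda>s. (1 / norm ?A)^2 * (R s \<bullet> ?A + s^3 * (?E \<bullet> ?A))) \<in> O[at 0](\<lambda>t. t^3)"
    proof (rule bigo_power_at_0[OF S(1)])
      fix s assume s: "\<bar>s\<bar> < S"
      have "\<bar>R s \<bullet> ?A + s^3 * (?E \<bullet> ?A)\<bar> \<le> (C * norm ?A) * \<bar>s\<bar>^3 + \<bar>s\<bar>^3 * \<bar>?E \<bullet> ?A\<bar>"
        using abs_triangle_ineq[of "R s \<bullet> ?A" "s^3 * (?E \<bullet> ?A)"] order_trans[OF bR[OF s, of ?A] mult_left_mono[OF t4[OF s]]] C(1)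
        by (simp add: abs_mult power_abs)
      then have "(1 / norm ?A)^2 * \<bar>R s \<bullet> ?A + s^3 * (?E \<bullet> ?A)\<bar> \<le> (1 / norm ?A)^2 * ((C * norm ?A) * \<bar>s\<bar>^3 + \<bar>s\<bar>^3 * \<bar>?E \<bullet> ?A\<bar>)"
        by (rule mult_left_mono) simp
      then show "\<bar>(1 / norm ?A)^2 * (R s \<bullet> ?A + s^3 * (?E \<bullet> ?A))\<bar> \<le> ((1 / norm ?A)^2 * (C * norm ?A + \<bar>?E \<bullet> ?A\<bar>)) * \<bar>s\<bar>^3"
        unfolding abs_mult by (simp add: algebra_simps)
    qed
    ultimately show "(\<lambda>s. (1 / norm ?A) * Q (sol 0 P s - P) $ 1 - s^2) \<in> O[at 0](\<lambda>t. t^3)" by simp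
    have "(norm ?A / b) * Q (sol 0 P s - P) $ 2 - s^3 = (1 / b) * (R s \<bullet> cross3 (\<xi> P) ?A)" for s
    proof -
      have "norm ?A * Q (sol 0 P s - P) $ 2 = R s \<bullet> cross3 (\<xi> P) ?A + s^3 * b"
        unfolding Q(5) y by (simp add: inner_add_left dot_cross_self b_def)
      then show ?thesis using b by (simp add: field_simps)
    qed
    moreover have "(\<lambda>s. (1 / b) * (R s \<bullet> cross3 (\<xi> P) ?A)) \<in> O[at 0](\<lambda>t. t^4)"
    proof (rule bigo_power_at_0[OF S(1)])
      fix s assume s: "\<bar>s\<bar> < S"
      have "\<bar>1 / b\<bar> * \<bar>R s \<bullet> cross3 (\<xi> P) ?A\<bar> \<le> \<bar>1 / b\<bar> * ((C * norm (cross3 (\<xi> P) ?A)) * s^4)"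
        by (intro mult_left_mono bR s) simp
      then show "\<bar>(1 / b) * (R s \<bullet> cross3 (\<xi> P) ?A)\<bar> \<le> (\<bar>1 / b\<bar> * (C * norm (cross3 (\<xi> P) ?A))) * \<bar>s\<bar>^4"
        unfolding abs_mult by (simp add: mult_ac)
    qed
    ultimately show "(\<lambda>s. (norm ?A / b) * Q (sol 0 P s - P) $ 2 - s^3) \<in> O[at 0](\<lambda>t. t^4)" by simp
    have "(- 5 / twist P) * Q (sol 0 P s - P) $ 3 - s^5 = (- 5 / twist P) * ((sol 0 P s - P) \<bullet> \<xi> P + (twist P / 5) * s^5)" for s
      unfolding Q(6) using tw0 by (simp add: field_simps)
    moreover have "(\<lambda>s. (- 5 / twist P) * ((sol 0 P s - P) \<bullet> \<xi> P + (twist P / 5) * s^5)) \<in> O[at 0](\<lambda>t. t^6)"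
    proof (rule bigo_power_at_0[OF S(1)])
      fix s assume s: "\<bar>s\<bar> < S"
      have "\<bar>- 5 / twist P\<bar> * \<bar>(sol 0 P s - P) \<bullet> \<xi> P + (twist P / 5) * s^5\<bar> \<le> \<bar>- 5 / twist P\<bar> * (C3 * s^6)"
        by (intro mult_left_mono C3 s) simp
      then show "\<bar>(- 5 / twist P) * ((sol 0 P s - P) \<bullet> \<xi> P + (twist P / 5) * s^5)\<bar> \<le> (\<bar>- 5 / twist P\<bar> * C3) * \<bar>s\<bar>^6"
        unfolding abs_mult by (simp add: mult_ac)
    qed
    ultimately show "(\<lambda>s. (- 5 / twist P) * Q (sol 0 P s - P) $ 3 - s^5) \<in> O[at 0](\<lambda>t. t^6)" by simp
  qed
  moreover have "\<exists>c. Q v = c *\<^sub>R axis 1 1" if v: "asym_dir \<xi> P v" for v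
  proof -
    obtain c where "v = c *\<^sub>R dir0 \<xi> P"
      using v asym_dir_iff_lift_dir[OF xi_diff[OF Pc] c0[OF Pc] g0[OF Pc], of 0 v] P(2) by (auto simp: lift_dir_def)
    moreover have "dir0 \<xi> P = (- (grad K P \<bullet> dir0 \<xi> P)) *\<^sub>R ?A" using rate_dir0[OF P(1)] by (simp add: cuspA_def)
    ultimately have "v = (c * - (grad K P \<bullet> dir0 \<xi> P)) *\<^sub>R ?A" by (metis scaleR_scaleR)
    then have "Q v = ((c * - (grad K P \<bullet> dir0 \<xi> P)) * norm ?A) *\<^sub>R axis 1 1"
      using Q(3) by (simp add: linear_cmul[OF lin] linear_neg[OF lin])
    then show ?thesis by blast
  qed
  ultimately show ?thesis unfolding type_235_at_def using Q(1,2) by blast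
qed

text \<open>The two roots of the binary equation are \<open>dir0 \<plusminus> s dir1\<close>, which coincide for \<open>s = 0\<close>.\<close>

lemma cuspidal:
  assumes P: "P \<in> U" "K P = 0"
  shows "cuspidal_parabolic \<xi> W P"
proof -
  note Pc = U_sub(2)[OF P(1)]
  have A: "lift_dir \<xi> 0 P = dir0 \<xi> P" by (simp add: lift_dir_def)
  have "{v. asym_dir \<xi> P v} = {c *\<^sub>R dir0 \<xi> P | c. c \<noteq> 0}"
    using asym_dir_iff_lift_dir[OF xi_diff[OF Pc] c0[OF Pc] g0[OF Pc], of 0] P(2) A by auto
  moreover have "dir0 \<xi> P \<noteq> 0" using lift_dir_nonzero[of \<xi> 0 P] A by simp
  ultimately show ?thesis
    unfolding cuspidal_parabolic_def
    using mem_parabolic[OF Pc] P(2) vec_angle_not_right[OF rate_dir0[OF P(1)]] by blast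
qed

end

section \<open>The two foliations and the normal form\<close>

context cusp_box begin

lemma foliations_of_asymptotic_lines:
  assumes K0: "K 0 = 0"
  shows "\<exists>U X\<^sub>1 X\<^sub>2 \<F>\<^sub>1 \<F>\<^sub>2. open U \<and> 0 \<in> U \<and> U \<subseteq> W \<and>
        asym_foliation \<xi> (U \<inter> hyperbolic_set \<xi> W) X\<^sub>1 \<F>\<^sub>1 \<and>
        asym_foliation \<xi> (U \<inter> hyperbolic_set \<xi> W) X\<^sub>2 \<F>\<^sub>2 \<and>
        (\<forall>q\<in>U \<inter> hyperbolic_set \<xi> W.
           (\<forall>r. X\<^sub>1 q \<noteq> r *\<^sub>R X\<^sub>2 q) \<and>
           {v. asym_dir \<xi> q v} = {r *\<^sub>R X\<^sub>1 q | r. r \<noteq> 0} \<union> {r *\<^sub>R X\<^sub>2 q | r. r \<noteq> 0}) \<and>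
        (\<forall>P\<in>U \<inter> parabolic_set \<xi> W.
           cuspidal_parabolic \<xi> W P \<and>
           (\<exists>!L. L \<in> \<F>\<^sub>1 \<and> leaf_starts_at \<xi> W L P) \<and>
           (\<exists>!L. L \<in> \<F>\<^sub>2 \<and> leaf_starts_at \<xi> W L P) \<and>
           (\<forall>L\<^sub>1\<in>\<F>\<^sub>1. \<forall>L\<^sub>2\<in>\<F>\<^sub>2. leaf_starts_at \<xi> W L\<^sub>1 P \<and> leaf_starts_at \<xi> W L\<^sub>2 P \<longrightarrow>
              (\<exists>\<epsilon>>0. \<exists>\<gamma>. asym_param \<xi> W P \<epsilon> \<gamma> \<and>
                 same_germ P (insert P L\<^sub>1) (\<gamma> ` {0..<\<epsilon>}) \<and>
                 same_germ P (insert P L\<^sub>2) (\<gamma> ` {-\<epsilon><..0}) \<and>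
                 (curl \<xi> P \<bullet> \<xi> P \<noteq> 0 \<longrightarrow> type_235_at \<xi> P \<gamma>) \<and> cusp_230 P \<gamma>)))"
proof (rule exI[of _ U], rule exI[of _ "leaf_field 1"], rule exI[of _ "leaf_field (-1)"],
    rule exI[of _ "leaves 1"], rule exI[of _ "leaves (-1)"], intro conjI ballI)
  show "open U" by simp
  show "0 \<in> U" using u by simp
  show "U \<subseteq> W" using U_sub sub by blast
  show "asym_foliation \<xi> M (leaf_field 1) (leaves 1)" "asym_foliation \<xi> M (leaf_field (-1)) (leaves (-1))"
    by (rule asym_foliation_leaves, simp)+
next
  fix q assume q: "q \<in> M"
  note qN = MN[OF q]
  have qc: "q \<in> cball 0 r" using U_sub q by blast
  define s where "s = lev q"
  have s: "0 < s" "s < S" "K q = - (s^2)" using q lev[OF qN] unfolding M_eq s_def by (auto simp: lev_def)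
  define a b where "a = s * (- 2 / (grad K q \<bullet> lift_dir \<xi> s q))"
    and "b = - s * (- 2 / (grad K q \<bullet> lift_dir \<xi> (-s) q))"
  have ab: "a \<noteq> 0" "b \<noteq> 0" using rate0[OF qc, of s] rate0[OF qc, of "- s"] s by (auto simp: a_def b_def)
  have X1: "leaf_field 1 q = a *\<^sub>R lift_dir \<xi> s q" and X2: "leaf_field (-1) q = b *\<^sub>R lift_dir \<xi> (-s) q"
    by (simp_all add: leaf_field_def field_def lift_vel_def a_def b_def s_def)
  have "leaf_field 1 q \<noteq> c *\<^sub>R leaf_field (-1) q" for c
    unfolding X1 X2 scaleR_scaleR lift_dir_eq_iff[OF g0[OF qc]] using ab s by auto
  then show "\<forall>c. leaf_field 1 q \<noteq> c *\<^sub>R leaf_field (-1) q" by blast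
  have resc: "(\<exists>c. c \<noteq> 0 \<and> v = c *\<^sub>R w) \<longleftrightarrow> (\<exists>c. c \<noteq> 0 \<and> v = c *\<^sub>R (d *\<^sub>R w))" if "d \<noteq> 0" for d v and w :: "real^3"
  proof
    assume "\<exists>c. c \<noteq> 0 \<and> v = c *\<^sub>R w"
    then obtain c where "c \<noteq> 0" "v = c *\<^sub>R w" by blast
    then show "\<exists>c. c \<noteq> 0 \<and> v = c *\<^sub>R (d *\<^sub>R w)" using that by (intro exI[of _ "c / d"]) auto
  next
    assume "\<exists>c. c \<noteq> 0 \<and> v = c *\<^sub>R (d *\<^sub>R w)"
    then obtain c where "c \<noteq> 0" "v = c *\<^sub>R (d *\<^sub>R w)" by blast
    then show "\<exists>c. c \<noteq> 0 \<and> v = c *\<^sub>R w" using that by (intro exI[of _ "c * d"]) auto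
  qed
  have "asym_dir \<xi> q v \<longleftrightarrow> (\<exists>c. c \<noteq> 0 \<and> v = c *\<^sub>R leaf_field 1 q) \<or> (\<exists>c. c \<noteq> 0 \<and> v = c *\<^sub>R leaf_field (-1) q)" for v
    unfolding asym_dir_iff_lift_dir[OF xi_diff[OF qc] c0[OF qc] g0[OF qc] s(3)] X1 X2
      resc[OF ab(1), symmetric] resc[OF ab(2), symmetric] by blast
  then show "{v. asym_dir \<xi> q v} = {c *\<^sub>R leaf_field 1 q | c. c \<noteq> 0} \<union> {c *\<^sub>R leaf_field (-1) q | c. c \<noteq> 0}"
    by blast
next
  fix P assume "P \<in> U \<inter> parabolic_set \<xi> W"
  then have P: "P \<in> U" "K P = 0" using mem_parabolic U_sub by blast+
  show "cuspidal_parabolic \<xi> W P" by (rule cuspidal[OF P])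
  show "\<exists>!L. L \<in> leaves 1 \<and> leaf_starts_at \<xi> W L P" by (rule unique_leaf[OF P]) simp
  show "\<exists>!L. L \<in> leaves (-1) \<and> leaf_starts_at \<xi> W L P" by (rule unique_leaf[OF P]) simp
  fix L1 L2 assume L: "L1 \<in> leaves 1" "L2 \<in> leaves (-1)"
  show "leaf_starts_at \<xi> W L1 P \<and> leaf_starts_at \<xi> W L2 P \<longrightarrow>
    (\<exists>\<epsilon>>0. \<exists>\<gamma>. asym_param \<xi> W P \<epsilon> \<gamma> \<and> same_germ P (insert P L1) (\<gamma> ` {0..<\<epsilon>}) \<and>
      same_germ P (insert P L2) (\<gamma> ` {-\<epsilon><..0}) \<and>
      (curl \<xi> P \<bullet> \<xi> P \<noteq> 0 \<longrightarrow> type_235_at \<xi> P \<gamma>) \<and> cusp_230 P \<gamma>)"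
  proof
    assume st: "leaf_starts_at \<xi> W L1 P \<and> leaf_starts_at \<xi> W L2 P"
    obtain \<epsilon> where \<epsilon>: "0 < \<epsilon>" "\<bar>1\<bar> * \<epsilon> \<le> S" "asym_param \<xi> W P \<epsilon> (\<lambda>t. sol 0 P (1 * t))"
      using asym_param_curve[OF P, of 1] by auto
    have h: "same_germ P (half P e S) (half P e \<epsilon>)" if "\<bar>e\<bar> = 1" for e
      using half_germ[OF P that] S \<epsilon> by simp
    have im: "sol 0 P ` {0..<\<epsilon>} = half P 1 \<epsilon>" "sol 0 P ` {-\<epsilon><..0} = half P (-1) \<epsilon>"
      using half_reparam[of 1 P \<epsilon>] by simp_all
    have "same_germ P (insert P L1) (sol 0 P ` {0..<\<epsilon>})"
      unfolding im using same_germ_trans[OF leaf_germ(2)[OF P _ L(1)] h] st by simp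
    moreover have "same_germ P (insert P L2) (sol 0 P ` {-\<epsilon><..0})"
      unfolding im using same_germ_trans[OF leaf_germ(2)[OF P _ L(2)] h] st by simp
    moreover have "cusp_230 P (sol 0 P)" using cusp_230_curve[OF P(1), of 1] by simp
    ultimately show "\<exists>\<epsilon>>0. \<exists>\<gamma>. asym_param \<xi> W P \<epsilon> \<gamma> \<and> same_germ P (insert P L1) (\<gamma> ` {0..<\<epsilon>}) \<and>
      same_germ P (insert P L2) (\<gamma> ` {-\<epsilon><..0}) \<and>
      (curl \<xi> P \<bullet> \<xi> P \<noteq> 0 \<longrightarrow> type_235_at \<xi> P \<gamma>) \<and> cusp_230 P \<gamma>"
      using \<epsilon> type_235_at_curve[OF P] by (intro exI[of _ \<epsilon>] conjI exI[of _ "sol 0 P"]) auto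
  qed
qed

text \<open>At \<open>0\<close> the vectors \<open>dir0\<close> and \<open>dir1\<close> are \<open>(1, 0, 0)\<close> and \<open>(0, 1/g, 0)\<close>, and \<open>\<xi>\<close> is the third axis.\<close>

lemma normal_form_coordinates:
  assumes K0: "K 0 = 0" and \<xi>0: "\<xi> 0 = vector [0, 0, 1]" and f0: "f_coeff \<xi> 0 = 0"
  defines "\<I> \<equiv> grad K 0 $ 1" and "g \<equiv> g_coeff \<xi> 0" and "\<R> \<equiv> curl \<xi> 0 \<bullet> \<xi> 0"
  obtains C1 C2 C3 where
    "\<And>s. \<bar>s\<bar> < S \<Longrightarrow> \<bar>sol 0 0 s $ 1 + (1 / \<I>) * s^2\<bar> \<le> C1 * \<bar>s\<bar>^3"
    "\<And>s. \<bar>s\<bar> < S \<Longrightarrow> \<bar>sol 0 0 s $ 2 + (2 / (3 * \<I> * g)) * s^3\<bar> \<le> C2 * \<bar>s\<bar>^4"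
    "\<And>s. \<bar>s\<bar> < S \<Longrightarrow> \<bar>sol 0 0 s $ 3 + (\<R> / (15 * \<I>^2 * g)) * s^5\<bar> \<le> C3 * \<bar>s\<bar>^6"
proof -
  have P: "0 \<in> U" using u by simp
  have d0: "dir0 \<xi> 0 = vector [1, 0, 0]" and d1: "dir1 \<xi> 0 = vector [0, 1 / g, 0]"
    by (simp_all add: dir0_def dir1_def f0 \<xi>0 g_def)
  have gd: "grad K 0 \<bullet> dir0 \<xi> 0 = \<I>" by (simp add: d0 inner_vec_def sum_3 \<I>_def)
  have A: "cuspA 0 $ 1 = - 1 / \<I>" "cuspA 0 $ 2 = 0"
    unfolding cuspA_def gd by (simp_all add: d0)
  have E: "cuspE 0 $ 2 = - 2 / (3 * \<I> * g)"
    unfolding cuspE_def gd by (simp add: d0 d1)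
  have inner: "v \<bullet> \<xi> 0 = v $ 3" for v by (simp add: \<xi>0 inner_vec_def sum_3)
  have vol: "\<xi> 0 \<bullet> cross3 (cuspA 0) (cuspE 0) = 2 / (3 * \<I>^2 * g)"
    unfolding inner_commute[of "\<xi> 0"] inner by (simp add: cross3_def A E power2_eq_square)
  have tw: "twist 0 / 5 = \<R> / (15 * \<I>^2 * g)"
  proof -
    have "2 * twist 0 = 2 * (\<R> / (3 * \<I>^2 * g))"
      using twist_curl[OF P K0] vol by (simp add: \<R>_def)
    then have "twist 0 = \<R> / (3 * \<I>^2 * g)" by (rule mult_left_cancel[THEN iffD1, rotated]) simp
    then show ?thesis by simp
  qed
  obtain C where C: "0 \<le> C"
    "\<And>s. \<bar>s\<bar> < S \<Longrightarrow> norm (sol 0 0 s - 0 - s^2 *\<^sub>R cuspA 0 - s^3 *\<^sub>R cuspE 0) \<le> C * s^4"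
    using cusp_expansion[OF P] by metis
  obtain C3 where C3: "\<And>s. \<bar>s\<bar> < S \<Longrightarrow> \<bar>(sol 0 0 s - 0) \<bullet> \<xi> 0 + (twist 0 / 5) * s^5\<bar> \<le> C3 * s^6"
    using normal_coordinate_expansion[OF P K0] by metis
  have comp: "\<bar>sol 0 0 s $ i - s^2 * cuspA 0 $ i - s^3 * cuspE 0 $ i\<bar> \<le> C * s^4" if "\<bar>s\<bar> < S" for s i
    using order_trans[OF component_le_norm_cart C(2)[OF that], of i] by simp
  have 1: "\<bar>sol 0 0 s $ 1 + (1 / \<I>) * s^2\<bar> \<le> (C + \<bar>cuspE 0 $ 1\<bar>) * \<bar>s\<bar>^3" if s: "\<bar>s\<bar> < S" for s
  proof -
    have "\<bar>s\<bar>^3 * \<bar>s\<bar> \<le> \<bar>s\<bar>^3 * 1" using s S by (intro mult_left_mono) auto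
    moreover have "\<bar>s\<bar>^3 * \<bar>s\<bar> = s^4" by (simp add: eval_nat_numeral abs_if)
    ultimately have "C * s^4 \<le> C * \<bar>s\<bar>^3" using C(1) by (intro mult_left_mono) auto
    moreover have "\<bar>s^3 * cuspE 0 $ 1\<bar> = \<bar>cuspE 0 $ 1\<bar> * \<bar>s\<bar>^3" by (simp add: abs_mult power_abs)
    ultimately show ?thesis using comp[OF s, of 1] unfolding A by (simp add: algebra_simps)
  qed
  have 2: "\<bar>sol 0 0 s $ 2 + (2 / (3 * \<I> * g)) * s^3\<bar> \<le> C * \<bar>s\<bar>^4" if s: "\<bar>s\<bar> < S" for s
    using comp[OF s, of 2] unfolding A E by (simp add: mult.commute)
  have 3: "\<bar>sol 0 0 s $ 3 + (\<R> / (15 * \<I>^2 * g)) * s^5\<bar> \<le> C3 * \<bar>s\<bar>^6" if s: "\<bar>s\<bar> < S" for s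
    using C3[OF s] unfolding inner tw by simp
  show thesis by (rule that[OF 1 2 3])
qed

end

lemma bigo_power_rescaled:
  fixes h :: "real \<Rightarrow> real"
  assumes "0 < S" "\<mu> \<noteq> 0" "\<And>s. \<bar>s\<bar> < S \<Longrightarrow> \<bar>h s\<bar> \<le> C * \<bar>s\<bar>^n"
  shows "(\<lambda>t. h (\<mu> * t)) \<in> O[at 0](\<lambda>t. t^n)"
proof (rule bigo_power_at_0[where \<epsilon> = "S / \<bar>\<mu>\<bar>" and C = "C * \<bar>\<mu>\<bar>^n"])
  fix t assume "\<bar>t\<bar> < S / \<bar>\<mu>\<bar>"
  then have "\<bar>\<mu> * t\<bar> < S" using assms(2) by (simp add: abs_mult pos_less_divide_eq mult.commute)
  from assms(3)[OF this] show "\<bar>h (\<mu> * t)\<bar> \<le> C * \<bar>\<mu>\<bar>^n * \<bar>t\<bar>^n"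
    by (simp add: abs_mult power_mult_distrib mult.assoc)
qed (use assms in simp)

lemma powr_thirds:
  assumes "(x::real) > 0"
  shows "x powr (2/3) = (root 3 x)^2" "x powr (4/3) = (root 3 x)^4" "x powr (7/3) = (root 3 x)^7"
  using assms by (simp_all add: root_powr_inverse powr_power)

text \<open>The value of \<open>\<mu>\<close> is forced by the second identity, which normalises the second coordinate to \<open>t\<^sup>3\<close>:
  with \<open>g = \<I> / (2 a)\<close> it says \<open>\<mu>\<^sup>3 = - 3 \<I>\<^sup>2 / (4 a)\<close>. The real cube roots are used because \<open>\<I>\<close> and \<open>a\<close> may be negative.\<close>

lemma cusp_constants:
  fixes \<I> a g :: real
  assumes nz: "\<I> \<noteq> 0" "a \<noteq> 0" and I: "\<I> = 2 * a * g"
  defines "\<mu> \<equiv> - ((root 3 3 * (root 3 \<I>)^2) / ((root 3 2)^2 * root 3 a))"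
  shows "\<mu> \<noteq> 0" "2 / (3 * \<I> * g) * \<mu>^3 = -1"
    "1 / \<I> * \<mu>^2 = 3 powr (2/3) * root 3 \<I> / (2 powr (4/3) * (root 3 a)^2)"
    "R / (15 * \<I>^2 * g) * \<mu>^5 = - (3 powr (2/3) * root 3 \<I> * R / (2 powr (7/3) * 5 * (root 3 a)^2))"
proof -
  define x y p q where "x = root 3 \<I>" and "y = root 3 a" and "p = root 3 (3::real)" and "q = root 3 (2::real)"
  have cubes: "x^3 = \<I>" "y^3 = a" "p^3 = 3" "q^3 = 2"
    by (simp_all add: x_def y_def p_def q_def odd_real_root_pow)
  have nz': "x \<noteq> 0" "y \<noteq> 0" "p \<noteq> 0" "q \<noteq> 0" using nz by (simp_all add: x_def y_def p_def q_def)
  have mu: "\<mu> = - (p * x^2 / (q^2 * y))" by (simp add: \<mu>_def x_def y_def p_def q_def)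
  show "\<mu> \<noteq> 0" using nz' by (simp add: mu)
  have g: "g = x^3 / (q^3 * y^3)" using I nz by (simp add: cubes field_simps)
  have m3: "\<mu>^3 = - (p^3 * x^6 / (q^6 * y^3))" by (simp add: mu power_divide power_mult_distrib flip: power_mult)
  have m2: "\<mu>^2 = p^2 * x^4 / (q^4 * y^2)" by (simp add: mu power_divide power_mult_distrib flip: power_mult)
  have m5: "\<mu>^5 = - (p^5 * x^10 / (q^10 * y^5))" by (simp add: mu power_divide power_mult_distrib flip: power_mult)
  have "2 / (3 * \<I> * g) * \<mu>^3 = q^3 / (p^3 * x^3 * g) * \<mu>^3" by (simp only: cubes)
  also have "\<dots> = -1" unfolding g m3 using nz' by (simp add: field_simps flip: power_add)
  finally show "2 / (3 * \<I> * g) * \<mu>^3 = -1" .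
  have "1 / \<I> * \<mu>^2 = 1 / x^3 * \<mu>^2" by (simp only: cubes)
  also have "\<dots> = p^2 * x / (q^4 * y^2)" unfolding m2 using nz' by (simp add: eval_nat_numeral)
  also have "\<dots> = 3 powr (2/3) * root 3 \<I> / (2 powr (4/3) * (root 3 a)^2)"
    by (simp add: powr_thirds x_def y_def p_def q_def)
  finally show "1 / \<I> * \<mu>^2 = 3 powr (2/3) * root 3 \<I> / (2 powr (4/3) * (root 3 a)^2)" .
  have "R / (15 * \<I>^2 * g) * \<mu>^5 = R / (5 * p^3 * (x^3)^2 * g) * \<mu>^5" by (simp add: cubes)
  also have "\<dots> = - (p^2 * x * R / (q^7 * 5 * y^2))"
    unfolding g m5 using nz' by (simp add: eval_nat_numeral mult_ac)
  also have "\<dots> = - (3 powr (2/3) * root 3 \<I> * R / (2 powr (7/3) * 5 * (root 3 a)^2))"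
    by (simp add: powr_thirds x_def y_def p_def q_def)
  finally show "R / (15 * \<I>^2 * g) * \<mu>^5 = - (3 powr (2/3) * root 3 \<I> * R / (2 powr (7/3) * 5 * (root 3 a)^2))" .
qed

section \<open>A neighbourhood on which the lifted field is Lipschitz\<close>

lemma lip_bd_on_vec3:
  fixes f :: "'a::metric_space \<Rightarrow> real^3"
  assumes "\<And>i. lip_bd_on Z (\<lambda>x. f x $ i)"
  shows "lip_bd_on Z f"
proof -
  have "lip_bd_on Z (\<lambda>x. f x $ 1 *\<^sub>R axis 1 1 + f x $ 2 *\<^sub>R axis 2 1 + f x $ 3 *\<^sub>R (axis 3 1 :: real^3))"
    by (intro lip_bd_on_add lip_bd_on_scaleR lip_bd_on_const assms)
  moreover have "f x $ 1 *\<^sub>R axis 1 1 + f x $ 2 *\<^sub>R axis 2 1 + f x $ 3 *\<^sub>R axis 3 1 = f x" for x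
    by (simp add: vec_eq_iff forall_3 axis_def)
  ultimately show ?thesis by simp
qed

lemma lip_bd_on_vector3:
  assumes "lip_bd_on Z f" "lip_bd_on Z g" "lip_bd_on Z h"
  shows "lip_bd_on Z (\<lambda>x. vector [f x, g x, h x] :: real^3)"
proof (rule lip_bd_on_vec3)
  show "lip_bd_on Z (\<lambda>x. (vector [f x, g x, h x] :: real^3) $ i)" for i
    using exhaust_3[of i] assms by auto
qed

text \<open>Along the segment from \<open>p\<close> to \<open>q\<close> the derivative of the remainder is bounded by the Lipschitz constant of
  the gradient times the length of the segment.\<close>

lemma taylor_bound_from_lipschitz_gradient:
  fixes h :: "real^3 \<Rightarrow> real"
  assumes der: "\<And>p. p \<in> cball a r \<Longrightarrow> (h has_derivative (\<lambda>v. grad h p \<bullet> v)) (at p)"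
    and lip: "lip_bd_on (cball a r) (grad h)"
  shows "\<exists>C\<ge>0. \<forall>p\<in>cball a r. \<forall>q\<in>cball a r. \<bar>h q - h p - grad h p \<bullet> (q - p)\<bar> \<le> C * norm (q - p)^2"
proof -
  from lip obtain L where L: "0 \<le> L" "\<And>x y. x \<in> cball a r \<Longrightarrow> y \<in> cball a r \<Longrightarrow> norm (grad h x - grad h y) \<le> L * dist x y"
    unfolding lip_bd_on_def by blast
  have "\<bar>h q - h p - grad h p \<bullet> (q - p)\<bar> \<le> L * norm (q - p)^2" if p: "p \<in> cball a r" and q: "q \<in> cball a r" for p q
  proof -
    have sub: "closed_segment p q \<subseteq> cball a r" using p q by (intro closed_segment_subset) auto
    have "norm ((h q - grad h p \<bullet> q) - (h p - grad h p \<bullet> p)) \<le> (L * norm (q - p)) * norm (q - p)"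
    proof (rule differentiable_bound[where S = "closed_segment p q" and f' = "\<lambda>x v. (grad h x - grad h p) \<bullet> v"])
      fix x assume x: "x \<in> closed_segment p q"
      then have xb: "x \<in> cball a r" using sub by blast
      show "((\<lambda>x. h x - grad h p \<bullet> x) has_derivative (\<lambda>v. (grad h x - grad h p) \<bullet> v)) (at x within closed_segment p q)"
        by (rule has_derivative_at_withinI) (use der[OF xb] in \<open>auto intro!: derivative_eq_intros simp: inner_diff_left\<close>)
      have "onorm (\<lambda>v. (grad h x - grad h p) \<bullet> v) \<le> norm (grad h x - grad h p)"
        by (rule onorm_bound) (auto simp: Cauchy_Schwarz_ineq2)
      also have "\<dots> \<le> L * dist x p" by (rule L(2)[OF xb p])
      also have "dist x p \<le> norm (q - p)" using segment_bound(1)[OF x] by (simp add: dist_norm)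
      finally show "onorm (\<lambda>v. (grad h x - grad h p) \<bullet> v) \<le> L * norm (q - p)" using L(1) by (simp add: mult_left_mono)
    qed auto
    then show ?thesis by (simp add: inner_diff_right power2_eq_square algebra_simps)
  qed
  then show ?thesis using L(1) by blast
qed

lemma Ck_on_2_grad_lip:
  assumes "Ck_on 2 h V" "cball a r \<subseteq> V"
  shows "lip_bd_on (cball a r) (grad h)"
proof (rule lip_bd_on_vec3)
  have "Ck_on (Suc 1) h V" using assms(1) by (simp add: numeral_2_eq_2)
  then have Ck: "Ck_on 1 (pd i h) V" for i by (rule Ck_on_pd)
  have "(\<lambda>p. grad h p $ i) = pd i h" for i by (simp add: grad_def fun_eq_iff)
  then show "lip_bd_on (cball a r) (\<lambda>p. grad h p $ i)" for i
    using Ck_on_imp_lip_bd_on[OF Ck assms(2)] by metis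
qed

text \<open>The coefficients and \<open>\<K>\<close> are of class \<open>C\<^sup>2\<close>, being built from first derivatives of a \<open>C\<^sup>3\<close> field, so
  \<open>\<nabla>\<K>\<close> is \<open>C\<^sup>1\<close> and the lifted velocity is Lipschitz near \<open>(0, 0)\<close>. The time bound \<open>S\<close> is chosen after the bound and the
  Lipschitz constant of the lifted velocity, and \<open>u\<close> after \<open>S\<close>.\<close>

lemma cusp_box_exists:
  fixes \<xi> :: "real^3 \<Rightarrow> real^3"
  assumes W: "open W" "0 \<in> W" and \<xi>: "Ck_on 3 \<xi> W" and n1: "\<forall>p\<in>W. norm (\<xi> p) = 1"
    and c: "\<xi> 0 $ 3 \<noteq> 0" and g: "g_coeff \<xi> 0 \<noteq> 0" and K0: "KK \<xi> 0 = 0"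
    and Kx: "grad (KK \<xi>) 0 $ 1 \<noteq> 0" and rate: "grad (KK \<xi>) 0 \<bullet> dir0 \<xi> 0 \<noteq> 0"
  shows "\<exists>r S \<Lambda> \<beta> \<kappa> u. cusp_box \<xi> W r S \<Lambda> \<beta> \<kappa> u"
proof -
  have open_neq: "open {p \<in> V. f p \<noteq> 0}" if "open V" "continuous_on V f" for V and f :: "real^3 \<Rightarrow> real"
  proof -
    have "open (V \<inter> f -` (- {0}))" using that by (intro continuous_open_preimage) auto
    then show ?thesis by (simp add: Int_def vimage_def)
  qed
  have Ck0: "continuous_on V f" if "Ck_on 2 f V" for V and f :: "real^3 \<Rightarrow> real"
    using Ck_on_le[OF that, of 0] by simp
  have \<xi>1: "Ck_on (Suc 2) \<xi> W" using \<xi> by (simp add: eval_nat_numeral)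
  define W1 where "W1 = {p \<in> W. \<xi> p $ 3 \<noteq> 0}"
  have W1: "open W1" unfolding W1_def
    using open_neq[OF W(1) Ck0[OF Ck_on_SucD[OF Ck_on_nth[OF W(1) \<xi>1]]]] .
  have \<xi>W1: "Ck_on (Suc 2) \<xi> W1" by (rule Ck_on_subset[OF \<xi>1]) (auto simp: W1_def)
  have c1: "\<xi> p $ 3 \<noteq> 0" if "p \<in> W1" for p using that by (simp add: W1_def)
  have C1: "Ck_on 2 (e_coeff \<xi>) W1" "Ck_on 2 (f_coeff \<xi>) W1" "Ck_on 2 (g_coeff \<xi>) W1" "Ck_on 2 (KK \<xi>) W1"
    "Ck_on 2 (\<lambda>p. \<xi> p $ 1 / \<xi> p $ 3) W1" "Ck_on 2 (\<lambda>p. \<xi> p $ 2 / \<xi> p $ 3) W1"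
    by (rule Ck_on_coeffs[OF W1 \<xi>W1 c1]; assumption)+
  define W2 where "W2 = {p \<in> W1. g_coeff \<xi> p \<noteq> 0}"
  have W2: "open W2" unfolding W2_def by (rule open_neq[OF W1 Ck0[OF C1(3)]])
  have "Ck_on (Suc 1) (KK \<xi>) W2"
    using Ck_on_subset[OF C1(4), of W2] by (simp add: W2_def subset_iff numeral_2_eq_2)
  then have "Ck_on 1 (pd 1 (KK \<xi>)) W2" by (rule Ck_on_pd)
  then have "continuous_on W2 (pd 1 (KK \<xi>))" using Ck_on_SucD[of 0] by simp
  then have cKx: "continuous_on W2 (\<lambda>p. grad (KK \<xi>) p $ 1)" by (simp add: grad_def)
  define W3 where "W3 = {p \<in> W2. grad (KK \<xi>) p $ 1 \<noteq> 0}"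
  have W3: "open W3" unfolding W3_def by (rule open_neq[OF W2 cKx])
  have sub: "W3 \<subseteq> W1" "W3 \<subseteq> W2" "W3 \<subseteq> W" by (auto simp: W3_def W2_def W1_def)
  have "0 \<in> W3" using W(2) c g Kx by (simp add: W3_def W2_def W1_def)
  then obtain r0 where r0: "r0 > 0" "cball 0 r0 \<subseteq> W3" using W3 open_contains_cball by blast
  note C3 = C1[THEN Ck_on_subset, OF sub(1)]
  have g3: "g_coeff \<xi> p \<noteq> 0" if "p \<in> W3" for p using that by (simp add: W3_def W2_def)
  let ?B = "cball (0 :: real^3) r0"
  have lip: "lip_bd_on ?B f" if "Ck_on 2 f W3" for f :: "real^3 \<Rightarrow> real"
  proof -
    have "Ck_on 1 f W3" by (rule Ck_on_le[OF that]) simp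
    then show ?thesis by (rule Ck_on_imp_lip_bd_on[OF _ r0(2)])
  qed
  have fg: "lip_bd_on ?B (\<lambda>p. f_coeff \<xi> p / g_coeff \<xi> p)" "lip_bd_on ?B (\<lambda>p. 1 / g_coeff \<xi> p)"
    by (intro lip Ck_on_divide[OF W3] Ck_on_const C3 g3; assumption)+
  note ab = lip[OF C3(5)] lip[OF C3(6)]
  have neg: "lip_bd_on Z (\<lambda>p. - h p)" if "lip_bd_on Z h" for Z and h :: "real^3 \<Rightarrow> real"
    using lip_bd_on_diff[OF lip_bd_on_const[of Z 0] that] by simp
  have d0: "lip_bd_on ?B (dir0 \<xi>)" and d1: "lip_bd_on ?B (dir1 \<xi>)"
    unfolding dir0_def[abs_def] dir1_def[abs_def]
    by (intro lip_bd_on_vector3 lip_bd_on_const lip_bd_on_add lip_bd_on_mult neg fg ab)+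
  have gK: "lip_bd_on ?B (grad (KK \<xi>))" by (rule Ck_on_2_grad_lip[OF C3(4) r0(2)])
  define Z where "Z = {-1..1::real} \<times> ?B"
  have snd_lip: "lip_bd_on Z (\<lambda>z. h (snd z))" if "lip_bd_on ?B h" for h :: "real^3 \<Rightarrow> 'b::real_normed_vector"
    by (rule lip_bd_on_compose[OF that]) (auto simp: Z_def dist_snd_le)
  have fst_lip: "lip_bd_on Z fst"
  proof (rule lip_bd_onI[of _ _ 1 1])
    show "norm (fst x) \<le> 1" if "x \<in> Z" for x using that by (auto simp: Z_def)
    show "norm (fst x - fst y) \<le> 1 * dist x y" for x y :: "real \<times> (real^3)"
      unfolding dist_norm[symmetric] mult_1 by (rule dist_fst_le)
  qed
  have ld: "lip_bd_on Z (\<lambda>z. lift_dir \<xi> (fst z) (snd z))"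
    unfolding lift_dir_def by (intro lip_bd_on_add lip_bd_on_scaleR fst_lip snd_lip d0 d1)
  let ?rate = "\<lambda>z. grad (KK \<xi>) (snd z) \<bullet> lift_dir \<xi> (fst z) (snd z)"
  have lr: "lip_bd_on Z ?rate" by (intro lip_bd_on_inner snd_lip gK ld)
  define d where "d = \<bar>?rate (0, 0)\<bar> / 2"
  have d: "d > 0" using rate by (simp add: d_def lift_dir_def)
  have Z0: "(0, 0) \<in> Z" using r0 by (simp add: Z_def)
  obtain \<epsilon> where \<epsilon>: "\<epsilon> > 0" "\<And>z. z \<in> Z \<Longrightarrow> dist z (0, 0) < \<epsilon> \<Longrightarrow> dist (?rate z) (?rate (0, 0)) < d"
    using lip_bd_on_imp_continuous_on[OF lr] Z0 d unfolding continuous_on_iff by metis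
  define r where "r = min r0 (\<epsilon> / 3)"
  define S1 where "S1 = min 1 (\<epsilon> / 3)"
  define Z' where "Z' = {-S1..S1} \<times> cball (0 :: real^3) r"
  have r: "0 < r" "r \<le> r0" and S1: "0 < S1" "S1 \<le> 1" using r0 \<epsilon> by (auto simp: r_def S1_def)
  have ZZ: "Z' \<subseteq> Z" using r S1 by (auto simp: Z_def Z'_def)
  have low: "d \<le> \<bar>?rate z\<bar>" if z: "z \<in> Z'" for z
  proof -
    have "dist z (0, 0) \<le> \<bar>fst z\<bar> + norm (snd z)"
      using norm_Pair_le[of "fst z" "snd z"] by (simp add: dist_norm zero_prod_def[symmetric])
    also have "\<dots> \<le> \<epsilon> / 3 + \<epsilon> / 3" using z by (intro add_mono) (auto simp: Z'_def S1_def r_def)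
    also have "\<dots> < \<epsilon>" using \<epsilon> by simp
    finally have "dist (?rate z) (?rate (0, 0)) < d" using \<epsilon>(2) z ZZ by blast
    then show ?thesis unfolding d_def dist_real_def by linarith
  qed
  have "lip_bd_on Z' (\<lambda>z. (- 2 * inverse (?rate z)) *\<^sub>R lift_dir \<xi> (fst z) (snd z))"
    by (intro lip_bd_on_scaleR lip_bd_on_mult lip_bd_on_const
      lip_bd_on_inverse[OF lip_bd_on_subset[OF lr ZZ] d low] lip_bd_on_subset[OF ld ZZ])
  then have lv: "lip_bd_on Z' (\<lambda>z. lift_vel \<xi> (fst z) (snd z))"
    by (simp add: lift_vel_def divide_inverse)
  then obtain L where L: "0 \<le> L" "\<And>z. z \<in> Z' \<Longrightarrow> norm (lift_vel \<xi> (fst z) (snd z)) \<le> L"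
    "\<And>z z'. z \<in> Z' \<Longrightarrow> z' \<in> Z' \<Longrightarrow> norm (lift_vel \<xi> (fst z) (snd z) - lift_vel \<xi> (fst z') (snd z')) \<le> L * dist z z'"
    unfolding lip_bd_on_def by blast
  define S where "S = min S1 (min (1 / (4 * L + 1)) (r / (4 * L + 1)))"
  have S: "0 < S" "S \<le> S1" "S \<le> 1" using S1 r L(1) by (auto simp: S_def)
  have "4 * L * S \<le> (4 * L + 1) * (1 / (4 * L + 1))" "4 * L * S \<le> (4 * L + 1) * (r / (4 * L + 1))"
    using L(1) S by (intro mult_mono; simp add: S_def)+
  then have S': "4 * L * S \<le> 1" "4 * L * S \<le> r" using L(1) by simp_all
  have ball_sub: "cball 0 r \<subseteq> ?B" "cball 0 r \<subseteq> W3" using r r0 by auto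
  have dn: "(h has_derivative (\<lambda>v. grad h p \<bullet> v)) (at p)" if "Ck_on 2 h W3" "p \<in> cball 0 r" for h p
    using that ball_sub Ck_on_le[OF that(1), of 1] by (intro has_derivative_grad) auto
  have n3: "Ck_on 2 (\<lambda>p. \<xi> p $ j) W3" for j
    using Ck_on_SucD[OF Ck_on_nth[OF W1 \<xi>W1, of j]] sub(1) by (rule Ck_on_subset)
  have dxi: "\<xi> differentiable (at p)" if "p \<in> cball 0 r" for p
  proof -
    have "p \<in> W" using that ball_sub sub by blast
    then show ?thesis using Ck_on_le[OF \<xi>1, of 1] by simp
  qed
  have "\<exists>C\<ge>0. \<forall>p\<in>cball 0 r. \<forall>q\<in>cball 0 r. \<bar>\<xi> q $ j - \<xi> p $ j - grad (\<lambda>p. \<xi> p $ j) p \<bullet> (q - p)\<bar> \<le> C * norm (q - p)^2" for j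
    by (rule taylor_bound_from_lipschitz_gradient[OF dn[OF n3] Ck_on_2_grad_lip[OF n3 ball_sub(2)]])
  then obtain T where T: "\<And>j. T j \<ge> 0" "\<And>j p q. p \<in> cball 0 r \<Longrightarrow> q \<in> cball 0 r \<Longrightarrow>
    \<bar>\<xi> q $ j - \<xi> p $ j - grad (\<lambda>p. \<xi> p $ j) p \<bullet> (q - p)\<bar> \<le> T j * norm (q - p)^2" by metis
  have taylor: "norm (\<xi> q - \<xi> p - frechet_derivative \<xi> (at p) (q - p)) \<le> (\<Sum>j\<in>UNIV. T j) * norm (q - p)^2"
    if pq: "p \<in> cball 0 r" "q \<in> cball 0 r" for p q
  proof -
    have "norm (\<xi> q - \<xi> p - frechet_derivative \<xi> (at p) (q - p))
      \<le> (\<Sum>j\<in>UNIV. \<bar>(\<xi> q - \<xi> p - frechet_derivative \<xi> (at p) (q - p)) $ j\<bar>)" by (rule norm_le_l1_cart)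
    also have "\<dots> \<le> (\<Sum>j\<in>UNIV. T j * norm (q - p)^2)"
      using T(2)[OF pq] by (intro sum_mono) (simp add: frechet_derivative_nth[OF dxi[OF pq(1)]])
    finally show ?thesis by (simp add: sum_distrib_right)
  qed
  have "isCont (KK \<xi>) 0"
    using has_derivative_continuous[OF dn[OF C3(4)]] r by simp
  then obtain \<delta> where \<delta>: "\<delta> > 0" "\<And>p. dist p 0 < \<delta> \<Longrightarrow> dist (KK \<xi> p) (KK \<xi> 0) < S^2"
    using S(1) unfolding continuous_at_eps_delta by (metis zero_less_power)
  define u where "u = min \<delta> (r / 2)"
  have "cusp_box \<xi> W r S L L (\<Sum>j\<in>UNIV. T j) u"
  proof
    show "0 < r" "0 < S" "S \<le> 1" "4 * L * S \<le> 1" "4 * L * S \<le> r" "0 \<le> L" by (fact r S S' L(1))+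
    show "0 \<le> (\<Sum>j\<in>UNIV. T j)" using T(1) by (rule sum_nonneg)
    show "0 < u" "u \<le> r / 2" using \<delta> r by (auto simp: u_def)
    show "\<bar>KK \<xi> p\<bar> < S^2" if "p \<in> ball 0 u" for p
      using \<delta>(2)[of p] that K0 by (simp add: u_def dist_real_def dist_commute)
    show "cball 0 r \<subseteq> W" using ball_sub sub by blast
    show "continuous_on (cball 0 r) (grad (KK \<xi>))"
      using lip_bd_on_imp_continuous_on[OF gK] ball_sub(1) by (rule continuous_on_subset)
    fix p assume p: "p \<in> cball (0 :: real^3) r"
    then have p3: "p \<in> W3" using ball_sub by blast
    show "\<xi> p $ 3 \<noteq> 0" using p3 sub c1 by blast
    show "g_coeff \<xi> p \<noteq> 0" by (rule g3[OF p3])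
    show "norm (\<xi> p) = 1" using n1 p3 sub by blast
    show "(KK \<xi> has_derivative (\<lambda>v. grad (KK \<xi>) p \<bullet> v)) (at p)" by (rule dn[OF C3(4) p])
    show "grad (KK \<xi>) p $ 1 \<noteq> 0" using p3 by (simp add: W3_def)
    show "\<xi> differentiable (at p)" by (rule dxi[OF p])
    show "norm (\<xi> q - \<xi> p - frechet_derivative \<xi> (at p) (q - p)) \<le> (\<Sum>j\<in>UNIV. T j) * norm (q - p)^2"
      if "q \<in> cball 0 r" for q by (rule taylor[OF p that])
    have inZ: "(s, q) \<in> Z'" if "\<bar>s\<bar> \<le> S" "q \<in> cball 0 r" for s q using that S by (auto simp: Z'_def)
    fix s :: real assume s: "\<bar>s\<bar> \<le> S"
    show "grad (KK \<xi>) p \<bullet> lift_dir \<xi> s p \<noteq> 0" using low[OF inZ[OF s p]] d by auto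
    show "norm (lift_vel \<xi> s p) \<le> L" using L(2)[OF inZ[OF s p]] by simp
    show "norm (lift_vel \<xi> s p - lift_vel \<xi> s' p') \<le> L * dist (s, p) (s', p')"
      if "p' \<in> cball 0 r" "\<bar>s'\<bar> \<le> S" for p' s'
      using L(3)[OF inZ[OF s p] inZ[OF that(2,1)]] by simp
  qed
  then show ?thesis by blast
qed

section \<open>Asymptotic lines near a cuspidal parabolic point\<close>

theorem theorem3p2:
  fixes \<xi> :: "real^3 \<Rightarrow> real^3" and W :: "(real^3) set" and k :: nat
    and \<A> :: "real^3" and \<theta> \<I> \<R> a\<^sub>1\<^sub>1 :: real
  assumes "3 \<le> k" and "open W" and "0 \<in> W" and "Ck_on k \<xi> W"
    and "\<forall>p\<in>W. norm (\<xi> p) = 1"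
    and "\<forall>p\<in>parabolic_set \<xi> W. grad (KK \<xi>) p \<noteq> 0"
    and "\<xi> 0 = vector [0, 0, 1]"
    and "\<A> = vector [1, 0, 0]"
    and "0 \<in> parabolic_set \<xi> W"
    and "{v. asym_dir \<xi> 0 v} = {r *\<^sub>R \<A> | r. r \<noteq> 0}"
    and "a\<^sub>1\<^sub>1 = pd 1 (pd 1 (\<lambda>p. \<xi> p $ 1)) 0 / 2"
    and "\<theta> = vec_angle (grad (KK \<xi>) 0) \<A>"
    and "\<I> = norm (grad (KK \<xi>) 0) * norm \<A> * cos \<theta>"
    and "\<R> = curl \<xi> 0 \<bullet> \<xi> 0"
    and "\<theta> \<noteq> pi / 2"
  shows
    "(\<exists>\<Gamma>\<^sub>1 \<Gamma>\<^sub>2.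
        asym_arc_from \<xi> W 0 \<Gamma>\<^sub>1 \<and> asym_arc_from \<xi> W 0 \<Gamma>\<^sub>2 \<and> \<not> same_germ 0 \<Gamma>\<^sub>1 \<Gamma>\<^sub>2 \<and>
        (\<forall>\<Gamma>. asym_arc_from \<xi> W 0 \<Gamma> \<longrightarrow> same_germ 0 \<Gamma> \<Gamma>\<^sub>1 \<or> same_germ 0 \<Gamma> \<Gamma>\<^sub>2) \<and>
        (\<exists>\<epsilon>>0. \<exists>\<gamma>. asym_param \<xi> W 0 \<epsilon> \<gamma> \<and>
           same_germ 0 \<Gamma>\<^sub>1 (\<gamma> ` {0..<\<epsilon>}) \<and> same_germ 0 \<Gamma>\<^sub>2 (\<gamma> ` {-\<epsilon><..0}) \<and>
           (\<lambda>t. \<gamma> t $ 1 - (- (3 powr (2/3) * root 3 \<I> / (2 powr (4/3) * (root 3 a\<^sub>1\<^sub>1)^2)) * t^2))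
             \<in> O[at 0](\<lambda>t. t^3) \<and>
           (\<lambda>t. \<gamma> t $ 2 - t^3) \<in> O[at 0](\<lambda>t. t^4) \<and>
           (\<lambda>t. \<gamma> t $ 3 - 3 powr (2/3) * root 3 \<I> * \<R> / (2 powr (7/3) * 5 * (root 3 a\<^sub>1\<^sub>1)^2) * t^5)
             \<in> O[at 0](\<lambda>t. t^6) \<and>
           (\<R> \<noteq> 0 \<longrightarrow> type_235 \<gamma>) \<and> cusp_230 0 \<gamma>)) \<and>
     (\<exists>U X\<^sub>1 X\<^sub>2 \<F>\<^sub>1 \<F>\<^sub>2. open U \<and> 0 \<in> U \<and> U \<subseteq> W \<and>
        asym_foliation \<xi> (U \<inter> hyperbolic_set \<xi> W) X\<^sub>1 \<F>\<^sub>1 \<and>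
        asym_foliation \<xi> (U \<inter> hyperbolic_set \<xi> W) X\<^sub>2 \<F>\<^sub>2 \<and>
        (\<forall>q\<in>U \<inter> hyperbolic_set \<xi> W.
           (\<forall>r. X\<^sub>1 q \<noteq> r *\<^sub>R X\<^sub>2 q) \<and>
           {v. asym_dir \<xi> q v} = {r *\<^sub>R X\<^sub>1 q | r. r \<noteq> 0} \<union> {r *\<^sub>R X\<^sub>2 q | r. r \<noteq> 0}) \<and>
        (\<forall>P\<in>U \<inter> parabolic_set \<xi> W.
           cuspidal_parabolic \<xi> W P \<and>
           (\<exists>!L. L \<in> \<F>\<^sub>1 \<and> leaf_starts_at \<xi> W L P) \<and>
           (\<exists>!L. L \<in> \<F>\<^sub>2 \<and> leaf_starts_at \<xi> W L P) \<and>
           (\<forall>L\<^sub>1\<in>\<F>\<^sub>1. \<forall>L\<^sub>2\<in>\<F>\<^sub>2. leaf_starts_at \<xi> W L\<^sub>1 P \<and> leaf_starts_at \<xi> W L\<^sub>2 P \<longrightarrow>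
              (\<exists>\<epsilon>>0. \<exists>\<gamma>. asym_param \<xi> W P \<epsilon> \<gamma> \<and>
                 same_germ P (insert P L\<^sub>1) (\<gamma> ` {0..<\<epsilon>}) \<and>
                 same_germ P (insert P L\<^sub>2) (\<gamma> ` {-\<epsilon><..0}) \<and>
                 (curl \<xi> P \<bullet> \<xi> P \<noteq> 0 \<longrightarrow> type_235_at \<xi> P \<gamma>) \<and> cusp_230 P \<gamma>))))"
proof -
  have \<xi>3: "Ck_on 3 \<xi> W" by (rule Ck_on_le[OF assms(4,1)])
  have \<xi>1: "Ck_on 1 \<xi> W" by (rule Ck_on_le[OF \<xi>3]) simp
  have d: "\<xi> differentiable (at 0)" using \<xi>1 assms(3) by simp
  have c: "\<xi> 0 $ 3 \<noteq> 0" using assms(7) by simp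
  have K0: "KK \<xi> 0 = 0" using assms(9) by (simp add: parabolic_set_def)
  note nf = parabolic_normal_form[OF d assms(7) assms(10)[unfolded assms(8)]]
  have d0: "dir0 \<xi> 0 = \<A>" by (simp add: dir0_def nf(2) assms(7,8))
  have gA: "grad (KK \<xi>) 0 \<bullet> \<A> = grad (KK \<xi>) 0 $ 1" by (simp add: assms(8) inner_vec_def sum_3)
  have nA: "norm \<A> = 1" by (simp add: assms(8) norm_eq_1 inner_vec_def sum_3)
  have Kx: "grad (KK \<xi>) 0 $ 1 \<noteq> 0"
  proof
    assume "grad (KK \<xi>) 0 $ 1 = 0"
    then have "\<theta> = pi / 2" unfolding assms(12) vec_angle_def gA by simp
    then show False using assms(15) by blast
  qed
  have \<I>: "\<I> = grad (KK \<xi>) 0 $ 1"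
  proof -
    have nz: "norm (grad (KK \<xi>) 0) > 0" using Kx by auto
    have "\<bar>grad (KK \<xi>) 0 $ 1\<bar> \<le> norm (grad (KK \<xi>) 0)" by (rule component_le_norm_cart)
    then have "\<bar>grad (KK \<xi>) 0 $ 1 / norm (grad (KK \<xi>) 0)\<bar> \<le> 1" using nz by (simp add: abs_divide)
    then show ?thesis using nz unfolding assms(13,12) vec_angle_def gA nA by (simp add: cos_arccos_abs)
  qed
  define W1 where "W1 = {p \<in> W. \<xi> p $ 3 \<noteq> 0}"
  have "continuous_on W (\<lambda>p. \<xi> p $ 3)"
    using Ck_on_le[OF Ck_on_nth[OF assms(2) \<xi>1], of 0] by simp
  then have "open (W \<inter> (\<lambda>p. \<xi> p $ 3) -` (- {0}))" using assms(2) by (intro continuous_open_preimage) auto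
  then have W1: "open W1" by (simp add: W1_def Int_def vimage_def)
  have "pd 1 (KK \<xi>) 0 = pd 1 (pd 1 (\<lambda>p. \<xi> p $ 1)) 0 * g_coeff \<xi> 0"
    by (rule pd1_KK_normal_form[OF W1 _ Ck_on_subset[OF Ck_on_le[OF \<xi>3]] _ assms(7) nf(1,2)])
      (use assms(3) c in \<open>auto simp: W1_def\<close>)
  then have Ia: "\<I> = 2 * a\<^sub>1\<^sub>1 * g_coeff \<xi> 0" by (simp add: \<I> grad_def assms(11))
  have I0: "\<I> \<noteq> 0" and a0: "a\<^sub>1\<^sub>1 \<noteq> 0" using Kx Ia \<I> by auto
  have "\<exists>r S \<Lambda> \<beta> \<kappa> u. cusp_box \<xi> W r S \<Lambda> \<beta> \<kappa> u"
    by (rule cusp_box_exists[OF assms(2,3) \<xi>3 assms(5) c nf(3) K0 Kx]) (simp add: d0 gA Kx)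
  then obtain r S \<Lambda> \<beta> \<kappa> u where "cusp_box \<xi> W r S \<Lambda> \<beta> \<kappa> u" by blast
  then interpret cusp_box \<xi> W r S \<Lambda> \<beta> \<kappa> u .
  have P: "0 \<in> U" using u by simp
  define \<mu> where "\<mu> = - ((root 3 3 * (root 3 \<I>)^2) / ((root 3 2)^2 * root 3 a\<^sub>1\<^sub>1))"
  note cc = cusp_constants[OF I0 a0 Ia, folded \<mu>_def]
  define \<gamma> where "\<gamma> = (\<lambda>t. sol 0 0 (\<mu> * t))"
  obtain C1 C2 C3 where C:
    "\<And>s. \<bar>s\<bar> < S \<Longrightarrow> \<bar>sol 0 0 s $ 1 + (1 / \<I>) * s^2\<bar> \<le> C1 * \<bar>s\<bar>^3"
    "\<And>s. \<bar>s\<bar> < S \<Longrightarrow> \<bar>sol 0 0 s $ 2 + (2 / (3 * \<I> * g_coeff \<xi> 0)) * s^3\<bar> \<le> C2 * \<bar>s\<bar>^4"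
    "\<And>s. \<bar>s\<bar> < S \<Longrightarrow> \<bar>sol 0 0 s $ 3 + (\<R> / (15 * \<I>^2 * g_coeff \<xi> 0)) * s^5\<bar> \<le> C3 * \<bar>s\<bar>^6"
    using normal_form_coordinates[OF K0 assms(7) nf(2)] unfolding \<I>[symmetric] assms(14)[symmetric] by metis
  define \<alpha> where "\<alpha> = 3 powr (2/3) * root 3 \<I> / (2 powr (4/3) * (root 3 a\<^sub>1\<^sub>1)^2)"
  define \<zeta> where "\<zeta> = 3 powr (2/3) * root 3 \<I> * \<R> / (2 powr (7/3) * 5 * (root 3 a\<^sub>1\<^sub>1)^2)"
  have coef: "(1 / \<I>) * (\<mu> * t)^2 = \<alpha> * t^2" "(2 / (3 * \<I> * g_coeff \<xi> 0)) * (\<mu> * t)^3 = - (t^3)"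
    "(\<R> / (15 * \<I>^2 * g_coeff \<xi> 0)) * (\<mu> * t)^5 = - (\<zeta> * t^5)" for t
    using cc(2,3) cc(4)[of \<R>] unfolding power_mult_distrib \<alpha>_def \<zeta>_def by (simp_all add: mult.assoc[symmetric])
  have O1: "(\<lambda>t. \<gamma> t $ 1 - (- \<alpha> * t^2)) \<in> O[at 0](\<lambda>t. t^3)"
    using bigo_power_rescaled[OF S(1) cc(1) C(1)] unfolding coef \<gamma>_def by simp
  have O2: "(\<lambda>t. \<gamma> t $ 2 - t^3) \<in> O[at 0](\<lambda>t. t^4)"
    using bigo_power_rescaled[OF S(1) cc(1) C(2)] unfolding coef \<gamma>_def by simp
  have O3: "(\<lambda>t. \<gamma> t $ 3 - \<zeta> * t^5) \<in> O[at 0](\<lambda>t. t^6)"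
    using bigo_power_rescaled[OF S(1) cc(1) C(3)] unfolding coef \<gamma>_def by simp
  have type: "type_235 \<gamma>" if R: "\<R> \<noteq> 0"
  proof -
    have nz: "\<alpha> \<noteq> 0" "\<zeta> \<noteq> 0" using R I0 a0 by (simp_all add: \<alpha>_def \<zeta>_def)
    have A1: "(\<lambda>t. (- 1 / \<alpha>) * (\<gamma> t $ 1 - (- \<alpha> * t^2))) \<in> O[at 0](\<lambda>t. t^3)"
      using O1 nz by (subst landau_o.big.cmult_in_iff) auto
    have A1': "(- 1 / \<alpha>) * (\<gamma> t $ 1 - (- \<alpha> * t^2)) = (- 1 / \<alpha>) * \<gamma> t $ 1 - t^2" for t
      using nz by (simp add: field_simps)
    have 1: "(\<lambda>t. (- 1 / \<alpha>) * \<gamma> t $ 1 - t^2) \<in> O[at 0](\<lambda>t. t^3)" using A1 unfolding A1' .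
    have A3: "(\<lambda>t. (1 / \<zeta>) * (\<gamma> t $ 3 - \<zeta> * t^5)) \<in> O[at 0](\<lambda>t. t^6)"
      using O3 nz by (subst landau_o.big.cmult_in_iff) auto
    have A3': "(1 / \<zeta>) * (\<gamma> t $ 3 - \<zeta> * t^5) = (1 / \<zeta>) * \<gamma> t $ 3 - t^5" for t
      using nz by (simp add: field_simps)
    have 3: "(\<lambda>t. (1 / \<zeta>) * \<gamma> t $ 3 - t^5) \<in> O[at 0](\<lambda>t. t^6)" using A3 unfolding A3' .
    show ?thesis unfolding type_235_def
      by (rule exI[of _ "- 1 / \<alpha>"], rule exI[of _ 1], rule exI[of _ "1 / \<zeta>"], intro conjI 1 3)
        (use nz O2 in auto)
  qed
  have cusp: "cusp_230 0 \<gamma>" unfolding \<gamma>_def by (rule cusp_230_curve[OF P cc(1)])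
  show ?thesis
  proof (rule asym_arcs_at[OF P K0 cc(1), folded \<gamma>_def])
    fix \<Gamma>1 \<Gamma>2 \<epsilon>
    assume G: "asym_arc_from \<xi> W 0 \<Gamma>1" "asym_arc_from \<xi> W 0 \<Gamma>2" "\<not> same_germ 0 \<Gamma>1 \<Gamma>2"
      "\<And>\<Gamma>. asym_arc_from \<xi> W 0 \<Gamma> \<Longrightarrow> same_germ 0 \<Gamma> \<Gamma>1 \<or> same_germ 0 \<Gamma> \<Gamma>2"
      "0 < \<epsilon>" "asym_param \<xi> W 0 \<epsilon> \<gamma>" "same_germ 0 \<Gamma>1 (\<gamma> ` {0..<\<epsilon>})" "same_germ 0 \<Gamma>2 (\<gamma> ` {-\<epsilon><..0})"
    have "asym_param \<xi> W 0 \<epsilon> \<gamma> \<and> same_germ 0 \<Gamma>1 (\<gamma> ` {0..<\<epsilon>}) \<and> same_germ 0 \<Gamma>2 (\<gamma> ` {-\<epsilon><..0}) \<and>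
      (\<lambda>t. \<gamma> t $ 1 - (- \<alpha> * t^2)) \<in> O[at 0](\<lambda>t. t^3) \<and> (\<lambda>t. \<gamma> t $ 2 - t^3) \<in> O[at 0](\<lambda>t. t^4) \<and>
      (\<lambda>t. \<gamma> t $ 3 - \<zeta> * t^5) \<in> O[at 0](\<lambda>t. t^6) \<and> (\<R> \<noteq> 0 \<longrightarrow> type_235 \<gamma>) \<and> cusp_230 0 \<gamma>"
      by (intro conjI impI G(6-8) O1 O2 O3 type cusp)
    with G(5) have "\<exists>\<epsilon>>0. \<exists>\<gamma>. asym_param \<xi> W 0 \<epsilon> \<gamma> \<and> same_germ 0 \<Gamma>1 (\<gamma> ` {0..<\<epsilon>}) \<and>
      same_germ 0 \<Gamma>2 (\<gamma> ` {-\<epsilon><..0}) \<and>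
      (\<lambda>t. \<gamma> t $ 1 - (- \<alpha> * t^2)) \<in> O[at 0](\<lambda>t. t^3) \<and> (\<lambda>t. \<gamma> t $ 2 - t^3) \<in> O[at 0](\<lambda>t. t^4) \<and>
      (\<lambda>t. \<gamma> t $ 3 - \<zeta> * t^5) \<in> O[at 0](\<lambda>t. t^6) \<and> (\<R> \<noteq> 0 \<longrightarrow> type_235 \<gamma>) \<and> cusp_230 0 \<gamma>"
      by blast
    note part1 = this
    show ?thesis
      unfolding \<alpha>_def[symmetric] \<zeta>_def[symmetric]
    proof (rule conjI)
      show "\<exists>\<Gamma>\<^sub>1 \<Gamma>\<^sub>2. asym_arc_from \<xi> W 0 \<Gamma>\<^sub>1 \<and> asym_arc_from \<xi> W 0 \<Gamma>\<^sub>2 \<and> \<not> same_germ 0 \<Gamma>\<^sub>1 \<Gamma>\<^sub>2 \<and>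
        (\<forall>\<Gamma>. asym_arc_from \<xi> W 0 \<Gamma> \<longrightarrow> same_germ 0 \<Gamma> \<Gamma>\<^sub>1 \<or> same_germ 0 \<Gamma> \<Gamma>\<^sub>2) \<and>
        (\<exists>\<epsilon>>0. \<exists>\<gamma>. asym_param \<xi> W 0 \<epsilon> \<gamma> \<and>
           same_germ 0 \<Gamma>\<^sub>1 (\<gamma> ` {0..<\<epsilon>}) \<and> same_germ 0 \<Gamma>\<^sub>2 (\<gamma> ` {-\<epsilon><..0}) \<and>
           (\<lambda>t. \<gamma> t $ 1 - (- \<alpha> * t^2)) \<in> O[at 0](\<lambda>t. t^3) \<and>
           (\<lambda>t. \<gamma> t $ 2 - t^3) \<in> O[at 0](\<lambda>t. t^4) \<and>
           (\<lambda>t. \<gamma> t $ 3 - \<zeta> * t^5) \<in> O[at 0](\<lambda>t. t^6) \<and>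
           (\<R> \<noteq> 0 \<longrightarrow> type_235 \<gamma>) \<and> cusp_230 0 \<gamma>)"
        by (rule exI[of _ \<Gamma>1], rule exI[of _ \<Gamma>2], intro conjI G(1-3) part1) (use G(4) in blast)
    qed (rule foliations_of_asymptotic_lines[OF K0])
  qed
qed

end
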